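(* Let $M$ be a $3$-dimensional proper CR submanifold of the nearly Kähler manifold $(\mathbb{S}^3\times\mathbb{S}^3,g,J)$ such that $P\mathcal{D}_1=\mathcal{D}_1$ and $P\mathcal{D}_2=\mathcal{D}_2$. Then $M$ is locally congruent to one of the following three immersions: \begin{align*} f_1(u,v,t)&=\Big(\cos\big(\tfrac{\sqrt3}{2}u+\tfrac12v\big)+i\sin\big(\tfrac{\sqrt3}{2}u+\tfrac12v\big),\ A(t)\big(\cos(\tfrac{\sqrt3}{2}u-\tfrac12v)+i\sin(\tfrac{\sqrt3}{2}u-\tfrac12v)\big)\Big),\\ f_2(u,v,t)&=\Big(A(t)\big(\cos(\tfrac{\sqrt3}{2}u-\tfrac12v)+i\sin(\tfrac{\sqrt3}{2}u-\tfrac12v)\big),\ \cos\big(\tfrac{\sqrt3}{2}u+\tfrac12v\big)+i\sin\big(\tfrac{\sqrt3}{2}u+\tfrac12v\big)\Big),\\ f_3(u,v,t)&=\Big((\cos v+i\sin v)\,\overline{A(t)},\ \big(\cos(\tfrac{\sqrt3}{2}u-\tfrac12v)-i\sin(\tfrac{\sqrt3}{2}u-\tfrac12v)\big)\overline{A(t)}\Big), \end{align*} where $A(t)=a_1(t)+a_2(t)j$ is a unit quaternion for each $t$, with $a_1(t),a_2(t)\in\mathbb{C}$ satisfying \begin{align*} a_1'(t)&=-\tfrac{\sqrt3}{2}a_2(t)e^{-if(t)},\\ a_2'(t)&=\tfrac{\sqrt3}{2}a_1(t)e^{if(t)} \end{align*} for some real-valued differentiable function $f$ of $t$.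
   Context: Identify $\mathbb{S}^3$ with the unit quaternions in $\mathbb{H}=\mathbb{R}^4$ with standard imaginary units $i,j,k$, and $\mathbb{C}=\mathrm{span}_{\mathbb{R}}\{1,i\}\subset\mathbb{H}$; $\overline{A}$ denotes quaternionic conjugation. A tangent vector of $\mathbb{S}^3\times\mathbb{S}^3$ at $(p,q)$ is written $Z=(p\alpha,q\beta)$ with $\alpha,\beta\in\mathrm{Im}\,\mathbb{H}$. The almost complex structure is $J(p\alpha,q\beta)=\frac{1}{\sqrt3}\big(p(2\beta-\alpha),q(-2\alpha+\beta)\big)$, and the nearly Kähler metric is $g(Z,Z')=\frac12(\langle Z,Z'\rangle+\langle JZ,JZ'\rangle)$, where $\langle\cdot,\cdot\rangle$ is the standard product metric induced from $\mathbb{R}^4\times\mathbb{R}^4$. Let $\widetilde\nabla$ be the Levi-Civita connection of $g$ and $G(X,Y)=(\widetilde\nabla_XJ)Y$, a skew-symmetric tensor. The almost product structure $P$ is $P(p\alpha,q\beta)=(p\beta,q\alpha)$. All objects are smooth. A submanifold $M$ is a CR submanifold if there is a smooth distribution $\mathcal{D}_1\subseteq TM$ with $J\mathcal{D}_1=\mathcal{D}_1$ whose $g$-orthogonal complement $\mathcal{D}_1^\perp$ in $TM$ is totally real, i.e. $J\mathcal{D}_1^\perp\subseteq T^\perp M$. It is proper if it is neither almost complex nor totally real. For a $3$-dimensional proper CR submanifold, $\mathcal{D}_1=JTM\cap TM$ has rank $2$ and $\mathcal{D}_1^\perp$ has rank $1$. Along such $M$ put $\mathcal{D}_2=\mathcal{D}_1^\perp\oplus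 J\mathcal{D}_1^\perp$ and $\mathcal{D}_3=G(\mathcal{D}_1,\mathcal{D}_2)$. These are $J$-invariant rank-$2$ bundles over $M$, and $T(\mathbb{S}^3\times\mathbb{S}^3)|_M=\mathcal{D}_1\oplus\mathcal{D}_2\oplus\mathcal{D}_3$ is a $g$-orthogonal decomposition. For unit quaternions $a,b,c$, the map $\mathcal{F}_{abc}(p,q)=(ap\bar c,bq\bar c)$ is an isometry of $(\mathbb{S}^3\times\mathbb{S}^3,g)$ preserving $J$ and $P$. "$M$ is locally congruent to one of the immersions" means: each point of $M$ has a neighbourhood which is the image, under some $\mathcal{F}_{abc}$, of the restriction of one of the listed immersions (for some choice of the data $f$, $A$) to an open set of parameters. *)

theory Defs
  imports "HOL-Analysis.Analysis"
begin

section \<open>Quaternions\<close>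

text \<open>The pair \<open>(z, w)\<close> stands for the quaternion \<open>z + w j\<close> with \<open>z, w\<close> in
  \<open>\<complex> = span {1, i}\<close>; the product below is forced by \<open>j z = cnj z j\<close> and \<open>j j = -1\<close>.
  The library's inner product and norm on \<open>complex \<times> complex\<close> are the Euclidean ones of \<open>\<real>\<^sup>4\<close>.\<close>

type_synonym quat = "complex \<times> complex"

definition qmult :: "quat \<Rightarrow> quat \<Rightarrow> quat"  (infixl "*\<^sub>H" 70) where
  "x *\<^sub>H y = (fst x * fst y - snd x * cnj (snd y), fst x * snd y + snd x * cnj (fst y))"

definition qcnj :: "quat \<Rightarrow> quat" where
  "qcnj x = (cnj (fst x), - snd x)"

definition quat_of_complex :: "complex \<Rightarrow> quat" where
  "quat_of_complex z = (z, 0)"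

definition Im_quat :: "quat set" where
  "Im_quat = {x. Re (fst x) = 0}"

definition unit_quat :: "quat set" where
  "unit_quat = {x. norm x = 1}"

definition quat_i :: quat where "quat_i = (\<i>, 0)"
definition quat_j :: quat where "quat_j = (0, 1)"
definition quat_k :: quat where "quat_k = (0, \<i>)"

lemma quat_units:
  "quat_i *\<^sub>H quat_i = (-1, 0)" "quat_j *\<^sub>H quat_j = (-1, 0)" "quat_k *\<^sub>H quat_k = (-1, 0)"
  "quat_i *\<^sub>H quat_j = quat_k" "quat_j *\<^sub>H quat_k = quat_i" "quat_k *\<^sub>H quat_i = quat_j"
  "quat_j *\<^sub>H quat_i = - quat_k" "quat_k *\<^sub>H quat_j = - quat_i" "quat_i *\<^sub>H quat_k = - quat_j"
  by (simp_all add: quat_i_def quat_j_def quat_k_def qmult_def)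

lemma quat_split: "quat_of_complex z + quat_of_complex w *\<^sub>H quat_j = (z, w)"
  by (simp add: quat_of_complex_def quat_j_def qmult_def)

lemma qmult_assoc: "(x *\<^sub>H y) *\<^sub>H z = x *\<^sub>H (y *\<^sub>H z)"
  by (simp add: qmult_def algebra_simps)

lemma qmult_qcnj: "x *\<^sub>H qcnj x = quat_of_complex (of_real ((norm x)\<^sup>2))"
  by (simp add: qmult_def qcnj_def quat_of_complex_def norm_prod_def
      complex_norm_square[symmetric] del: of_real_power)

section \<open>The nearly Kaehler manifold \<open>S\<^sup>3 \<times> S\<^sup>3\<close>\<close>

definition S3S3 :: "(quat \<times> quat) set" where
  "S3S3 = unit_quat \<times> unit_quat"

definition tangent_S3S3 :: "quat \<times> quat \<Rightarrow> (quat \<times> quat) set" where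
  "tangent_S3S3 x =
     {(fst x *\<^sub>H \<alpha>, snd x *\<^sub>H \<beta>) | \<alpha> \<beta>. \<alpha> \<in> Im_quat \<and> \<beta> \<in> Im_quat}"

text \<open>At a point \<open>x = (p, q)\<close> of \<open>S\<^sup>3 \<times> S\<^sup>3\<close> a tangent vector \<open>Z = (p \<alpha>, q \<beta>)\<close> has
  \<open>\<alpha> = cnj p (p \<alpha>)\<close> and \<open>\<beta> = cnj q (q \<beta>)\<close>. The tensors below are written in these terms and
  are meaningful for \<open>Z \<in> tangent_S3S3 x\<close> only.\<close>

definition J_nk :: "quat \<times> quat \<Rightarrow> quat \<times> quat \<Rightarrow> quat \<times> quat" where
  "J_nk x Z =
     (let p = fst x; q = snd x; \<alpha> = qcnj p *\<^sub>H fst Z; \<beta> = qcnj q *\<^sub>H snd Z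
      in (1 / sqrt 3) *\<^sub>R (p *\<^sub>H (2 *\<^sub>R \<beta> - \<alpha>), q *\<^sub>H ((-2) *\<^sub>R \<alpha> + \<beta>)))"

definition P_nk :: "quat \<times> quat \<Rightarrow> quat \<times> quat \<Rightarrow> quat \<times> quat" where
  "P_nk x Z =
     (let p = fst x; q = snd x; \<alpha> = qcnj p *\<^sub>H fst Z; \<beta> = qcnj q *\<^sub>H snd Z
      in (p *\<^sub>H \<beta>, q *\<^sub>H \<alpha>))"

definition g_nk :: "quat \<times> quat \<Rightarrow> quat \<times> quat \<Rightarrow> quat \<times> quat \<Rightarrow> real" where
  "g_nk x Z Z' = (1 / 2) * (Z \<bullet> Z' + J_nk x Z \<bullet> J_nk x Z')"

definition F_isom :: "quat \<Rightarrow> quat \<Rightarrow> quat \<Rightarrow> quat \<times> quat \<Rightarrow> quat \<times> quat" where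
  "F_isom a b c x = (a *\<^sub>H fst x *\<^sub>H qcnj c, b *\<^sub>H snd x *\<^sub>H qcnj c)"

lemma qmult_scaleR_right: "x *\<^sub>H (r *\<^sub>R y) = r *\<^sub>R (x *\<^sub>H y)"
  by (simp add: qmult_def scaleR_conv_of_real algebra_simps)

lemma qcnj_cancel:
  assumes "p \<in> unit_quat" shows "qcnj p *\<^sub>H (p *\<^sub>H z) = z"
proof -
  have "norm (qcnj p) = 1" and "qcnj (qcnj p) = p"
    using assms by (simp_all add: unit_quat_def qcnj_def norm_prod_def)
  then have "qcnj p *\<^sub>H p = quat_of_complex 1"
    using qmult_qcnj[of "qcnj p"] by simp
  then show ?thesis
    by (simp add: qmult_assoc[symmetric]) (simp add: quat_of_complex_def qmult_def)
qed

lemma J_nk_tangent: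
  assumes "p \<in> unit_quat" "q \<in> unit_quat"
  shows "J_nk (p, q) (p *\<^sub>H \<alpha>, q *\<^sub>H \<beta>) =
    (1 / sqrt 3) *\<^sub>R (p *\<^sub>H (2 *\<^sub>R \<beta> - \<alpha>), q *\<^sub>H ((-2) *\<^sub>R \<alpha> + \<beta>))"
  using assms by (simp add: J_nk_def qcnj_cancel)

lemma P_nk_tangent:
  assumes "p \<in> unit_quat" "q \<in> unit_quat"
  shows "P_nk (p, q) (p *\<^sub>H \<alpha>, q *\<^sub>H \<beta>) = (p *\<^sub>H \<beta>, q *\<^sub>H \<alpha>)"
  using assms by (simp add: P_nk_def qcnj_cancel)

section \<open>Three-dimensional submanifolds\<close>

text \<open>\<open>C\<^sup>k\<close> and smooth maps on an open set, in terms of iterated directional derivatives.\<close>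

fun Ck_on :: "nat \<Rightarrow> 'a::euclidean_space set \<Rightarrow> ('a \<Rightarrow> 'b::euclidean_space) \<Rightarrow> bool" where
  "Ck_on 0 S f \<longleftrightarrow> continuous_on S f"
| "Ck_on (Suc k) S f \<longleftrightarrow> (\<forall>x\<in>S. f differentiable (at x)) \<and>
     (\<forall>h. Ck_on k S (\<lambda>x. frechet_derivative f (at x) h))"

definition smooth_on :: "'a::euclidean_space set \<Rightarrow> ('a \<Rightarrow> 'b::euclidean_space) \<Rightarrow> bool" where
  "smooth_on S f \<longleftrightarrow> (\<forall>k. Ck_on k S f)"

text \<open>A submanifold is given by a space \<open>M\<close> and a map \<open>\<iota>\<close> into \<open>S\<^sup>3 \<times> S\<^sup>3\<close>, which need not be
  injective; an embedded submanifold \<open>S\<close> is the case \<open>M = top_of_set S\<close>, \<open>\<iota> = id\<close>.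
  A local parametrization is the inverse of a chart of \<open>M\<close> in which \<open>\<iota>\<close> is a smooth immersion.
  Transition maps between two of these are automatically smooth, so they form an atlas.\<close>

type_synonym R3 = "real \<times> real \<times> real"

definition local_param ::
    "'m topology \<Rightarrow> ('m \<Rightarrow> quat \<times> quat) \<Rightarrow> R3 set \<Rightarrow> (R3 \<Rightarrow> 'm) \<Rightarrow> bool" where
  "local_param M \<iota> V \<psi> \<longleftrightarrow>
     open V \<and> openin M (\<psi> ` V) \<and>
     homeomorphic_map (top_of_set V) (subtopology M (\<psi> ` V)) \<psi> \<and>
     smooth_on V (\<iota> \<circ> \<psi>) \<and>
     (\<forall>v\<in>V. inj (frechet_derivative (\<iota> \<circ> \<psi>) (at v)))"

definition submanifold3 :: "'m topology \<Rightarrow> ('m \<Rightarrow> quat \<times> quat) \<Rightarrow> bool" where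
  "submanifold3 M \<iota> \<longleftrightarrow>
     Hausdorff_space M \<and> second_countable M \<and> \<iota> ` topspace M \<subseteq> S3S3 \<and>
     (\<forall>x\<in>topspace M. \<exists>V \<psi>. local_param M \<iota> V \<psi> \<and> x \<in> \<psi> ` V)"

text \<open>The range of the differential does not depend on the local parametrization around \<open>x\<close>, so
  the existential quantifier over parametrizations amounts to choosing any one of them.\<close>

definition tangent_space ::
    "'m topology \<Rightarrow> ('m \<Rightarrow> quat \<times> quat) \<Rightarrow> 'm \<Rightarrow> (quat \<times> quat) set" where
  "tangent_space M \<iota> x =
     {Z. \<exists>V \<psi> v. local_param M \<iota> V \<psi> \<and> v \<in> V \<and> \<psi> v = x \<and>
                Z \<in> range (frechet_derivative (\<iota> \<circ> \<psi>) (at v))}"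

definition normal_space ::
    "'m topology \<Rightarrow> ('m \<Rightarrow> quat \<times> quat) \<Rightarrow> 'm \<Rightarrow> (quat \<times> quat) set" where
  "normal_space M \<iota> x =
     {Z \<in> tangent_S3S3 (\<iota> x). \<forall>Y\<in>tangent_space M \<iota> x. g_nk (\<iota> x) Z Y = 0}"

text \<open>Distributions have constant rank \<open>r\<close> on all of \<open>M\<close>, which is not assumed connected.\<close>

definition smooth_distribution ::
    "'m topology \<Rightarrow> ('m \<Rightarrow> quat \<times> quat) \<Rightarrow> nat \<Rightarrow> ('m \<Rightarrow> (quat \<times> quat) set) \<Rightarrow> bool" where
  "smooth_distribution M \<iota> r D \<longleftrightarrow>
     (\<forall>x\<in>topspace M. D x \<subseteq> tangent_space M \<iota> x \<and> subspace (D x) \<and> dim (D x) = r) \<and>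
     (\<forall>x\<in>topspace M. \<exists>V \<psi> X.
        local_param M \<iota> V \<psi> \<and> x \<in> \<psi> ` V \<and>
        (\<forall>i<r. smooth_on V (X i)) \<and>
        (\<forall>v\<in>V. D (\<psi> v) = span ((\<lambda>i. X i v) ` {..<r})))"

definition orth_compl_in_TM :: "'m topology \<Rightarrow> ('m \<Rightarrow> quat \<times> quat) \<Rightarrow>
    ('m \<Rightarrow> (quat \<times> quat) set) \<Rightarrow> 'm \<Rightarrow> (quat \<times> quat) set" where
  "orth_compl_in_TM M \<iota> D x =
     {Z \<in> tangent_space M \<iota> x. \<forall>Y\<in>D x. g_nk (\<iota> x) Z Y = 0}"

definition CR_submanifold3 :: "'m topology \<Rightarrow> ('m \<Rightarrow> quat \<times> quat) \<Rightarrow> bool" where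
  "CR_submanifold3 M \<iota> \<longleftrightarrow> submanifold3 M \<iota> \<and>
     (\<exists>r D. smooth_distribution M \<iota> r D \<and>
        (\<forall>x\<in>topspace M.
           J_nk (\<iota> x) ` D x = D x \<and>
           J_nk (\<iota> x) ` orth_compl_in_TM M \<iota> D x \<subseteq> normal_space M \<iota> x))"

definition almost_complex_submanifold :: "'m topology \<Rightarrow> ('m \<Rightarrow> quat \<times> quat) \<Rightarrow> bool" where
  "almost_complex_submanifold M \<iota> \<longleftrightarrow>
     (\<forall>x\<in>topspace M. J_nk (\<iota> x) ` tangent_space M \<iota> x = tangent_space M \<iota> x)"

definition totally_real_submanifold :: "'m topology \<Rightarrow> ('m \<Rightarrow> quat \<times> quat) \<Rightarrow> bool" where
  "totally_real_submanifold M \<iota> \<longleftrightarrow>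
     (\<forall>x\<in>topspace M. J_nk (\<iota> x) ` tangent_space M \<iota> x \<subseteq> normal_space M \<iota> x)"

definition proper_CR_submanifold3 :: "'m topology \<Rightarrow> ('m \<Rightarrow> quat \<times> quat) \<Rightarrow> bool" where
  "proper_CR_submanifold3 M \<iota> \<longleftrightarrow>
     CR_submanifold3 M \<iota> \<and> \<not> almost_complex_submanifold M \<iota> \<and> \<not> totally_real_submanifold M \<iota>"

definition D1 ::
    "'m topology \<Rightarrow> ('m \<Rightarrow> quat \<times> quat) \<Rightarrow> 'm \<Rightarrow> (quat \<times> quat) set" where
  "D1 M \<iota> x = J_nk (\<iota> x) ` tangent_space M \<iota> x \<inter> tangent_space M \<iota> x"

definition D1_perp ::
    "'m topology \<Rightarrow> ('m \<Rightarrow> quat \<times> quat) \<Rightarrow> 'm \<Rightarrow> (quat \<times> quat) set" where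
  "D1_perp M \<iota> = orth_compl_in_TM M \<iota> (D1 M \<iota>)"

definition D2 ::
    "'m topology \<Rightarrow> ('m \<Rightarrow> quat \<times> quat) \<Rightarrow> 'm \<Rightarrow> (quat \<times> quat) set" where
  "D2 M \<iota> x = {Y + Z | Y Z. Y \<in> D1_perp M \<iota> x \<and> Z \<in> J_nk (\<iota> x) ` D1_perp M \<iota> x}"

section \<open>The model immersions\<close>

text \<open>\<open>A t = (a\<^sub>1 t, a\<^sub>2 t)\<close> is the quaternion \<open>a\<^sub>1 t + a\<^sub>2 t j\<close>.\<close>

definition admissible_data :: "(real \<Rightarrow> real) \<Rightarrow> (real \<Rightarrow> quat) \<Rightarrow> bool" where
  "admissible_data f A \<longleftrightarrow>
     (\<forall>t. f differentiable (at t)) \<and> (\<forall>t. A t \<in> unit_quat) \<and>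
     (\<forall>t. ((\<lambda>s. fst (A s)) has_vector_derivative
             - complex_of_real (sqrt 3 / 2) * snd (A t) * exp (- \<i> * complex_of_real (f t))) (at t)) \<and>
     (\<forall>t. ((\<lambda>s. snd (A s)) has_vector_derivative
             complex_of_real (sqrt 3 / 2) * fst (A t) * exp (\<i> * complex_of_real (f t))) (at t))"

definition immersion1 :: "(real \<Rightarrow> quat) \<Rightarrow> R3 \<Rightarrow> quat \<times> quat" where
  "immersion1 A = (\<lambda>(u, v, t).
     (quat_of_complex (cis (sqrt 3 / 2 * u + v / 2)),
      A t *\<^sub>H quat_of_complex (cis (sqrt 3 / 2 * u - v / 2))))"

definition immersion2 :: "(real \<Rightarrow> quat) \<Rightarrow> R3 \<Rightarrow> quat \<times> quat" where
  "immersion2 A = (\<lambda>(u, v, t).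
     (A t *\<^sub>H quat_of_complex (cis (sqrt 3 / 2 * u - v / 2)),
      quat_of_complex (cis (sqrt 3 / 2 * u + v / 2))))"

definition immersion3 :: "(real \<Rightarrow> quat) \<Rightarrow> R3 \<Rightarrow> quat \<times> quat" where
  "immersion3 A = (\<lambda>(u, v, t).
     (quat_of_complex (cis v) *\<^sub>H qcnj (A t),
      quat_of_complex (cnj (cis (sqrt 3 / 2 * u - v / 2))) *\<^sub>H qcnj (A t)))"

text \<open>A neighbourhood \<open>W\<close> of \<open>x\<close> in \<open>M\<close>, identified with \<open>\<iota> ` W\<close>, is the image of a restriction
  of \<open>\<phi>\<close> under some \<open>F_isom\<close>. The embedding condition justifies the identification and is
  automatic when \<open>\<iota>\<close> is an inclusion.\<close>

definition locally_congruent_at ::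
    "'m topology \<Rightarrow> ('m \<Rightarrow> quat \<times> quat) \<Rightarrow> 'm \<Rightarrow> (R3 \<Rightarrow> quat \<times> quat) \<Rightarrow> bool" where
  "locally_congruent_at M \<iota> x \<phi> \<longleftrightarrow>
     (\<exists>W U a b c. openin M W \<and> x \<in> W \<and> embedding_map (subtopology M W) euclidean \<iota> \<and>
        open U \<and> a \<in> unit_quat \<and> b \<in> unit_quat \<and> c \<in> unit_quat \<and>
        \<iota> ` W = F_isom a b c ` (\<phi> ` U))"

end

(* Left translation identifies the tangent space of S^3 x S^3 with Im H (x) R^2, on which J and P act on
   the factor R^2 and generate all of M_2(R). Hence P D1 = D1 and P D2 = D2 give orthonormal imaginary
   quaternions xi, eta and a vector w in R^2 with D1 = xi (x) R^2 and D1_perp = R (eta (x) w). The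
   Maurer-Cartan equations of the two factors force w, up to scaling, to be (1,0), (0,1) or (1,1), and the
   type is locally constant. The swap of the factors and (p, q) |-> (cnj p, q cnj p) reduce everything to
   w = (1,0). There, differentiating the Maurer-Cartan equations once more shows that xi is constant, say
   xi = i; the dual coframe a, b, s is then closed, and in coordinates with dA = a, dB = b, dS = s one finds
   q = q0 exp(iB) and p = G(S) exp(iA) with G' = G (e(S) j), |e| = 1. The curve G is the curve A(t)
   of the model immersion up to the speed of the parameter. *)

theory Submission
  imports Defs
begin

subsection \<open>Directional derivatives and \<open>C\<^sup>k\<close> maps\<close>

text \<open>The frame xi, eta and the vector w come from linear algebra at a single point, so they
  carry sign and scale ambiguities and no regularity. This shapes the proof: whatever must be
  continuous or smooth across points is expressed by commutators of Maurer-Cartan forms on fixed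
  parameter vectors, which point along xi eta whatever the choices. Orthogonality of this normal
  field to both forms, differentiated once, gives an equation for each factor and each pair of
  vectors. If both components of w are nonzero, the two factors compute the same derivative as -4
  w1^2 and as -4 w1 w2, and this is why only three directions survive. The directions (0,1), (1,0),
  (1,1) lead to the first, second and third model. A second obstacle is that
  \<open>admissible_data\<close> asks for f and A on the whole real line, whereas integration yields
  a curve over a short interval. As f need only be differentiable, it can be continued by its
  tangent lines, along which the equation for A has a closed solution.\<close>

abbreviation dd :: "'a::euclidean_space \<Rightarrow> ('a \<Rightarrow> 'b::euclidean_space) \<Rightarrow> 'a \<Rightarrow> 'b" where
  "dd h f \<equiv> (\<lambda>x. frechet_derivative f (at x) h)"

lemma frechet_derivative_worksI: "f differentiable F \<Longrightarrow> (f has_derivative frechet_derivative f F) F"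
  by (simp add: frechet_derivative_works)

lemma dd_eqI: "(f has_derivative f') (at x) \<Longrightarrow> dd h f x = f' h"
  using frechet_derivative_at by metis

lemma dd_bilinear:
  assumes "bounded_bilinear B" "f differentiable (at x)" "g differentiable (at x)"
  shows "dd h (\<lambda>x. B (f x) (g x)) x = B (f x) (dd h g x) + B (dd h f x) (g x)"
  using bounded_bilinear.FDERIV[OF assms(1) frechet_derivative_worksI[OF assms(2)] frechet_derivative_worksI[OF assms(3)]]
  by (rule dd_eqI)

lemma differentiable_bilinear:
  assumes "bounded_bilinear B" "f differentiable (at x)" "g differentiable (at x)"
  shows "(\<lambda>x. B (f x) (g x)) differentiable (at x)"
  using bounded_bilinear.FDERIV[OF assms(1) frechet_derivative_worksI[OF assms(2)] frechet_derivative_worksI[OF assms(3)]]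
  by (rule differentiableI)

lemma dd_linear:
  assumes "bounded_linear L" "f differentiable (at x)"
  shows "dd h (\<lambda>x. L (f x)) x = L (dd h f x)"
  using bounded_linear.has_derivative[OF assms(1) frechet_derivative_worksI[OF assms(2)]]
  by (rule dd_eqI)

lemma differentiable_linear:
  assumes "bounded_linear L" "f differentiable (at x)"
  shows "(\<lambda>x. L (f x)) differentiable (at x)"
  using bounded_linear.has_derivative[OF assms(1) frechet_derivative_worksI[OF assms(2)]]
  by (rule differentiableI)

lemma dd_add:
  assumes "f differentiable (at x)" "g differentiable (at x)"
  shows "dd h (\<lambda>x. f x + g x) x = dd h f x + dd h g x"
  using has_derivative_add[OF frechet_derivative_worksI[OF assms(1)] frechet_derivative_worksI[OF assms(2)]]
  by (rule dd_eqI)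

lemma dd_cong:
  assumes "open S" "x \<in> S" "\<And>y. y \<in> S \<Longrightarrow> f y = g y"
  shows "dd h f x = dd h g x"
proof -
  have "(f has_derivative f') (at x) \<longleftrightarrow> (g has_derivative f') (at x)" for f'
    using has_derivative_transform_within_open[of f f' x UNIV S g]
      has_derivative_transform_within_open[of g f' x UNIV S f] assms by auto
  then show ?thesis by (simp add: frechet_derivative_def)
qed

lemma differentiable_cong:
  assumes "open S" "x \<in> S" "\<And>y. y \<in> S \<Longrightarrow> f y = g y"
  shows "f differentiable (at x) \<longleftrightarrow> g differentiable (at x)"
proof -
  have "(f has_derivative f') (at x) \<longleftrightarrow> (g has_derivative f') (at x)" for f'
    using has_derivative_transform_within_open[of f f' x UNIV S g]
      has_derivative_transform_within_open[of g f' x UNIV S f] assms by auto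
  then show ?thesis by (simp add: differentiable_def)
qed

lemma dd_const [simp]: "dd h (\<lambda>x. c) x = 0"
  by (simp add: frechet_derivative_const)

lemma linear_dd: "f differentiable (at x) \<Longrightarrow> linear (\<lambda>h. dd h f x)"
  by (rule linear_frechet_derivative)

lemma Ck_on_cong:
  assumes "open S" "\<And>x. x \<in> S \<Longrightarrow> f x = g x"
  shows "Ck_on k S f \<longleftrightarrow> Ck_on k S g"
  using assms(2)
proof (induction k arbitrary: f g)
  case 0
  then show ?case by (simp cong: continuous_on_cong)
next
  case (Suc k)
  have "Ck_on k S (dd h f) \<longleftrightarrow> Ck_on k S (dd h g)" for h
    by (rule Suc.IH) (rule dd_cong[OF assms(1)], use Suc.prems in auto)
  moreover have "f differentiable (at x) \<longleftrightarrow> g differentiable (at x)" if "x \<in> S" for x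
    by (rule differentiable_cong[OF assms(1)]) (use Suc.prems that in auto)
  ultimately show ?case by simp
qed

lemma Ck_on_subset: "Ck_on k S f \<Longrightarrow> T \<subseteq> S \<Longrightarrow> Ck_on k T f"
  by (induction k arbitrary: f) (auto intro: continuous_on_subset)

text \<open>The product rule leaves one factor undifferentiated, so the induction in
  \<open>Ck_on_bilinear\<close> has to lower that factor by one class.\<close>

lemma Ck_on_Suc_imp: "Ck_on (Suc k) S f \<Longrightarrow> Ck_on k S f"
proof (induction k arbitrary: f)
  case 0
  then show ?case
    by (auto intro!: continuous_at_imp_continuous_on differentiable_imp_continuous_within)
next
  case (Suc k)
  then show ?case by simp
qed

lemma Ck_on_const: "Ck_on k S (\<lambda>x. c)"
  by (induction k arbitrary: c) (auto simp: frechet_derivative_const)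

lemma Ck_on_linear:
  assumes "bounded_linear L" "open S" "Ck_on k S f"
  shows "Ck_on k S (\<lambda>x. L (f x))"
  using assms(3)
proof (induction k arbitrary: f)
  case 0
  then show ?case using bounded_linear.continuous_on[OF assms(1)] by auto
next
  case (Suc k)
  have "Ck_on k S (dd h (\<lambda>x. L (f x)))" for h
    using Ck_on_cong[OF assms(2), of "dd h (\<lambda>x. L (f x))" "\<lambda>x. L (dd h f x)"] Suc
    by (auto simp: dd_linear[OF assms(1)])
  then show ?case
    using Suc.prems differentiable_linear[OF assms(1)] by auto
qed

lemma Ck_on_add:
  assumes "open S" "Ck_on k S f" "Ck_on k S g"
  shows "Ck_on k S (\<lambda>x. f x + g x)"
  using assms(2,3)
proof (induction k arbitrary: f g)
  case 0
  then show ?case by (auto intro: continuous_on_add)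
next
  case (Suc k)
  have "Ck_on k S (dd h (\<lambda>x. f x + g x))" for h
    using Ck_on_cong[OF assms(1), of "dd h (\<lambda>x. f x + g x)" "\<lambda>x. dd h f x + dd h g x"] Suc
    by (auto simp: dd_add)
  then show ?case using Suc.prems by (auto intro: differentiable_add)
qed

lemma Ck_on_bilinear:
  assumes "bounded_bilinear B" "open S" "Ck_on k S f" "Ck_on k S g"
  shows "Ck_on k S (\<lambda>x. B (f x) (g x))"
  using assms(3,4)
proof (induction k arbitrary: f g)
  case 0
  then show ?case using bounded_bilinear.continuous_on[OF assms(1)] by auto
next
  case (Suc k)
  have "Ck_on k S (dd h (\<lambda>x. B (f x) (g x)))" for h
  proof -
    have "Ck_on k S (\<lambda>x. B (f x) (dd h g x))" "Ck_on k S (\<lambda>x. B (dd h f x) (g x))"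
      using Suc.IH Suc.prems Ck_on_Suc_imp[OF Suc.prems(1)] Ck_on_Suc_imp[OF Suc.prems(2)] by auto
    then have "Ck_on k S (\<lambda>x. B (f x) (dd h g x) + B (dd h f x) (g x))"
      by (rule Ck_on_add[OF assms(2)])
    then show ?thesis
      using Ck_on_cong[OF assms(2), of "dd h (\<lambda>x. B (f x) (g x))"
          "\<lambda>x. B (f x) (dd h g x) + B (dd h f x) (g x)"] Suc.prems
      by (auto simp: dd_bilinear[OF assms(1)])
  qed
  then show ?case
    using Suc.prems by (auto intro!: differentiable_bilinear[OF assms(1)])
qed

section \<open>Real powers and normalization of smooth maps\<close>

lemma has_derivative_powr_const:
  fixes f :: "'a::euclidean_space \<Rightarrow> real"
  assumes "f differentiable (at x)" "f x > 0"
  shows "((\<lambda>x. f x powr c) has_derivative (\<lambda>h. (c * f x powr (c - 1)) * dd h f x)) (at x)"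
proof -
  have "((\<lambda>t. t powr c) has_field_derivative c * f x powr (c - 1)) (at (f x))"
    using assms(2) by (rule has_real_derivative_powr)
  then have "((\<lambda>t. t powr c) has_derivative (*) (c * f x powr (c - 1))) (at (f x))"
    by (simp add: has_field_derivative_def)
  then show ?thesis
    by (rule has_derivative_compose[OF frechet_derivative_worksI[OF assms(1)]])
qed

text \<open>Each differentiation lowers the exponent by one, so the induction runs over all
  exponents \<open>c\<close> at once.\<close>

lemma Ck_on_powr:
  fixes f :: "'a::euclidean_space \<Rightarrow> real"
  assumes "open S" "Ck_on k S f" "\<And>x. x \<in> S \<Longrightarrow> f x > 0"
  shows "Ck_on k S (\<lambda>x. f x powr c)"
  using assms(2)
proof (induction k arbitrary: c)
  case 0
  then show ?case using assms(3) by (auto intro!: continuous_on_powr continuous_intros) fastforce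
next
  case (Suc k)
  have "Ck_on k S (dd h (\<lambda>x. f x powr c))" for h
  proof -
    have "Ck_on k S (\<lambda>x. (c * f x powr (c - 1)) * dd h f x)"
      using Suc.prems Ck_on_Suc_imp[OF Suc.prems]
      by (intro Ck_on_bilinear[OF bounded_bilinear_mult assms(1)] Ck_on_const Suc.IH) auto
    moreover have "dd h (\<lambda>x. f x powr c) x = (c * f x powr (c - 1)) * dd h f x" if "x \<in> S" for x
      by (rule dd_eqI[OF has_derivative_powr_const]) (use that assms(3) Suc.prems in auto)
    ultimately show ?thesis
      using Ck_on_cong[OF assms(1), of "dd h (\<lambda>x. f x powr c)" "\<lambda>x. (c * f x powr (c - 1)) * dd h f x" k]
      by simp
  qed
  moreover have "(\<lambda>x. f x powr c) differentiable (at x)" if "x \<in> S" for x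
    by (rule differentiableI[OF has_derivative_powr_const]) (use that assms(3) Suc.prems in auto)
  ultimately show ?case by simp
qed

lemma smooth_on_subset: "smooth_on S f \<Longrightarrow> T \<subseteq> S \<Longrightarrow> smooth_on T f"
  by (auto simp: smooth_on_def intro: Ck_on_subset)

lemma smooth_on_cong:
  assumes "open S" "\<And>x. x \<in> S \<Longrightarrow> f x = g x"
  shows "smooth_on S f \<longleftrightarrow> smooth_on S g"
  using Ck_on_cong[OF assms] by (simp add: smooth_on_def)

lemma smooth_on_const [intro!, simp]: "smooth_on S (\<lambda>x. c)"
  by (auto simp: smooth_on_def Ck_on_const)

lemma smooth_on_Ck: "smooth_on S f \<Longrightarrow> Ck_on k S f"
  by (simp add: smooth_on_def)

lemma smooth_on_dd: "smooth_on S f \<Longrightarrow> smooth_on S (dd h f)"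
  unfolding smooth_on_def by (metis Ck_on.simps(2))

lemma smooth_on_differentiable: "smooth_on S f \<Longrightarrow> x \<in> S \<Longrightarrow> f differentiable (at x)"
  using smooth_on_Ck[of S f 1] by simp

lemma smooth_on_continuous: "smooth_on S f \<Longrightarrow> continuous_on S f"
  using smooth_on_Ck[of S f 0] by simp

lemma smooth_on_has_derivative:
  "smooth_on S f \<Longrightarrow> x \<in> S \<Longrightarrow> (f has_derivative (\<lambda>h. dd h f x)) (at x)"
  using smooth_on_differentiable frechet_derivative_worksI by blast

lemma smooth_on_linear:
  "bounded_linear L \<Longrightarrow> open S \<Longrightarrow> smooth_on S f \<Longrightarrow> smooth_on S (\<lambda>x. L (f x))"
  by (auto simp: smooth_on_def intro: Ck_on_linear)

lemma smooth_on_add: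
  "open S \<Longrightarrow> smooth_on S f \<Longrightarrow> smooth_on S g \<Longrightarrow> smooth_on S (\<lambda>x. f x + g x)"
  by (auto simp: smooth_on_def intro: Ck_on_add)

lemma smooth_on_diff:
  assumes "open S" "smooth_on S f" "smooth_on S g"
  shows "smooth_on S (\<lambda>x. f x - g x)"
  using smooth_on_add[OF assms(1,2) smooth_on_linear[OF bounded_linear_minus[OF bounded_linear_ident] assms(1,3)]]
  by simp

lemma smooth_on_bilinear:
  "bounded_bilinear B \<Longrightarrow> open S \<Longrightarrow> smooth_on S f \<Longrightarrow> smooth_on S g \<Longrightarrow>
    smooth_on S (\<lambda>x. B (f x) (g x))"
  by (auto simp: smooth_on_def intro: Ck_on_bilinear)

lemma smooth_on_powr:
  fixes f :: "'a::euclidean_space \<Rightarrow> real"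
  shows "open S \<Longrightarrow> smooth_on S f \<Longrightarrow> (\<And>x. x \<in> S \<Longrightarrow> f x > 0) \<Longrightarrow> smooth_on S (\<lambda>x. f x powr c)"
  by (auto simp: smooth_on_def intro: Ck_on_powr)

text \<open>The factor \<open>1 / norm (f x)\<close> is the power -1/2 of
  \<open>f x \<bullet> f x\<close>, which is smooth and positive.\<close>

lemma smooth_on_normalize:
  fixes f :: "'a::euclidean_space \<Rightarrow> 'b::euclidean_space"
  assumes "open S" "smooth_on S f" "\<And>x. x \<in> S \<Longrightarrow> f x \<noteq> 0"
  shows "smooth_on S (\<lambda>x. (1 / norm (f x)) *\<^sub>R f x)"
proof -
  have "smooth_on S (\<lambda>x. ((f x \<bullet> f x) powr (- 1 / 2)) *\<^sub>R f x)"
    by (intro smooth_on_bilinear[OF bounded_bilinear_scaleR] smooth_on_powr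
        smooth_on_bilinear[OF bounded_bilinear_inner]) (use assms in auto)
  moreover have "(f x \<bullet> f x) powr (- 1 / 2) = 1 / norm (f x)" if "x \<in> S" for x
    using assms(3)[OF that] by (simp add: powr_minus_divide powr_half_sqrt norm_eq_sqrt_inner)
  ultimately show ?thesis
    using smooth_on_cong[OF assms(1), of "\<lambda>x. ((f x \<bullet> f x) powr (- 1 / 2)) *\<^sub>R f x"] by auto
qed

section \<open>Symmetry of second derivatives\<close>

lemma second_difference_mvt:
  fixes f :: "'a::euclidean_space \<Rightarrow> real"
  assumes "smooth_on S f" "0 < t" and S: "\<And>x y. 0 \<le> x \<Longrightarrow> x \<le> t \<Longrightarrow> 0 \<le> y \<Longrightarrow> y \<le> t \<Longrightarrow> v + x *\<^sub>R h + y *\<^sub>R k \<in> S"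
  obtains x y where "0 < x" "x < t" "0 < y" "y < t"
    "f (v + t *\<^sub>R h + t *\<^sub>R k) - f (v + t *\<^sub>R h) - f (v + t *\<^sub>R k) + f v
      = t\<^sup>2 * dd k (dd h f) (v + x *\<^sub>R h + y *\<^sub>R k)"
proof -
  let ?g = "\<lambda>x. f (v + x *\<^sub>R h + t *\<^sub>R k) - f (v + x *\<^sub>R h)"
  have d: "((\<lambda>x. F (w x)) has_real_derivative dd d F (w x)) (at x)"
    if "smooth_on S F" "w x \<in> S" "(w has_derivative (\<lambda>s. s *\<^sub>R d)) (at x)"
    for F :: "'a \<Rightarrow> real" and w d x
  proof -
    have "linear (\<lambda>h. dd h F (w x))"
      using linear_dd smooth_on_differentiable that by blast
    then have "(\<lambda>s. dd (s *\<^sub>R d) F (w x)) = (*) (dd d F (w x))"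
      by (auto simp: linear_cmul)
    then show ?thesis
      using has_derivative_compose[OF that(3) smooth_on_has_derivative[OF that(1,2)]]
      by (simp add: has_field_derivative_def)
  qed
  have "(?g has_real_derivative (dd h f (v + x *\<^sub>R h + t *\<^sub>R k) - dd h f (v + x *\<^sub>R h))) (at x)"
    if "0 \<le> x" "x \<le> t" for x
  proof (rule DERIV_diff)
    show "((\<lambda>x. f (v + x *\<^sub>R h + t *\<^sub>R k)) has_real_derivative dd h f (v + x *\<^sub>R h + t *\<^sub>R k)) (at x)"
      by (rule d[where w = "\<lambda>x. v + x *\<^sub>R h + t *\<^sub>R k"])
        (use assms S[of x t] that in \<open>auto intro!: derivative_eq_intros\<close>)
    show "((\<lambda>x. f (v + x *\<^sub>R h)) has_real_derivative dd h f (v + x *\<^sub>R h)) (at x)"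
      by (rule d[where w = "\<lambda>x. v + x *\<^sub>R h"])
        (use assms S[of x 0] that in \<open>auto intro!: derivative_eq_intros\<close>)
  qed
  from MVT2[OF assms(2) this] obtain x where x: "0 < x" "x < t"
    "?g t - ?g 0 = t * (dd h f (v + x *\<^sub>R h + t *\<^sub>R k) - dd h f (v + x *\<^sub>R h))"
    by auto
  have "((\<lambda>y. dd h f (v + x *\<^sub>R h + y *\<^sub>R k)) has_real_derivative dd k (dd h f) (v + x *\<^sub>R h + y *\<^sub>R k)) (at y)"
    if "0 \<le> y" "y \<le> t" for y
    by (rule d[where w = "\<lambda>y. v + x *\<^sub>R h + y *\<^sub>R k"])
      (use assms S[of x y] x that smooth_on_dd in \<open>auto intro!: derivative_eq_intros\<close>)
  from MVT2[OF assms(2) this] obtain y where y: "0 < y" "y < t"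
    "dd h f (v + x *\<^sub>R h + t *\<^sub>R k) - dd h f (v + x *\<^sub>R h) = t * dd k (dd h f) (v + x *\<^sub>R h + y *\<^sub>R k)"
    by auto
  show ?thesis
    by (rule that[of x y]) (use x y in \<open>simp_all add: power2_eq_square algebra_simps\<close>)
qed

text \<open>The second difference over a small parallelogram does not depend on the order of
  \<open>h\<close> and \<open>k\<close>. Two applications of the mean value theorem in either order
  write it as t^2 times a mixed derivative at a nearby point, and continuity compares these values
  with the ones at \<open>v\<close>.\<close>

lemma dd_commute_real:
  fixes f :: "'a::euclidean_space \<Rightarrow> real"
  assumes "open S" "smooth_on S f" "v \<in> S"
  shows "dd k (dd h f) v = dd h (dd k f) v"
proof (rule ccontr)
  assume ne: "dd k (dd h f) v \<noteq> dd h (dd k f) v"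
  define e where "e = \<bar>dd k (dd h f) v - dd h (dd k f) v\<bar> / 2"
  have e: "e > 0" using ne by (simp add: e_def)
  have ct: "continuous (at v) F" if "smooth_on S F" for F :: "'a \<Rightarrow> real"
    using smooth_on_continuous[OF that] assms(1,3) by (simp add: continuous_on_eq_continuous_at)
  have ex: "\<exists>d>0. \<forall>x. dist x v < d \<longrightarrow> dist (F x) (F v) < e" if "smooth_on S F" for F :: "'a \<Rightarrow> real"
    using ct[OF that] e unfolding continuous_at_eps_delta by simp
  have "\<exists>d>0. \<forall>x. dist x v < d \<longrightarrow> dist (dd k (dd h f) x) (dd k (dd h f) v) < e"
    by (rule ex) (intro smooth_on_dd assms(2))
  then obtain d1 where d1: "d1 > 0" "\<And>x. dist x v < d1 \<Longrightarrow> dist (dd k (dd h f) x) (dd k (dd h f) v) < e"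
    by auto
  have "\<exists>d>0. \<forall>x. dist x v < d \<longrightarrow> dist (dd h (dd k f) x) (dd h (dd k f) v) < e"
    by (rule ex) (intro smooth_on_dd assms(2))
  then obtain d2 where d2: "d2 > 0" "\<And>x. dist x v < d2 \<Longrightarrow> dist (dd h (dd k f) x) (dd h (dd k f) v) < e"
    by auto
  note d = d1(1) d2(1) d1(2) d2(2)
  obtain d3 where d3: "d3 > 0" "\<And>x. dist x v < d3 \<Longrightarrow> x \<in> S"
    using assms(1,3) unfolding open_dist by blast
  \<comment> \<open>Every point of the parallelogram with sides \<open>t *\<^sub>R h\<close> and
    \<open>t *\<^sub>R k\<close> then lies in all three balls around \<open>v\<close>; the summand 1
    keeps the denominator positive.\<close>
  define t where "t = min d1 (min d2 d3) / (norm h + norm k + 1)"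
  have t: "t > 0" using d d3 by (simp add: t_def add_nonneg_pos)
  have near: "dist (v + x *\<^sub>R h + y *\<^sub>R k) v < min d1 (min d2 d3)"
    if "0 \<le> x" "x \<le> t" "0 \<le> y" "y \<le> t" for x y
  proof -
    have "dist (v + x *\<^sub>R h + y *\<^sub>R k) v \<le> x * norm h + y * norm k"
      using that norm_triangle_ineq[of "x *\<^sub>R h" "y *\<^sub>R k"] by (simp add: dist_norm add.assoc)
    also have "\<dots> \<le> t * norm h + t * norm k"
      using that by (intro add_mono mult_right_mono) auto
    also have "\<dots> < t * (norm h + norm k + 1)" using t by (simp add: algebra_simps)
    also have "\<dots> = min d1 (min d2 d3)"
      unfolding t_def using norm_ge_zero[of h] norm_ge_zero[of k] by (simp add: add_nonneg_eq_0_iff)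
    finally show ?thesis .
  qed
  have inS: "v + x *\<^sub>R h + y *\<^sub>R k \<in> S" "v + y *\<^sub>R k + x *\<^sub>R h \<in> S"
    if "0 \<le> x" "x \<le> t" "0 \<le> y" "y \<le> t" for x y
    using d3(2)[of "v + x *\<^sub>R h + y *\<^sub>R k"] near[OF that]
    by (simp_all add: add.assoc add.commute[of "y *\<^sub>R k"])
  obtain x y where 1: "0 < x" "x < t" "0 < y" "y < t"
    "f (v + t *\<^sub>R h + t *\<^sub>R k) - f (v + t *\<^sub>R h) - f (v + t *\<^sub>R k) + f v
      = t\<^sup>2 * dd k (dd h f) (v + x *\<^sub>R h + y *\<^sub>R k)"
    by (rule second_difference_mvt[OF assms(2) t, of v h k]) (rule inS(1))
  obtain y' x' where 2: "0 < y'" "y' < t" "0 < x'" "x' < t"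
    "f (v + t *\<^sub>R k + t *\<^sub>R h) - f (v + t *\<^sub>R k) - f (v + t *\<^sub>R h) + f v
      = t\<^sup>2 * dd h (dd k f) (v + y' *\<^sub>R k + x' *\<^sub>R h)"
    by (rule second_difference_mvt[OF assms(2) t, of v k h])
      (rule inS(2))
  have "t\<^sup>2 * dd k (dd h f) (v + x *\<^sub>R h + y *\<^sub>R k) = t\<^sup>2 * dd h (dd k f) (v + y' *\<^sub>R k + x' *\<^sub>R h)"
    using 1(5) 2(5) by (simp add: algebra_simps)
  then have "dd k (dd h f) (v + x *\<^sub>R h + y *\<^sub>R k) = dd h (dd k f) (v + y' *\<^sub>R k + x' *\<^sub>R h)"
    using t by simp
  moreover have "dist (dd k (dd h f) (v + x *\<^sub>R h + y *\<^sub>R k)) (dd k (dd h f) v) < e"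
    using d(3) near[of x y] 1 by simp
  moreover have "dist (dd h (dd k f) (v + y' *\<^sub>R k + x' *\<^sub>R h)) (dd h (dd k f) v) < e"
    using d(4) near[of x' y'] 2 by (simp add: add.assoc add.commute[of "y' *\<^sub>R k"])
  ultimately show False
    unfolding e_def dist_real_def using ne by argo
qed

lemma dd_commute:
  fixes f :: "'a::euclidean_space \<Rightarrow> 'b::euclidean_space"
  assumes "open S" "smooth_on S f" "v \<in> S"
  shows "dd k (dd h f) v = dd h (dd k f) v"
proof (rule euclidean_eqI)
  fix b :: 'b
  have lin: "bounded_linear (\<lambda>x. x \<bullet> b)" by (rule bounded_linear_inner_left)
  have 1: "dd h (dd k (\<lambda>x. f x \<bullet> b)) v = dd h (dd k f) v \<bullet> b" for h k
  proof -
    have "dd h (dd k (\<lambda>x. f x \<bullet> b)) v = dd h (\<lambda>x. dd k f x \<bullet> b) v"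
      by (rule dd_cong[OF assms(1,3)]) (rule dd_linear[OF lin smooth_on_differentiable[OF assms(2)]])
    then show ?thesis
      using dd_linear[OF lin smooth_on_differentiable[OF smooth_on_dd[OF assms(2)] assms(3)]] by metis
  qed
  show "dd k (dd h f) v \<bullet> b = dd h (dd k f) v \<bullet> b"
    using dd_commute_real[OF assms(1) smooth_on_linear[OF lin assms(1,2)] assms(3), of k h] 1 by simp
qed

subsection \<open>Quaternion algebra\<close>

lemma bounded_bilinear_qmult: "bounded_bilinear (*\<^sub>H)"
proof
  show "\<exists>K. \<forall>a b. norm (a *\<^sub>H b) \<le> norm a * norm b * K"
  proof (intro exI allI)
    fix a b :: quat
    obtain x y where a: "a = (x, y)" by fastforce
    obtain z w where b: "b = (z, w)" by fastforce
    have bd: "norm x \<le> norm a" "norm y \<le> norm a" "norm z \<le> norm b" "norm w \<le> norm b"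
      by (simp_all add: a b norm_prod_def real_le_rsqrt)
    have "norm (a *\<^sub>H b) \<le> norm (x * z - y * cnj w) + norm (x * w + y * cnj z)"
      by (simp add: qmult_def a b norm_Pair_le)
    also have "\<dots> \<le> (norm x * norm z + norm y * norm w) + (norm x * norm w + norm y * norm z)"
      by (intro add_mono norm_triangle_le norm_triangle_le_diff) (simp_all add: norm_mult)
    also have "\<dots> \<le> (norm a * norm b + norm a * norm b) + (norm a * norm b + norm a * norm b)"
      using bd by (intro add_mono mult_mono) auto
    finally show "norm (a *\<^sub>H b) \<le> norm a * norm b * 4" by simp
  qed
qed (simp_all add: qmult_def scaleR_conv_of_real algebra_simps)

interpretation qmult: bounded_bilinear "(*\<^sub>H)"
  by (rule bounded_bilinear_qmult)

lemma bounded_linear_qcnj: "bounded_linear qcnj"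
proof -
  have "linear qcnj"
    by (rule linearI) (simp_all add: qcnj_def)
  then show ?thesis by (rule linear_conv_bounded_linear[THEN iffD1])
qed

lemma qcnj_simps [simp]:
  "qcnj (x + y) = qcnj x + qcnj y" "qcnj (x - y) = qcnj x - qcnj y" "qcnj (- x) = - qcnj x"
  "qcnj (r *\<^sub>R x) = r *\<^sub>R qcnj x" "qcnj 0 = 0"
  by (simp_all add: qcnj_def prod_eq_iff)

definition qone :: quat where "qone = (1, 0)"

lemma qone_mult [simp]: "qone *\<^sub>H x = x" "x *\<^sub>H qone = x"
  by (simp_all add: qmult_def qone_def)

lemma qone_inner [simp]: "qone \<bullet> qone = 1"
  by (simp add: qone_def inner_prod_def inner_complex_def)

lemma qcnj_qone [simp]: "qcnj qone = qone"
  by (simp add: qcnj_def qone_def)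

lemma qcnj_qcnj [simp]: "qcnj (qcnj x) = x"
  by (simp add: qcnj_def)

lemma qcnj_qmult: "qcnj (x *\<^sub>H y) = qcnj y *\<^sub>H qcnj x"
  by (simp add: qcnj_def qmult_def algebra_simps)

lemma qcnj_minus_iff: "qcnj x = - x \<longleftrightarrow> x \<in> Im_quat"
  by (auto simp: qcnj_def Im_quat_def prod_eq_iff complex_eq_iff)

lemma qcnj_Im [simp]: "x \<in> Im_quat \<Longrightarrow> qcnj x = - x"
  by (simp add: qcnj_minus_iff)

lemma norm_qcnj [simp]: "norm (qcnj x) = norm x"
  by (simp add: qcnj_def norm_prod_def)

lemma norm_qmult: "norm (x *\<^sub>H y) = norm x * norm y"
proof -
  have "(norm (x *\<^sub>H y))\<^sup>2 = (norm x * norm y)\<^sup>2"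
    by (simp add: norm_prod_def qmult_def cmod_def power_mult_distrib)
      (simp add: power2_eq_square algebra_simps)
  then show ?thesis by (simp add: power2_eq_iff_nonneg)
qed

lemma inner_qmult_left: "(x *\<^sub>H y) \<bullet> z = y \<bullet> (qcnj x *\<^sub>H z)"
  by (simp add: qmult_def qcnj_def inner_prod_def inner_complex_def algebra_simps)

lemma inner_qmult_right: "(x *\<^sub>H y) \<bullet> z = x \<bullet> (z *\<^sub>H qcnj y)"
  by (simp add: qmult_def qcnj_def inner_prod_def inner_complex_def algebra_simps)

lemma subspace_Im_quat: "subspace Im_quat"
  by (auto simp: subspace_def Im_quat_def)

lemmas Im_quat_closed [intro] = subspace_0[OF subspace_Im_quat] subspace_add[OF subspace_Im_quat]
  subspace_diff[OF subspace_Im_quat] subspace_neg[OF subspace_Im_quat] subspace_scale[OF subspace_Im_quat]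

lemma Im_quat_iff_inner: "x \<in> Im_quat \<longleftrightarrow> x \<bullet> qone = 0"
  by (simp add: Im_quat_def inner_prod_def inner_complex_def qone_def)

lemma Im_quat_conj [intro]: "x \<in> Im_quat \<Longrightarrow> g *\<^sub>H x *\<^sub>H qcnj g \<in> Im_quat"
  by (simp only: qcnj_minus_iff[symmetric] qcnj_qmult qcnj_qcnj qmult_assoc)
    (simp add: qmult.minus_left qmult.minus_right)

lemma unit_quat_qcnj [intro, simp]: "x \<in> unit_quat \<Longrightarrow> qcnj x \<in> unit_quat"
  by (simp add: unit_quat_def)

lemma unit_quat_qmult [intro, simp]: "x \<in> unit_quat \<Longrightarrow> y \<in> unit_quat \<Longrightarrow> x *\<^sub>H y \<in> unit_quat"
  by (simp add: unit_quat_def norm_qmult)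

lemma qone_unit [intro, simp]: "qone \<in> unit_quat"
  by (simp add: unit_quat_def norm_prod_def qone_def)

lemma unit_quat_inverse [simp]:
  assumes "x \<in> unit_quat"
  shows "x *\<^sub>H qcnj x = qone" "qcnj x *\<^sub>H x = qone"
  using qmult_qcnj[of x] qmult_qcnj[of "qcnj x"] assms
  by (simp_all add: unit_quat_def quat_of_complex_def qone_def)

lemma unit_quat_cancel [simp]:
  assumes "x \<in> unit_quat"
  shows "x *\<^sub>H (qcnj x *\<^sub>H y) = y" "qcnj x *\<^sub>H (x *\<^sub>H y) = y"
  using assms by (simp_all flip: qmult_assoc)

lemma inner_conj:
  assumes "g \<in> unit_quat"
  shows "(g *\<^sub>H x *\<^sub>H qcnj g) \<bullet> (g *\<^sub>H y *\<^sub>H qcnj g) = x \<bullet> y"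
proof -
  have "(g *\<^sub>H x *\<^sub>H qcnj g) \<bullet> (g *\<^sub>H y *\<^sub>H qcnj g) = (x *\<^sub>H qcnj g) \<bullet> (y *\<^sub>H qcnj g)"
    unfolding qmult_assoc inner_qmult_left[of g] using assms by simp
  then show ?thesis
    unfolding inner_qmult_right[of x] qmult_assoc using assms by simp
qed

lemma qmult_Im_anticommute:
  assumes "x \<in> Im_quat" "y \<in> Im_quat"
  shows "x *\<^sub>H y + y *\<^sub>H x = (- 2 * (x \<bullet> y)) *\<^sub>R qone"
  using assms
  by (auto simp: Im_quat_def qmult_def inner_prod_def inner_complex_def scaleR_conv_of_real complex_eq_iff qone_def algebra_simps)

lemma Im_quat_square:
  assumes "x \<in> Im_quat"
  shows "x *\<^sub>H x = (- (x \<bullet> x)) *\<^sub>R qone"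
  using assms
  by (auto simp: Im_quat_def qmult_def inner_prod_def inner_complex_def scaleR_conv_of_real complex_eq_iff qone_def algebra_simps)

text \<open>The product of two orthogonal imaginary quaternions is their cross product.\<close>

locale quat_frame =
  fixes \<xi> \<eta> :: quat
  assumes Im [simp]: "\<xi> \<in> Im_quat" "\<eta> \<in> Im_quat"
    and unit [simp]: "\<xi> \<bullet> \<xi> = 1" "\<eta> \<bullet> \<eta> = 1" and orth [simp]: "\<xi> \<bullet> \<eta> = 0"
begin

abbreviation "\<zeta> \<equiv> \<xi> *\<^sub>H \<eta>"

lemma orth' [simp]: "\<eta> \<bullet> \<xi> = 0"
  using orth by (simp only: inner_commute)

lemma sq [simp]: "\<xi> *\<^sub>H \<xi> = - qone" "\<eta> *\<^sub>H \<eta> = - qone"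
  using Im_quat_square[OF Im(1)] Im_quat_square[OF Im(2)] by simp_all

lemma anti: "\<eta> *\<^sub>H \<xi> = - \<zeta>"
  using qmult_Im_anticommute[OF Im] by (simp add: eq_neg_iff_add_eq_0 add.commute)

lemma sq_assoc [simp]: "\<xi> *\<^sub>H (\<xi> *\<^sub>H x) = - x" "\<eta> *\<^sub>H (\<eta> *\<^sub>H x) = - x"
  by (simp_all flip: qmult_assoc add: qmult.minus_left)

lemma zeta_Im [simp]: "\<zeta> \<in> Im_quat"
proof -
  have "qcnj \<zeta> = - \<zeta>"
    by (simp add: qcnj_qmult qmult.minus_left qmult.minus_right anti)
  then show ?thesis by (simp only: qcnj_minus_iff)
qed

lemma zeta_xi: "\<zeta> *\<^sub>H \<xi> = \<eta>"
  by (simp add: qmult_assoc anti qmult.minus_right)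

lemma zeta_inner [simp]:
  "\<zeta> \<bullet> \<xi> = 0" "\<zeta> \<bullet> \<eta> = 0" "\<xi> \<bullet> \<zeta> = 0" "\<eta> \<bullet> \<zeta> = 0" "\<zeta> \<bullet> \<zeta> = 1"
proof -
  show 1: "\<zeta> \<bullet> \<xi> = 0"
    using Im(2) by (simp add: inner_qmult_left qmult.minus_left Im_quat_iff_inner[THEN iffD1])
  show 2: "\<zeta> \<bullet> \<eta> = 0"
    using Im(1) by (simp add: inner_qmult_right qmult.minus_right Im_quat_iff_inner[THEN iffD1])
  show "\<xi> \<bullet> \<zeta> = 0" "\<eta> \<bullet> \<zeta> = 0" using 1 2 by (simp_all add: inner_commute)
  show "\<zeta> \<bullet> \<zeta> = 1"
    by (simp add: inner_qmult_left qmult.minus_left)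
qed

text \<open>With \<open>qone\<close> the frame gives four orthonormal vectors in a space of
  dimension four, so they span it. The difference of the two sides is orthogonal to all four and
  therefore to itself.\<close>

lemma Im_expand:
  assumes "z \<in> Im_quat"
  shows "z = (z \<bullet> \<xi>) *\<^sub>R \<xi> + (z \<bullet> \<eta>) *\<^sub>R \<eta> + (z \<bullet> \<zeta>) *\<^sub>R \<zeta>"
proof -
  let ?B = "{qone, \<xi>, \<eta>, \<zeta>}"
  let ?y = "z - ((z \<bullet> \<xi>) *\<^sub>R \<xi> + (z \<bullet> \<eta>) *\<^sub>R \<eta> + (z \<bullet> \<zeta>) *\<^sub>R \<zeta>)"
  have one: "qone \<bullet> x = 0" "x \<bullet> qone = 0" if "x \<in> Im_quat" for x
    using that by (simp_all add: Im_quat_iff_inner inner_commute)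
  have po: "pairwise orthogonal ?B"
    by (auto simp: pairwise_def orthogonal_def one)
  have "qone \<noteq> 0" "\<xi> \<noteq> 0" "\<eta> \<noteq> 0" "\<zeta> \<noteq> 0"
    using qone_inner unit zeta_inner(5) by (metis inner_zero_left zero_neq_one)+
  then have nz: "0 \<notin> ?B" by auto
  have "independent ?B" using pairwise_orthogonal_independent[OF po nz] .
  moreover have "card ?B = 4"
  proof -
    have "qone \<noteq> \<xi>" "qone \<noteq> \<eta>" "qone \<noteq> \<zeta>" "\<xi> \<noteq> \<eta>" "\<xi> \<noteq> \<zeta>" "\<eta> \<noteq> \<zeta>"
      using qone_inner one(1)[OF Im(1)] one(1)[OF Im(2)] one(1)[OF zeta_Im] unit orth zeta_inner
      by (metis zero_neq_one)+
    then show ?thesis by simp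
  qed
  ultimately have "span ?B = UNIV"
    by (simp flip: dim_eq_full add: dim_eq_card_independent)
  then have "?y \<in> span ?B" by simp
  moreover have "orthogonal ?y x" if "x \<in> ?B" for x
    using that assms by (auto simp: orthogonal_def inner_diff_left inner_add_left one)
  ultimately have "orthogonal ?y ?y"
    using orthogonal_to_span by blast
  then show ?thesis by (simp add: orthogonal_def)
qed

lemma Im_zeroI:
  assumes "z \<in> Im_quat" "z \<bullet> \<xi> = 0" "z \<bullet> \<eta> = 0" "z \<bullet> \<zeta> = 0"
  shows "z = 0"
  using Im_expand[OF assms(1)] assms by simp

text \<open>The squares of \<xi> and \<eta> are scalars and their products anticommute, so only the
  determinant of the coefficients survives. Every bracket of Maurer-Cartan forms below is evaluated
  through this identity.\<close>

lemma commutator: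
  "(a *\<^sub>R \<xi> + b *\<^sub>R \<eta>) *\<^sub>H (c *\<^sub>R \<xi> + d *\<^sub>R \<eta>) - (c *\<^sub>R \<xi> + d *\<^sub>R \<eta>) *\<^sub>H (a *\<^sub>R \<xi> + b *\<^sub>R \<eta>)
     = (2 * (a * d - b * c)) *\<^sub>R \<zeta>"
  by (simp add: qmult.add_left qmult.add_right qmult.scaleR_left qmult.scaleR_right anti)
    (simp add: algebra_simps flip: scaleR_2)

lemma quat_frame_conj:
  assumes "g \<in> unit_quat"
  shows "quat_frame (g *\<^sub>H \<xi> *\<^sub>H qcnj g) (g *\<^sub>H \<eta> *\<^sub>H qcnj g)"
  by unfold_locales (use assms in \<open>auto simp: inner_conj\<close>)

end

subsection \<open>Closed one-forms and local coordinates\<close>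

lemma linear_Basis_expand:
  fixes f :: "'a::euclidean_space \<Rightarrow> 'b::real_vector"
  assumes "linear f"
  shows "f h = (\<Sum>b\<in>Basis. (h \<bullet> b) *\<^sub>R f b)"
proof -
  have "f h = f (\<Sum>b\<in>Basis. (h \<bullet> b) *\<^sub>R b)" by (simp add: euclidean_representation)
  then show ?thesis by (simp add: linear_sum[OF assms] linear_cmul[OF assms])
qed

text \<open>The potential is the integral of the form along the segment from \<open>v0\<close> to
  \<open>x\<close>. Closedness turns the derivative of the integrand in direction \<open>h\<close>
  into the t-derivative of \<open>t * a h (y x t)\<close>, which integrates to
  \<open>a h x\<close>.\<close>

lemma poincare:
  fixes a :: "'a::euclidean_space \<Rightarrow> 'a \<Rightarrow> real"
  assumes V: "open V" "convex V" "v0 \<in> V"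
    and lin: "\<And>v. v \<in> V \<Longrightarrow> linear (\<lambda>h. a h v)"
    and sm: "\<And>h. smooth_on V (a h)"
    and closed: "\<And>h k v. v \<in> V \<Longrightarrow> dd h (a k) v = dd k (a h) v"
  obtains A where "\<And>v. v \<in> V \<Longrightarrow> (A has_derivative (\<lambda>h. a h v)) (at v)"
proof -
  define y where "y = (\<lambda>x t. v0 + t *\<^sub>R (x - v0))"
  have yV: "y x t \<in> V" if "x \<in> V" "t \<in> {0..1}" for x t
  proof -
    have "(1 - t) *\<^sub>R v0 + t *\<^sub>R x \<in> V"
      using that V by (intro convexD_alt) auto
    then show ?thesis by (simp add: y_def algebra_simps)
  qed
  define f where "f = (\<lambda>x t. a (x - v0) (y x t))"
  \<comment> \<open>This is the derivative of \<open>f x t\<close> in \<open>x\<close>, with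
    closedness already used to exchange the direction \<open>h\<close> and the direction
    \<open>x - v0\<close>.\<close>
  define fx where "fx = (\<lambda>x t. Blinfun (\<lambda>h. a h (y x t) + t * dd (x - v0) (a h) (y x t)))"
  have linD: "linear (\<lambda>k. dd h (a k) v)" if "v \<in> V" for h v
    using linear_dd[OF smooth_on_differentiable[OF sm that], of h] closed[OF that] by simp
  have fx: "blinfun_apply (fx x t) h = a h (y x t) + t * dd (x - v0) (a h) (y x t)"
    if "x \<in> V" "t \<in> {0..1}" for x t h
  proof -
    have "linear (\<lambda>h. a h (y x t) + t * dd (x - v0) (a h) (y x t))"
      using lin[OF yV[OF that]] linD[OF yV[OF that], of "x - v0"]
      by (auto simp: linear_iff algebra_simps)
    then show ?thesis
      unfolding fx_def by (simp add: bounded_linear_Blinfun_apply linear_conv_bounded_linear)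
  qed
  have expand: "a h v = (\<Sum>b\<in>Basis. (h \<bullet> b) * a b v)" if "v \<in> V" for h v
    using linear_Basis_expand[OF lin[OF that], of h] by simp
  have dv: "((\<lambda>x. f x t) has_derivative blinfun_apply (fx x t)) (at x within V)"
    if x: "x \<in> V" and t: "t \<in> cbox 0 1" for x t
  proof -
    have t': "t \<in> {0..1}" using t by simp
    have yd: "((\<lambda>x. y x t) has_derivative (\<lambda>h. t *\<^sub>R h)) (at x)"
      unfolding y_def by (auto intro!: derivative_eq_intros)
    \<comment> \<open>In \<open>f x t\<close> the variable \<open>x\<close> occurs both in the base
      point and in the direction fed to the form. Expanding the direction in the basis reduces this
      to the product rule.\<close>
    have "((\<lambda>x. \<Sum>b\<in>Basis. ((x - v0) \<bullet> b) * a b (y x t)) has_derivative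
        (\<lambda>h. \<Sum>b\<in>Basis. ((x - v0) \<bullet> b) * dd (t *\<^sub>R h) (a b) (y x t) + (h \<bullet> b) * a b (y x t))) (at x)"
      by (intro has_derivative_sum has_derivative_mult
          has_derivative_compose[OF yd smooth_on_has_derivative[OF sm yV[OF x t']]])
        (auto intro!: derivative_eq_intros)
    moreover have "(\<Sum>b\<in>Basis. ((x - v0) \<bullet> b) * dd (t *\<^sub>R h) (a b) (y x t) + (h \<bullet> b) * a b (y x t))
        = blinfun_apply (fx x t) h" for h
    proof -
      have "(\<Sum>b\<in>Basis. ((x - v0) \<bullet> b) * dd (t *\<^sub>R h) (a b) (y x t))
        = t * (\<Sum>b\<in>Basis. ((x - v0) \<bullet> b) * dd b (a h) (y x t))"
        using linear_cmul[OF linear_dd[OF smooth_on_differentiable[OF sm yV[OF x t']]]]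
          closed[OF yV[OF x t']]
        by (simp add: sum_distrib_left algebra_simps)
      also have "(\<Sum>b\<in>Basis. ((x - v0) \<bullet> b) * dd b (a h) (y x t)) = dd (x - v0) (a h) (y x t)"
        using linear_Basis_expand[OF linear_dd[OF smooth_on_differentiable[OF sm yV[OF x t']]], of h "x - v0"]
        by simp
      finally show ?thesis
        using expand[OF yV[OF x t'], of h] by (simp add: fx[OF x t'] sum.distrib)
    qed
    ultimately have "((\<lambda>x. \<Sum>b\<in>Basis. ((x - v0) \<bullet> b) * a b (y x t)) has_derivative blinfun_apply (fx x t)) (at x)"
      by simp
    then have "((\<lambda>x. f x t) has_derivative blinfun_apply (fx x t)) (at x)"
      by (rule has_derivative_transform_within_open[OF _ V(1) x])
        (simp add: f_def expand[OF yV[OF _ t']])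
    then show ?thesis by (rule has_derivative_at_withinI)
  qed
  have cy: "continuous_on (V \<times> cbox 0 1) (\<lambda>p. y (fst p) (snd p))"
    unfolding y_def by (intro continuous_intros)
  have comp: "continuous_on (V \<times> cbox 0 1) (\<lambda>p. F (y (fst p) (snd p)))"
    if "smooth_on V F" for F :: "'a \<Rightarrow> real"
    by (rule continuous_on_compose2[OF smooth_on_continuous[OF that] cy]) (auto intro: yV)
  have cfx: "continuous_on (V \<times> cbox 0 1) (\<lambda>(x, t). fx x t)"
  proof (rule continuous_on_blinfun_componentwise)
    fix h :: 'a
    have cs: "continuous_on (V \<times> cbox 0 1) (\<lambda>p. a h (y (fst p) (snd p))
        + snd p * (\<Sum>b\<in>Basis. ((fst p - v0) \<bullet> b) * dd b (a h) (y (fst p) (snd p))))"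
      by (intro continuous_intros comp sm smooth_on_dd)
    have "(\<Sum>b\<in>Basis. ((x - v0) \<bullet> b) * dd b (a h) (y x t)) = dd (x - v0) (a h) (y x t)"
      if "x \<in> V" "t \<in> {0..1}" for x t
      using linear_Basis_expand[OF linear_dd[OF smooth_on_differentiable[OF sm yV[OF that]]], of h "x - v0"]
      by simp
    then have "blinfun_apply ((\<lambda>(x, t). fx x t) p) h = a h (y (fst p) (snd p))
        + snd p * (\<Sum>b\<in>Basis. ((fst p - v0) \<bullet> b) * dd b (a h) (y (fst p) (snd p)))"
      if "p \<in> V \<times> cbox 0 1" for p
      using that by (auto simp: fx)
    with cs show "continuous_on (V \<times> cbox 0 1) (\<lambda>p. blinfun_apply ((\<lambda>(x, t). fx x t) p) h)"
      by (rule continuous_on_eq[OF _ sym])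
  qed
  have cf: "continuous_on {0..1} (f x)" if "x \<in> V" for x
  proof -
    have "continuous_on {0..1} (y x)" unfolding y_def by (intro continuous_intros)
    then show ?thesis
      unfolding f_def
      by (rule continuous_on_compose2[OF smooth_on_continuous[OF sm]]) (auto intro: yV[OF that])
  qed
  have L: "((\<lambda>x. integral (cbox 0 1) (f x)) has_derivative (\<lambda>h. a h x)) (at x)" if x: "x \<in> V" for x
  proof -
    have "((\<lambda>x. integral (cbox 0 1) (f x)) has_derivative integral (cbox 0 1) (fx x)) (at x within V)"
      by (rule leibniz_rule[OF dv]) (use cf cfx x V in \<open>auto intro!: integrable_continuous_interval\<close>)
    then have "((\<lambda>x. integral (cbox 0 1) (f x)) has_derivative integral (cbox 0 1) (fx x)) (at x)"
      using at_within_open[OF x V(1)] by simp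
    moreover have "blinfun_apply (integral (cbox 0 1) (fx x)) h = a h x" for h
    proof -
      have "continuous_on (cbox 0 1) (\<lambda>t. (\<lambda>(x, t). fx x t) (x, t))"
        by (rule continuous_on_compose2[OF cfx]) (use x in \<open>auto intro!: continuous_intros\<close>)
      then have "fx x integrable_on cbox 0 1"
        by (intro integrable_continuous) simp
      then have "blinfun_apply (integral (cbox 0 1) (fx x)) h = integral (cbox 0 1) (\<lambda>t. blinfun_apply (fx x t) h)"
        by (simp add: blinfun_apply_integral)
      also have "\<dots> = a h x"
      proof (rule integral_unique)
        have "((\<lambda>t. t * a h (y x t)) has_vector_derivative blinfun_apply (fx x t) h) (at t within {0..1})"
          if t: "t \<in> {0..1}" for t
        proof -
          have yd: "((\<lambda>t. y x t) has_derivative (\<lambda>s. s *\<^sub>R (x - v0))) (at t)"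
            unfolding y_def by (auto intro!: derivative_eq_intros)
          have "((\<lambda>t. t * a h (y x t)) has_derivative
            (\<lambda>s. t * dd (s *\<^sub>R (x - v0)) (a h) (y x t) + s * a h (y x t))) (at t)"
            by (intro has_derivative_mult has_derivative_ident
                has_derivative_compose[OF yd smooth_on_has_derivative[OF sm yV[OF x t]]])
          moreover have "t * dd (s *\<^sub>R (x - v0)) (a h) (y x t) + s * a h (y x t) = s *\<^sub>R blinfun_apply (fx x t) h" for s
            using linear_cmul[OF linear_dd[OF smooth_on_differentiable[OF sm yV[OF x t]]]]
            by (simp add: fx[OF x t] distrib_left mult.left_commute mult.commute)
          ultimately show ?thesis
            by (simp add: has_vector_derivative_def has_derivative_at_withinI)
        qed
        from fundamental_theorem_of_calculus[OF _ this]
        show "((\<lambda>t. blinfun_apply (fx x t) h) has_integral a h x) (cbox 0 1)"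
          by (simp add: y_def)
      qed
      finally show ?thesis .
    qed
    ultimately show ?thesis by (auto elim!: has_derivative_eq_rhs)
  qed
  show ?thesis by (rule that[OF L])
qed

text \<open>The three potentials form a chart by the inverse function theorem. In that chart the
  kernel of \<open>s\<close> is tangent to the slices S = const, so \<open>H\<close> is constant on
  each slice of a box and descends to a curve \<open>c\<close> in S. In the application
  \<open>H\<close> combines the curve G with its direction e.\<close>

lemma local_coordinates:
  fixes a b s :: "R3 \<Rightarrow> R3 \<Rightarrow> real" and H :: "R3 \<Rightarrow> 'b::euclidean_space"
  assumes V: "open V" "v0 \<in> V"
    and dA: "\<And>v. v \<in> V \<Longrightarrow> (A has_derivative (\<lambda>h. a h v)) (at v)"
    and dB: "\<And>v. v \<in> V \<Longrightarrow> (B has_derivative (\<lambda>h. b h v)) (at v)"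
    and dS: "\<And>v. v \<in> V \<Longrightarrow> (S has_derivative (\<lambda>h. s h v)) (at v)"
    and cont: "\<And>h. continuous_on V (a h)" "\<And>h. continuous_on V (b h)" "\<And>h. continuous_on V (s h)"
    and inj: "\<And>h. a h v0 = 0 \<Longrightarrow> b h v0 = 0 \<Longrightarrow> s h v0 = 0 \<Longrightarrow> h = 0"
    and dH: "\<And>v. v \<in> V \<Longrightarrow> H differentiable (at v)"
    and H0: "\<And>v h. v \<in> V \<Longrightarrow> s h v = 0 \<Longrightarrow> dd h H v = 0"
  obtains V1 c d where "open V1" "v0 \<in> V1" "V1 \<subseteq> V" "d > 0"
    "\<And>V2. open V2 \<Longrightarrow> V2 \<subseteq> V1 \<Longrightarrow> open ((\<lambda>v. (A v, B v, S v)) ` V2)"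
    "\<And>v. v \<in> V1 \<Longrightarrow> \<bar>S v - S v0\<bar> < d \<and> H v = c (S v)"
    "\<And>t. \<bar>t - S v0\<bar> < d \<Longrightarrow> \<exists>v h. v \<in> V1 \<and> S v = t \<and> s h v = 1 \<and>
       (c has_vector_derivative dd h H v) (at t)"
proof -
  define \<theta> where "\<theta> = (\<lambda>v. (A v, B v, S v))"
  define \<theta>' where "\<theta>' = (\<lambda>v. Blinfun (\<lambda>h. (a h v, b h v, s h v)))"
  have d\<theta>: "(\<theta> has_derivative (\<lambda>h. (a h v, b h v, s h v))) (at v)" if "v \<in> V" for v
    unfolding \<theta>_def by (intro has_derivative_Pair dA dB dS that)
  have \<theta>': "blinfun_apply (\<theta>' v) = (\<lambda>h. (a h v, b h v, s h v))" if "v \<in> V" for v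
    unfolding \<theta>'_def using bounded_linear_Blinfun_apply[OF has_derivative_bounded_linear[OF d\<theta>[OF that]]] .
  have cont': "continuous_on V \<theta>'"
  proof (rule continuous_on_blinfun_componentwise)
    fix i
    have "continuous_on V (\<lambda>v. (a i v, b i v, s i v))"
      by (intro continuous_on_Pair cont)
    then show "continuous_on V (\<lambda>v. blinfun_apply (\<theta>' v) i)"
      by (rule continuous_on_eq) (simp add: \<theta>')
  qed
  have lin: "linear (blinfun_apply (\<theta>' v))" for v
    by (rule bounded_linear.linear[OF blinfun.bounded_linear_right])
  have "inj (blinfun_apply (\<theta>' v0))"
  proof -
    have "\<forall>h. blinfun_apply (\<theta>' v0) h = 0 \<longrightarrow> h = 0"
      using inj by (simp add: \<theta>'[OF V(2)] zero_prod_def)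
    then show ?thesis using linear_injective_0[OF lin] by blast
  qed
  then obtain g where g: "linear g" "g \<circ> blinfun_apply (\<theta>' v0) = id"
    using linear_injective_left_inverse[OF lin] by blast
  have inv: "Blinfun g o\<^sub>L \<theta>' v0 = id_blinfun"
    using g(1) pointfree_idE[OF g(2)] by (intro blinfun_eqI)
      (simp add: bounded_linear_Blinfun_apply linear_conv_bounded_linear)
  have df: "(\<theta> has_derivative blinfun_apply (\<theta>' v)) (at v)" if "v \<in> V" for v
    using d\<theta>[OF that] by (simp add: \<theta>'[OF that])
  obtain U' W g g' where U': "open U'" "U' \<subseteq> V" "v0 \<in> U'" "open W" "\<theta> v0 \<in> W"
    and hom: "homeomorphism U' W \<theta> g"
    and dg: "\<And>y. y \<in> W \<Longrightarrow> (g has_derivative (g' y)) (at y)"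
    and g'_eq: "\<And>y. y \<in> W \<Longrightarrow> g' y = inv (blinfun_apply (\<theta>' (g y)))"
    and bij: "\<And>y. y \<in> W \<Longrightarrow> bij (blinfun_apply (\<theta>' (g y)))"
    by (rule inverse_function_theorem[OF V(1) df cont' V(2) inv]) (assumption | rule that)+
  have gW: "g y \<in> V" "g y \<in> U'" "\<theta> (g y) = y" if "y \<in> W" for y
    using hom that U'(2) by (auto simp: homeomorphism_def)
  have g\<theta>: "g (\<theta> v) = v" if "v \<in> U'" for v
    using hom that by (auto simp: homeomorphism_def)
  obtain e where e: "e > 0" "ball (\<theta> v0) e \<subseteq> W"
    using U'(4,5) openE by blast
  \<comment> \<open>Three coordinate distances below e/3 add up to less than e, so the box
    \<open>Q\<close> fits into the ball.\<close>
  define d where "d = e / 3"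
  have d: "d > 0" using e by (simp add: d_def)
  define Q where "Q = ball (A v0) d \<times> ball (B v0) d \<times> ball (S v0) d"
  have Qsub: "Q \<subseteq> W"
  proof
    fix z assume "z \<in> Q"
    then obtain x y t where z: "z = (x, y, t)" "dist (A v0) x < d" "dist (B v0) y < d" "dist (S v0) t < d"
      by (auto simp: Q_def)
    have "dist (\<theta> v0) z \<le> dist (A v0) x + (dist (B v0) y + dist (S v0) t)"
      unfolding \<theta>_def z dist_Pair_Pair
      using sqrt_sum_squares_le_sum[of "dist (B v0) y" "dist (S v0) t"]
        sqrt_sum_squares_le_sum[of "dist (A v0) x" "sqrt ((dist (B v0) y)\<^sup>2 + (dist (S v0) t)\<^sup>2)"]
      by simp
    then have "dist (\<theta> v0) z < e" using z by (simp add: d_def)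
    then show "z \<in> W" using e by auto
  qed
  have Qopen: "open Q" unfolding Q_def by (intro open_Times open_ball)
  define V1 where "V1 = g ` Q"
  have V1eq: "V1 = {v \<in> U'. \<theta> v \<in> Q}"
    unfolding V1_def using Qsub gW g\<theta> by (auto intro!: rev_image_eqI)
  have "continuous_on U' \<theta>" using hom by (simp add: homeomorphism_def)
  then have V1open: "open V1"
    using continuous_open_preimage[OF _ U'(1) Qopen] unfolding V1eq by (simp add: vimage_def Int_def)
  have v01: "v0 \<in> V1" using U'(3) d by (auto simp: V1eq Q_def \<theta>_def)
  define K where "K = H \<circ> g"
  have dK: "(K has_derivative (\<lambda>z. dd (g' y z) H (g y))) (at y)" if "y \<in> W" for y
    unfolding K_def o_def
    using has_derivative_compose[OF dg[OF that] frechet_derivative_worksI[OF dH[OF gW(1)[OF that]]]] .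
  have sg: "\<theta>' (g y) (g' y z) = z" if "y \<in> W" for y z
    using bij[OF that] by (simp add: g'_eq[OF that] bij_is_surj surj_f_inv_f)
  have sg3: "s (g' y (x1, x2, t)) (g y) = t" if "y \<in> W" for y x1 x2 t
    using sg[OF that, of "(x1, x2, t)"] \<theta>'[OF gW(1)[OF that]] by simp
  \<comment> \<open>For fixed \<open>t\<close> the slice of the box is convex, and all its tangent
    vectors lie in the kernel of \<open>s\<close>.\<close>
  have Kconst: "K (x, y, t) = K (A v0, B v0, t)" if "(x, y, t) \<in> Q" for x y t
  proof -
    let ?C = "ball (A v0) d \<times> ball (B v0) d"
    have inW: "(fst w, snd w, t) \<in> W" if "w \<in> ?C" for w
      using Qsub that \<open>(x, y, t) \<in> Q\<close> by (auto simp: Q_def)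
    have "((\<lambda>w. K (fst w, snd w, t)) has_derivative (\<lambda>_. 0)) (at w within ?C)" if w: "w \<in> ?C" for w
    proof -
      have l: "((\<lambda>w::real\<times>real. (fst w, snd w, t)) has_derivative (\<lambda>h. (fst h, snd h, 0))) (at w)"
        by (auto intro!: derivative_eq_intros)
      have "dd (g' (fst w, snd w, t) (fst h, snd h, 0)) H (g (fst w, snd w, t)) = 0" for h
        by (rule H0) (use gW[OF inW[OF w]] sg3[OF inW[OF w]] in auto)
      then have "((\<lambda>w. K (fst w, snd w, t)) has_derivative (\<lambda>_. 0)) (at w)"
        using has_derivative_compose[OF l dK[OF inW[OF w]]] by simp
      then show ?thesis by (rule has_derivative_at_withinI)
    qed
    moreover have "convex ?C" by (intro convex_Times convex_ball)
    ultimately obtain k where "\<And>w. w \<in> ?C \<Longrightarrow> K (fst w, snd w, t) = k"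
      using has_derivative_zero_constant[of ?C "\<lambda>w. K (fst w, snd w, t)"] by auto
    from this[of "(x, y)"] this[of "(A v0, B v0)"] show ?thesis
      using that d by (simp add: Q_def)
  qed
  define c where "c = (\<lambda>t. K (A v0, B v0, t))"
  show ?thesis
  proof (rule that[of V1 d c])
    show "V1 \<subseteq> V" using U'(2) by (auto simp: V1eq)
    show "open ((\<lambda>v. (A v, B v, S v)) ` V2)" if "open V2" "V2 \<subseteq> V1" for V2
    proof -
      have "openin (top_of_set U') V2"
        using that by (auto simp: V1eq openin_open_eq U'(1))
      then have "openin (top_of_set W) (\<theta> ` V2)"
        using homeomorphism_imp_open_map[OF hom] by blast
      then show ?thesis using U'(4) by (simp add: openin_open_eq \<theta>_def)
    qed
    show "\<bar>S v - S v0\<bar> < d \<and> H v = c (S v)" if "v \<in> V1" for v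
    proof -
      have v: "v \<in> U'" "(A v, B v, S v) \<in> Q" using that by (auto simp: V1eq \<theta>_def)
      then have "H v = K (A v, B v, S v)"
        using g\<theta>[of v] by (simp add: K_def \<theta>_def)
      then show ?thesis
        using Kconst[OF v(2)] v(2) by (auto simp: c_def Q_def dist_real_def)
    qed
    show "\<exists>v h. v \<in> V1 \<and> S v = t \<and> s h v = 1 \<and> (c has_vector_derivative dd h H v) (at t)"
      if "\<bar>t - S v0\<bar> < d" for t
    proof -
      \<comment> \<open>The point is taken on the line along which \<open>c\<close> is defined. The
        image of (0, 0, 1) under the derivative of the inverse chart is the vector \<open>h\<close>
        with \<open>s h v = 1\<close>.\<close>
      let ?y = "(A v0, B v0, t)"
      have yQ: "?y \<in> Q" using that d by (auto simp: Q_def dist_real_def)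
      then have yW: "?y \<in> W" using Qsub by auto
      have "((\<lambda>t. (A v0, B v0, t)) has_derivative (\<lambda>r. (0, 0, r))) (at t)"
        by (auto intro!: derivative_eq_intros)
      from has_derivative_compose[OF this dK[OF yW]]
      have "(c has_derivative (\<lambda>r. dd (g' ?y (0, 0, r)) H (g ?y))) (at t)" by (simp add: c_def)
      moreover have "(\<lambda>r. dd (g' ?y (0, 0, r)) H (g ?y)) = (\<lambda>r. r *\<^sub>R dd (g' ?y (0, 0, 1)) H (g ?y))"
      proof
        fix r
        have "g' ?y (0, 0, r) = r *\<^sub>R g' ?y (0, 0, 1)"
          using linear_cmul[OF has_derivative_linear[OF dg[OF yW]], of r "(0, 0, 1)"] by simp
        then show "dd (g' ?y (0, 0, r)) H (g ?y) = r *\<^sub>R dd (g' ?y (0, 0, 1)) H (g ?y)"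
          using linear_cmul[OF linear_dd[OF dH[OF gW(1)[OF yW]]], of r "g' ?y (0, 0, 1)"] by simp
      qed
      ultimately have "(c has_vector_derivative dd (g' ?y (0, 0, 1)) H (g ?y)) (at t)"
        unfolding has_vector_derivative_def by (rule has_derivative_eq_rhs)
      moreover have "S (g ?y) = t" using gW(3)[OF yW] by (simp add: \<theta>_def)
      ultimately show ?thesis using sg3[OF yW, of 0 0 1] yQ
        by (intro exI[of _ "g ?y"] exI[of _ "g' ?y (0, 0, 1)"]) (auto simp: V1_def)
    qed
  qed (use V1open v01 d in auto)
qed

subsection \<open>Global extension of the data of the model immersions\<close>

text \<open>Since \<open>(0, z)\<close> is the quaternion z j, this is the system of
  \<open>admissible_data\<close> in the single equation A' = (sqrt 3 / 2) A e^(if) j. The set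
  \<open>I\<close> leaves room for solutions that exist on an interval only.\<close>

definition horizontal :: "real set \<Rightarrow> (real \<Rightarrow> real) \<Rightarrow> (real \<Rightarrow> quat) \<Rightarrow> bool" where
  "horizontal I f A \<longleftrightarrow> (\<forall>t\<in>I. f differentiable (at t) \<and> A t \<in> unit_quat \<and>
     (A has_vector_derivative (sqrt 3 / 2) *\<^sub>R (A t *\<^sub>H (0, cis (f t)))) (at t))"

lemma horizontal_admissible:
  assumes "horizontal UNIV f A"
  shows "admissible_data f A"
proof -
  have d: "(A has_vector_derivative (sqrt 3 / 2) *\<^sub>R (A t *\<^sub>H (0, cis (f t)))) (at t)" for t
    using assms by (simp add: horizontal_def)
  have "((\<lambda>s. fst (A s)) has_vector_derivative
      - complex_of_real (sqrt 3 / 2) * snd (A t) * exp (- \<i> * complex_of_real (f t))) (at t)" for t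
    using bounded_linear.has_vector_derivative[OF bounded_linear_fst d[of t]]
    by (simp add: qmult_def scaleR_conv_of_real cis_cnj cis_conv_exp exp_cnj mult.assoc)
  moreover have "((\<lambda>s. snd (A s)) has_vector_derivative
      complex_of_real (sqrt 3 / 2) * fst (A t) * exp (\<i> * complex_of_real (f t))) (at t)" for t
    using bounded_linear.has_vector_derivative[OF bounded_linear_snd d[of t]]
    by (simp add: qmult_def scaleR_conv_of_real cis_conv_exp mult.assoc)
  ultimately show ?thesis
    using assms by (simp add: admissible_data_def horizontal_def)
qed

lemma cis_unit_quat [simp]: "(cis x, 0) \<in> unit_quat"
  by (simp add: unit_quat_def norm_prod_def)

text \<open>In the frame rotating with angle \<open>\<alpha> + \<beta> t\<close> the equation has constant coefficients.\<close>

lemma horizontal_linear_phase: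
  assumes "A0 \<in> unit_quat"
  obtains A where "horizontal UNIV (\<lambda>t. \<alpha> + \<beta> * t) A" "A t0 = A0"
proof -
  \<comment> \<open>For Y = A e^(i(\<alpha> + \<beta> t)/2) the equation becomes Y' = Y M: the term
    i \<beta>/2 is the derivative of the half phase, and the rotation removes the time dependence
    from e^(if) j.\<close>
  define M :: quat where "M = (\<i> * (\<beta> / 2), complex_of_real (sqrt 3 / 2))"
  define \<mu> where "\<mu> = norm M"
  \<comment> \<open>This is exp((t - t0) M), in closed form because M M = - \<mu>^2.\<close>
  define X where "X = (\<lambda>t. cos (\<mu> * (t - t0)) *\<^sub>R qone + (sin (\<mu> * (t - t0)) / \<mu>) *\<^sub>R M)"
  define E where "E = (\<lambda>t. (cis (- (\<alpha> + \<beta> * t) / 2), 0) :: quat)"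
  define Y0 where "Y0 = A0 *\<^sub>H (cis ((\<alpha> + \<beta> * t0) / 2), 0)"
  define A where "A = (\<lambda>t. Y0 *\<^sub>H X t *\<^sub>H E t)"
  have M: "M \<in> Im_quat" "M \<noteq> 0" by (simp_all add: M_def Im_quat_def zero_prod_def)
  have \<mu>: "\<mu> > 0" "M \<bullet> M = \<mu>\<^sup>2" using M by (simp_all add: \<mu>_def power2_norm_eq_inner)
  have MM: "M *\<^sub>H M = (- \<mu>\<^sup>2) *\<^sub>R qone" using Im_quat_square[OF M(1)] \<mu> by simp
  have dX: "(X has_vector_derivative X t *\<^sub>H M) (at t)" for t
  proof -
    have "(X has_vector_derivative (- sin (\<mu> * (t - t0)) * \<mu>) *\<^sub>R qone + (cos (\<mu> * (t - t0)) * \<mu> / \<mu>) *\<^sub>R M) (at t)"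
    proof -
      have c: "((\<lambda>t. cos (\<mu> * (t - t0))) has_vector_derivative - sin (\<mu> * (t - t0)) * \<mu>) (at t)"
        and s: "((\<lambda>t. sin (\<mu> * (t - t0)) / \<mu>) has_vector_derivative cos (\<mu> * (t - t0)) * \<mu> / \<mu>) (at t)"
        unfolding has_real_derivative_iff_has_vector_derivative[symmetric]
        using \<mu>(1) by (auto intro!: derivative_eq_intros)
      show ?thesis
        unfolding X_def
        by (intro has_vector_derivative_add bounded_linear.has_vector_derivative[OF bounded_linear_scaleR_left] c s)
    qed
    moreover have "X t *\<^sub>H M = (- sin (\<mu> * (t - t0)) * \<mu>) *\<^sub>R qone + (cos (\<mu> * (t - t0)) * \<mu> / \<mu>) *\<^sub>R M"
      using \<mu>(1) by (simp add: X_def qmult.add_left qmult.scaleR_left MM power2_eq_square)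
    ultimately show ?thesis by simp
  qed
  have dE: "(E has_vector_derivative (- \<i> * (\<beta> / 2) * cis (- (\<alpha> + \<beta> * t) / 2), 0)) (at t)" for t
  proof -
    have "((\<lambda>t. cis (- (\<alpha> + \<beta> * t) / 2)) has_vector_derivative
        (- \<beta> / 2) *\<^sub>R (\<i> * cis (- (\<alpha> + \<beta> * t) / 2))) (at t)"
      unfolding has_vector_derivative_def
      by (auto intro!: derivative_eq_intros simp: scaleR_conv_of_real algebra_simps)
    then show ?thesis
      unfolding E_def
      by (auto intro!: has_vector_derivative_Pair has_vector_derivative_const
          simp: scaleR_conv_of_real mult.assoc mult.left_commute)
  qed
  have dA: "(A has_vector_derivative Y0 *\<^sub>H X t *\<^sub>H (- \<i> * (\<beta> / 2) * cis (- (\<alpha> + \<beta> * t) / 2), 0)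
     + Y0 *\<^sub>H (X t *\<^sub>H M) *\<^sub>H E t) (at t)" for t
    unfolding A_def
    by (rule bounded_bilinear.has_vector_derivative[OF bounded_bilinear_qmult
          bounded_linear.has_vector_derivative[OF qmult.bounded_linear_right dX] dE])
  have eq: "M *\<^sub>H E t + (- \<i> * (\<beta> / 2) * cis (- (\<alpha> + \<beta> * t) / 2), 0)
     = (sqrt 3 / 2) *\<^sub>R (E t *\<^sub>H (0, cis (\<alpha> + \<beta> * t)))" for t
  proof -
    define x where "x = \<alpha> + \<beta> * t"
    have "cis (- x / 2) * cis x = cis (x / 2)" "cnj (cis (- x / 2)) = cis (x / 2)"
      by (simp_all add: cis_mult cis_cnj)
    then show ?thesis
      unfolding M_def E_def x_def[symmetric] by (simp add: qmult_def scaleR_conv_of_real)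
  qed
  have "(A has_vector_derivative (sqrt 3 / 2) *\<^sub>R (A t *\<^sub>H (0, cis (\<alpha> + \<beta> * t)))) (at t)" for t
  proof -
    have "Y0 *\<^sub>H X t *\<^sub>H (- \<i> * (\<beta> / 2) * cis (- (\<alpha> + \<beta> * t) / 2), 0) + Y0 *\<^sub>H (X t *\<^sub>H M) *\<^sub>H E t
      = (Y0 *\<^sub>H X t) *\<^sub>H (M *\<^sub>H E t + (- \<i> * (\<beta> / 2) * cis (- (\<alpha> + \<beta> * t) / 2), 0))"
      by (simp add: qmult_assoc qmult.add_right)
    then show ?thesis
      using dA[of t] unfolding eq by (simp add: A_def qmult_assoc qmult.scaleR_right)
  qed
  moreover have "A t \<in> unit_quat" for t
  proof -
    have "(norm (X t))\<^sup>2 = 1"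
    proof -
      have "M \<bullet> qone = 0" "qone \<bullet> M = 0"
        using M(1) by (simp_all add: Im_quat_iff_inner inner_commute)
      then show ?thesis
        using \<mu> unfolding power2_norm_eq_inner X_def
        by (simp add: inner_add_left inner_add_right power2_eq_square[symmetric] power_divide)
    qed
    then have "norm (X t) = 1"
      using power2_eq_imp_eq[of "norm (X t)" 1] by simp
    then have "X t \<in> unit_quat" by (simp add: unit_quat_def)
    moreover have "Y0 \<in> unit_quat" "E t \<in> unit_quat"
      using assms by (simp_all add: Y0_def E_def cis_unit_quat)
    ultimately show ?thesis by (auto simp: A_def)
  qed
  moreover have "(\<lambda>t. \<alpha> + \<beta> * t) differentiable (at t)" for t
    by (auto intro!: derivative_intros)
  moreover have "A t0 = A0"
  proof -
    have "X t0 = qone" by (simp add: X_def)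
    then show ?thesis
      by (simp add: A_def Y0_def E_def qmult_assoc)
        (simp add: qmult_def cis_mult flip: add_divide_distrib)
  qed
  ultimately show ?thesis
    by (intro that[of A]) (simp_all add: horizontal_def)
qed

lemma has_vector_derivative_glue:
  assumes "(f has_vector_derivative D) (at c)" "(g has_vector_derivative D) (at c)" "f c = g c"
  shows "((\<lambda>t::real. if t \<le> c then f t else g t) has_vector_derivative D) (at c)"
proof -
  let ?h = "\<lambda>t. if t \<le> c then f t else g t"
  have "(?h has_vector_derivative D) (at c within {..c})"
    by (rule has_vector_derivative_transform[OF _ _ has_vector_derivative_at_within[OF assms(1)]]) auto
  moreover have "(?h has_vector_derivative D) (at c within {c..})"
    by (rule has_vector_derivative_transform[OF _ _ has_vector_derivative_at_within[OF assms(2)]])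
      (use assms(3) in auto)
  ultimately have "(?h has_vector_derivative D) (at c within ({..c} \<union> {c..}))"
    unfolding has_vector_derivative_def has_derivative_within Lim_within_Un by blast
  moreover have "{..c} \<union> {c..} = (UNIV :: real set)" by auto
  ultimately show ?thesis by simp
qed

text \<open>Beyond \<open>c\<close> the phase follows its tangent line, which keeps it
  differentiable at \<open>c\<close>, and the closed solution with linear phase starts at
  \<open>A c\<close>. The two curves have the same velocity at \<open>c\<close>, because the
  equation determines it from the common values of curve and phase.\<close>

lemma horizontal_extend_right:
  assumes "horizontal I f A" "c \<in> I"
  obtains f' A' where "horizontal (I \<union> {c..}) f' A'" "\<And>t. t \<le> c \<Longrightarrow> A' t = A t"
proof -
  have H: "f differentiable (at t)" "A t \<in> unit_quat"
    "(A has_vector_derivative (sqrt 3 / 2) *\<^sub>R (A t *\<^sub>H (0, cis (f t)))) (at t)" if "t \<in> I" for t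
    using assms(1) that by (auto simp: horizontal_def)
  obtain D where D: "(f has_vector_derivative D) (at c)"
    using H(1)[OF assms(2)] vector_derivative_works by blast
  define g where "g = (\<lambda>t. (f c - D * c) + D * t)"
  obtain B where B: "horizontal UNIV g B" "B c = A c"
    unfolding g_def by (rule horizontal_linear_phase[OF H(2)[OF assms(2)]])
  have gc: "g c = f c" by (simp add: g_def)
  have dg: "(g has_vector_derivative D) (at t)" for t
    unfolding g_def has_vector_derivative_def by (auto intro!: derivative_eq_intros)
  define f' where "f' = (\<lambda>t. if t \<le> c then f t else g t)"
  define A' where "A' = (\<lambda>t. if t \<le> c then A t else B t)"
  have "f' differentiable (at t) \<and> A' t \<in> unit_quat \<and>
     (A' has_vector_derivative (sqrt 3 / 2) *\<^sub>R (A' t *\<^sub>H (0, cis (f' t)))) (at t)" if t: "t \<in> I \<union> {c..}" for t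
  proof -
    consider "t < c" | "t = c" | "c < t" by linarith
    then show ?thesis
    proof cases
      case 1
      then have tr: "t \<in> I" using t by simp
      have "f' differentiable (at t)"
        using H(1)[OF tr] unfolding differentiable_def
        by (rule ex_forward) (rule has_derivative_transform_within_open[of _ _ _ _ "{..<c}"], use 1 in \<open>auto simp: f'_def\<close>)
      moreover have "(A' has_vector_derivative (sqrt 3 / 2) *\<^sub>R (A t *\<^sub>H (0, cis (f t)))) (at t)"
        by (rule has_vector_derivative_transform_within_open[OF H(3)[OF tr], of "{..<c}"])
          (use 1 in \<open>auto simp: A'_def\<close>)
      ultimately show ?thesis using H(2)[OF tr] 1 by (simp add: f'_def A'_def)
    next
      case 2
      have Bc: "(B has_vector_derivative (sqrt 3 / 2) *\<^sub>R (A c *\<^sub>H (0, cis (f c)))) (at c)"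
        using B by (simp add: horizontal_def flip: B(2) gc)
      have "(f' has_vector_derivative D) (at c)"
        unfolding f'_def by (rule has_vector_derivative_glue[OF D dg]) (simp add: gc)
      moreover have "(A' has_vector_derivative (sqrt 3 / 2) *\<^sub>R (A c *\<^sub>H (0, cis (f c)))) (at c)"
        unfolding A'_def
        by (rule has_vector_derivative_glue[OF H(3)[OF assms(2)]])
          (use Bc B(2) in simp_all)
      ultimately show ?thesis
        using H(2)[OF assms(2)] 2 by (auto simp: f'_def A'_def differentiableI_vector)
    next
      case 3
      have "f' differentiable (at t)"
        using differentiableI_vector[OF dg[of t]] unfolding differentiable_def
        by (rule ex_forward) (rule has_derivative_transform_within_open[of _ _ _ _ "{c<..}"], use 3 in \<open>auto simp: f'_def\<close>)
      moreover have "(B has_vector_derivative (sqrt 3 / 2) *\<^sub>R (B t *\<^sub>H (0, cis (g t)))) (at t)"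
        using B(1) by (auto simp: horizontal_def)
      then have "(A' has_vector_derivative (sqrt 3 / 2) *\<^sub>R (B t *\<^sub>H (0, cis (g t)))) (at t)"
        by (rule has_vector_derivative_transform_within_open[of _ _ _ "{c<..}"])
          (use 3 in \<open>auto simp: A'_def\<close>)
      moreover have "B t \<in> unit_quat" using B(1) by (auto simp: horizontal_def)
      ultimately show ?thesis using 3 by (simp add: f'_def A'_def)
    qed
  qed
  then have "horizontal (I \<union> {c..}) f' A'" by (simp add: horizontal_def)
  then show ?thesis by (rule that) (simp add: A'_def)
qed

text \<open>Reversing time changes the sign of the velocity; a shift of the phase by
  \<open>pi\<close> absorbs it. Extension to the left thereby becomes extension to the
  right.\<close>

lemma horizontal_reflect:
  assumes "horizontal I f A"
  shows "horizontal (uminus ` I) (\<lambda>t. f (- t) + pi) (\<lambda>t. A (- t))"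
  unfolding horizontal_def
proof (intro ballI conjI)
  fix t assume "t \<in> uminus ` I"
  then have H: "f differentiable (at (- t))" "A (- t) \<in> unit_quat"
    "(A has_vector_derivative (sqrt 3 / 2) *\<^sub>R (A (- t) *\<^sub>H (0, cis (f (- t))))) (at (- t))"
    using assms by (auto simp: horizontal_def)
  have u: "(uminus has_vector_derivative - 1) (at t)"
    unfolding has_vector_derivative_def by (auto intro!: derivative_eq_intros)
  obtain D where "(f has_vector_derivative D) (at (- t))"
    using H(1) vector_derivative_works by blast
  then have "((\<lambda>t. f (- t)) has_vector_derivative (- 1) *\<^sub>R D) (at t)"
    using vector_diff_chain_at[OF u] by (simp add: o_def)
  then show "(\<lambda>t. f (- t) + pi) differentiable (at t)"
    using differentiableI_vector by (intro differentiable_add) auto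
  show "A (- t) \<in> unit_quat" by fact
  have "((\<lambda>t. A (- t)) has_vector_derivative (- 1) *\<^sub>R ((sqrt 3 / 2) *\<^sub>R (A (- t) *\<^sub>H (0, cis (f (- t)))))) (at t)"
    using vector_diff_chain_at[OF u H(3)] by (simp add: o_def)
  moreover have "(- 1) *\<^sub>R ((sqrt 3 / 2) *\<^sub>R (A (- t) *\<^sub>H (0, cis (f (- t)))))
      = (sqrt 3 / 2) *\<^sub>R (A (- t) *\<^sub>H (0, cis (f (- t) + pi)))"
    by (simp add: qmult_def flip: cis_mult)
  ultimately show "((\<lambda>t. A (- t)) has_vector_derivative (sqrt 3 / 2) *\<^sub>R (A (- t) *\<^sub>H (0, cis (f (- t) + pi)))) (at t)"
    by simp
qed

text \<open>Extend to the right at \<open>d\<close>, reflect, extend to the right at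
  \<open>- c\<close>, and reflect back. The phase returns shifted by 2 pi, which is harmless since
  only the curve has to be preserved on the interval.\<close>

lemma horizontal_extend:
  assumes "horizontal {l<..<r} f A" "l < c" "c < d" "d < r"
  obtains f' A' where "horizontal UNIV f' A'" "\<And>t. c \<le> t \<Longrightarrow> t \<le> d \<Longrightarrow> A' t = A t"
proof -
  have sub: "horizontal J f A" if "horizontal I f A" "J \<subseteq> I" for I J f A
    using that by (auto simp: horizontal_def)
  obtain f1 A1 where 1: "horizontal ({l<..<r} \<union> {d..}) f1 A1" "\<And>t. t \<le> d \<Longrightarrow> A1 t = A t"
    by (rule horizontal_extend_right[OF assms(1), of d]) (use assms in auto)
  have "horizontal {..<- l} (\<lambda>t. f1 (- t) + pi) (\<lambda>t. A1 (- t))"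
  proof (rule sub[OF horizontal_reflect[OF 1(1)]])
    have "t \<in> uminus ` ({l<..<r} \<union> {d..})" if "t < - l" for t
      by (rule image_eqI[of _ _ "- t"]) (use that assms in auto)
    then show "{..<- l} \<subseteq> uminus ` ({l<..<r} \<union> {d..})" by auto
  qed
  then obtain f2 A2 where 2: "horizontal ({..<- l} \<union> {- c..}) f2 A2"
     "\<And>t. t \<le> - c \<Longrightarrow> A2 t = A1 (- t)"
    by (rule horizontal_extend_right[of _ _ _ "- c"]) (use assms in auto)
  have "{..<- l} \<union> {- c..} = UNIV" using assms by auto
  then have "horizontal UNIV (\<lambda>t. f2 (- t) + pi) (\<lambda>t. A2 (- t))"
    using horizontal_reflect[OF 2(1)] by (simp add: surj_uminus)
  then show ?thesis
    by (rule that) (use 1(2) 2(2) assms in auto)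
qed

text \<open>Two things separate a unit-speed curve with direction e j from the model data: the
  speed, adjusted by rescaling time, and a real phase for \<open>e\<close>, obtained from a
  logarithm near \<tau>.\<close>

lemma horizontal_of_curve:
  assumes "0 < \<delta>"
    and G: "\<And>t. \<bar>t - \<tau>\<bar> < \<delta> \<Longrightarrow> G t \<in> unit_quat"
      "\<And>t. \<bar>t - \<tau>\<bar> < \<delta> \<Longrightarrow> (G has_vector_derivative G t *\<^sub>H (0, e t)) (at t)"
    and e: "\<And>t. \<bar>t - \<tau>\<bar> < \<delta> \<Longrightarrow> e differentiable (at t)" "\<And>t. \<bar>t - \<tau>\<bar> < \<delta> \<Longrightarrow> norm (e t) = 1"
  obtains f A \<epsilon> where "admissible_data f A" "0 < \<epsilon>"
    "\<And>t. \<bar>t - \<tau>\<bar> < \<epsilon> \<Longrightarrow> A (2 / sqrt 3 * t) = G t"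
proof -
  have "\<bar>\<tau> - \<tau>\<bar> < \<delta>" using assms(1) by simp
  note e0 = e[OF this]
  have "isCont e \<tau>" using differentiable_imp_continuous_within[OF e0(1)] .
  then obtain d where d: "d > 0" "\<And>t. dist t \<tau> < d \<Longrightarrow> dist (e t) (e \<tau>) < 1"
    unfolding continuous_at_eps_delta using zero_less_one by blast
  define \<delta>' where "\<delta>' = min \<delta> d"
  define w where "w = (\<lambda>t. e t / e \<tau>)"
  have w: "Re (w t) > 0" "norm (w t) = 1" "w differentiable (at t)" if "\<bar>t - \<tau>\<bar> < \<delta>'" for t
  proof -
    show "norm (w t) = 1" using e(2) e0(2) that by (simp add: w_def norm_divide \<delta>'_def)
    have "e \<tau> \<noteq> 0" using e0(2) by auto
    then have "w t - 1 = (e t - e \<tau>) / e \<tau>" by (simp add: w_def diff_divide_distrib)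
    then have "norm (w t - 1) = norm (e t - e \<tau>)" using e0(2) by (simp add: norm_divide)
    then have "norm (w t - 1) < 1" using d(2)[of t] that by (simp add: \<delta>'_def dist_norm)
    then show "Re (w t) > 0" using abs_Re_le_cmod[of "w t - 1"] by simp
    show "w differentiable (at t)"
      unfolding w_def divide_inverse using e(1) that by (intro differentiable_mult) (auto simp: \<delta>'_def)
  qed
  define k where "k = sqrt 3 / 2"
  have k: "k > 0" "2 / sqrt 3 = 1 / k" by (simp_all add: k_def)
  define f where "f = (\<lambda>t. Arg (e \<tau>) + Im (Ln (w (k * t))))"
  define A where "A = (\<lambda>t. G (k * t))"
  have near: "\<bar>k * t - \<tau>\<bar> < \<delta>'" if "t \<in> {(\<tau> - \<delta>') / k<..<(\<tau> + \<delta>') / k}" for t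
    using that k(1) by (auto simp: field_simps abs_less_iff)
  have kd: "((\<lambda>t. k * t) has_vector_derivative k) (at t)" for t
    unfolding has_vector_derivative_def by (auto intro!: derivative_eq_intros)
  have H: "horizontal {(\<tau> - \<delta>') / k<..<(\<tau> + \<delta>') / k} f A"
    unfolding horizontal_def
  proof (intro ballI conjI)
    fix t assume "t \<in> {(\<tau> - \<delta>') / k<..<(\<tau> + \<delta>') / k}"
    note t = near[OF this]
    then have t': "\<bar>k * t - \<tau>\<bar> < \<delta>" by (simp add: \<delta>'_def)
    show "A t \<in> unit_quat" using G(1)[OF t'] by (simp add: A_def)
    have "w (k * t) \<notin> \<real>\<^sub>\<le>\<^sub>0" using w(1)[OF t] complex_nonpos_Reals_iff by auto
    moreover obtain D where "(w has_vector_derivative D) (at (k * t))"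
      using w(3)[OF t] vector_derivative_works by blast
    then have "((\<lambda>t. w (k * t)) has_vector_derivative k *\<^sub>R D) (at t)"
      using vector_diff_chain_at[OF kd] by (simp add: o_def)
    ultimately have "((Ln \<circ> (\<lambda>t. w (k * t))) has_vector_derivative k *\<^sub>R D * inverse (w (k * t))) (at t)"
      by (intro field_vector_diff_chain_at has_field_derivative_Ln)
    then have "((\<lambda>t. Im (Ln (w (k * t)))) has_vector_derivative Im (k *\<^sub>R D * inverse (w (k * t)))) (at t)"
      unfolding o_def by (rule bounded_linear.has_vector_derivative[OF bounded_linear_Im])
    then show "f differentiable (at t)"
      unfolding f_def using differentiableI_vector by (intro differentiable_add) auto
    have "e \<tau> \<noteq> 0" "w (k * t) \<noteq> 0"
      using w(2)[OF t] e0(2) by (metis norm_zero zero_neq_one)+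
    then have "cis (Arg (e \<tau>)) = e \<tau>" "cis (Arg (w (k * t))) = w (k * t)"
      using cis_Arg[of "e \<tau>"] cis_Arg[of "w (k * t)"] w(2)[OF t] e0(2)
      by (simp_all add: sgn_eq)
    moreover have "Arg (w (k * t)) = Im (Ln (w (k * t)))"
      using w(1)[OF t] by (intro Arg_eq_Im_Ln) auto
    ultimately have "cis (f t) = e (k * t)"
      using e0(2) by (simp add: f_def flip: cis_mult) (auto simp: w_def)
    moreover have "(A has_vector_derivative k *\<^sub>R (G (k * t) *\<^sub>H (0, e (k * t)))) (at t)"
      using vector_diff_chain_at[OF kd G(2)[OF t']] by (simp add: A_def o_def)
    ultimately show "(A has_vector_derivative (sqrt 3 / 2) *\<^sub>R (A t *\<^sub>H (0, cis (f t)))) (at t)"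
      by (simp add: A_def k_def)
  qed
  have \<delta>': "\<delta>' > 0" using assms(1) d(1) by (simp add: \<delta>'_def)
  \<comment> \<open>Halving the radius makes room on both sides for the extension, which keeps the
    curve on a compact interval inside the domain.\<close>
  obtain f' A' where A': "horizontal UNIV f' A'"
    "\<And>t. (\<tau> - \<delta>' / 2) / k \<le> t \<Longrightarrow> t \<le> (\<tau> + \<delta>' / 2) / k \<Longrightarrow> A' t = A t"
    by (rule horizontal_extend[OF H, of "(\<tau> - \<delta>' / 2) / k" "(\<tau> + \<delta>' / 2) / k"])
      (use k(1) \<delta>' in \<open>simp_all add: divide_strict_right_mono\<close>)
  show ?thesis
  proof (rule that[OF horizontal_admissible[OF A'(1)], of "\<delta>' / 2"])
    show "A' (2 / sqrt 3 * t) = G t" if "\<bar>t - \<tau>\<bar> < \<delta>' / 2" for t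
      using A'(2)[of "t / k"] that k by (auto simp: A_def divide_right_mono abs_less_iff)
  qed (use \<delta>' in auto)
qed

subsection \<open>The Maurer-Cartan form of a map into the unit quaternions\<close>

definition mcf :: "(R3 \<Rightarrow> quat) \<Rightarrow> R3 \<Rightarrow> R3 \<Rightarrow> quat" where
  "mcf p h v = qcnj (p v) *\<^sub>H dd h p v"

definition unit_map :: "R3 set \<Rightarrow> (R3 \<Rightarrow> quat) \<Rightarrow> bool" where
  "unit_map V p \<longleftrightarrow> open V \<and> smooth_on V p \<and> p ` V \<subseteq> unit_quat"

lemma unit_mapD:
  assumes "unit_map V p"
  shows "open V" "smooth_on V p" "\<And>v. v \<in> V \<Longrightarrow> p v \<in> unit_quat"
  using assms by (auto simp: unit_map_def)

lemma unit_map_subset: "unit_map V p \<Longrightarrow> open W \<Longrightarrow> W \<subseteq> V \<Longrightarrow> unit_map W p"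
  by (auto simp: unit_map_def intro: smooth_on_subset)

lemmas dd_qmult = dd_bilinear[OF bounded_bilinear_qmult]
lemmas dd_inner = dd_bilinear[OF bounded_bilinear_inner]
lemmas smooth_on_qmult = smooth_on_bilinear[OF bounded_bilinear_qmult]
lemmas smooth_on_inner = smooth_on_bilinear[OF bounded_bilinear_inner]
lemmas smooth_on_scaleR = smooth_on_bilinear[OF bounded_bilinear_scaleR]
lemmas smooth_on_qcnj = smooth_on_linear[OF bounded_linear_qcnj]

lemma dd_inner_const:
  fixes f g :: "'a::euclidean_space \<Rightarrow> 'b::euclidean_space"
  assumes "open V" "v \<in> V" "smooth_on V f" "smooth_on V g" "\<And>u. u \<in> V \<Longrightarrow> f u \<bullet> g u = c"
  shows "dd h f v \<bullet> g v + f v \<bullet> dd h g v = 0"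
proof -
  have "dd h (\<lambda>u. f u \<bullet> g u) v = dd h (\<lambda>u. c) v"
    by (rule dd_cong[OF assms(1,2,5)])
  then show ?thesis
    using dd_inner[OF smooth_on_differentiable[OF assms(3,2)] smooth_on_differentiable[OF assms(4,2)], of h]
    by simp
qed

lemma dd_Im:
  assumes "open V" "v \<in> V" "smooth_on V f" "\<And>u. u \<in> V \<Longrightarrow> f u \<in> Im_quat"
  shows "dd h f v \<in> Im_quat"
  using dd_inner_const[OF assms(1-3), of "\<lambda>u. qone" 0 h] assms(4)
  by (simp add: Im_quat_iff_inner)

context
  fixes V p assumes p: "unit_map V p"
begin

lemma smooth_on_mcf: "smooth_on V (mcf p h)"
  unfolding mcf_def[abs_def]
  using unit_mapD[OF p] by (intro smooth_on_qmult smooth_on_qcnj smooth_on_dd)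

lemma linear_mcf: "v \<in> V \<Longrightarrow> linear (\<lambda>h. mcf p h v)"
  using linear_dd[OF smooth_on_differentiable[OF unit_mapD(2)[OF p]]]
  by (auto simp: mcf_def linear_iff qmult.add_right qmult.scaleR_right)

lemma dd_eq_mcf: "v \<in> V \<Longrightarrow> dd h p v = p v *\<^sub>H mcf p h v"
  using unit_mapD(3)[OF p] by (simp add: mcf_def)

lemma mcf_Im:
  assumes "v \<in> V"
  shows "mcf p h v \<in> Im_quat"
proof -
  have "p u \<bullet> p u = 1" if "u \<in> V" for u
    using unit_mapD(3)[OF p that] by (simp add: unit_quat_def flip: power2_norm_eq_inner)
  then have "dd h p v \<bullet> p v + p v \<bullet> dd h p v = 0"
    by (rule dd_inner_const[OF unit_mapD(1)[OF p] assms unit_mapD(2)[OF p] unit_mapD(2)[OF p]])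
  then have "dd h p v \<bullet> p v = 0" by (simp add: inner_commute)
  moreover have "mcf p h v \<bullet> qone = dd h p v \<bullet> p v"
    by (simp add: mcf_def inner_qmult_left)
  ultimately show ?thesis by (simp add: Im_quat_iff_inner)
qed

text \<open>In the derivative of p^-1 dp the second derivatives of \<open>p\<close> are symmetric
  and cancel. The derivative of the conjugate contributes the quadratic terms, with a minus sign
  because the form is imaginary.\<close>

lemma maurer_cartan:
  assumes v: "v \<in> V"
  shows "dd h (mcf p k) v - dd k (mcf p h) v = mcf p k v *\<^sub>H mcf p h v - mcf p h v *\<^sub>H mcf p k v"
proof -
  note o = unit_mapD(1)[OF p] and s = unit_mapD(2)[OF p]
  have 1: "dd h (mcf p k) v = qcnj (p v) *\<^sub>H dd h (dd k p) v - mcf p h v *\<^sub>H mcf p k v" for h k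
  proof -
    have d: "(\<lambda>v. qcnj (p v)) differentiable (at v)"
      by (rule differentiable_linear[OF bounded_linear_qcnj smooth_on_differentiable[OF s v]])
    have "dd h (mcf p k) v = qcnj (p v) *\<^sub>H dd h (dd k p) v + dd h (\<lambda>v. qcnj (p v)) v *\<^sub>H dd k p v"
      unfolding mcf_def[abs_def]
      by (rule dd_qmult[OF d smooth_on_differentiable[OF smooth_on_dd[OF s] v]])
    moreover have "dd h (\<lambda>v. qcnj (p v)) v = qcnj (dd h p v)"
      by (rule dd_linear[OF bounded_linear_qcnj smooth_on_differentiable[OF s v]])
    moreover have "qcnj (dd h p v) *\<^sub>H dd k p v = - (mcf p h v *\<^sub>H mcf p k v)"
      using mcf_Im[OF v, of h] unit_mapD(3)[OF p v]
      by (simp add: dd_eq_mcf[OF v] qcnj_qmult qmult_assoc qmult.minus_left)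
    ultimately show ?thesis by simp
  qed
  show ?thesis
    using 1[of h k] 1[of k h] dd_commute[OF o s v, of k h] by simp
qed

text \<open>Differentiating \<open>N \<bottom> \<omega>(k)\<close> turns the Maurer-Cartan equation into a first-order equation for \<open>N\<close>.\<close>

lemma maurer_cartan_normal:
  assumes v: "v \<in> V" and N: "smooth_on V N" "\<And>u h. u \<in> V \<Longrightarrow> N u \<bullet> mcf p h u = 0"
  shows "dd k N v \<bullet> mcf p h v - dd h N v \<bullet> mcf p k v
    = N v \<bullet> (mcf p k v *\<^sub>H mcf p h v - mcf p h v *\<^sub>H mcf p k v)"
proof -
  have 1: "dd h N v \<bullet> mcf p k v + N v \<bullet> dd h (mcf p k) v = 0" for h k
    by (rule dd_inner_const[OF unit_mapD(1)[OF p] v N(1) smooth_on_mcf N(2)])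
  show ?thesis
    unfolding maurer_cartan[OF v, symmetric] inner_diff_right using 1[of h k] 1[of k h] by simp
qed

end

lemma mcf_conj:
  assumes "unit_map V p" "g \<in> unit_quat" "v \<in> V"
  shows "mcf (\<lambda>v. p v *\<^sub>H g) h v = qcnj g *\<^sub>H mcf p h v *\<^sub>H g"
proof -
  have "dd h (\<lambda>v. p v *\<^sub>H g) v = dd h p v *\<^sub>H g"
    by (rule dd_linear[OF qmult.bounded_linear_left smooth_on_differentiable[OF unit_mapD(2)[OF assms(1)] assms(3)]])
  then show ?thesis by (simp add: mcf_def qcnj_qmult qmult_assoc)
qed

lemma unit_map_mult_const:
  assumes "unit_map V p" "g \<in> unit_quat"
  shows "unit_map V (\<lambda>v. p v *\<^sub>H g)"
  using assms unfolding unit_map_def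
  by (auto intro!: smooth_on_qmult)

section \<open>Adapted frames\<close>

text \<open>\<open>adapted p q v \<xi> \<eta> w1 w2\<close>: in the left trivialization the differential of \<open>(p, q)\<close> at \<open>v\<close> has
  the range \<open>\<xi> \<otimes> \<real>\<^sup>2 + \<real> (w1 \<eta>, w2 \<eta>)\<close>.\<close>

definition adapted_basis :: "(R3 \<Rightarrow> quat) \<Rightarrow> (R3 \<Rightarrow> quat) \<Rightarrow> R3 \<Rightarrow> quat \<Rightarrow> quat \<Rightarrow> real \<Rightarrow> real
    \<Rightarrow> R3 \<Rightarrow> R3 \<Rightarrow> R3 \<Rightarrow> bool" where
  "adapted_basis p q v \<xi> \<eta> w1 w2 ha hb hs \<longleftrightarrow>
     mcf p ha v = \<xi> \<and> mcf q ha v = 0 \<and> mcf p hb v = 0 \<and> mcf q hb v = \<xi> \<and>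
     mcf p hs v = w1 *\<^sub>R \<eta> \<and> mcf q hs v = w2 *\<^sub>R \<eta> \<and>
     (\<forall>h. \<exists>x y z. h = x *\<^sub>R ha + y *\<^sub>R hb + z *\<^sub>R hs)"

definition adapted :: "(R3 \<Rightarrow> quat) \<Rightarrow> (R3 \<Rightarrow> quat) \<Rightarrow> R3 \<Rightarrow> quat \<Rightarrow> quat \<Rightarrow> real \<Rightarrow> real \<Rightarrow> bool" where
  "adapted p q v \<xi> \<eta> w1 w2 \<longleftrightarrow> quat_frame \<xi> \<eta> \<and> (w1 \<noteq> 0 \<or> w2 \<noteq> 0) \<and>
     (\<exists>ha hb hs. adapted_basis p q v \<xi> \<eta> w1 w2 ha hb hs)"

lemma adapted_basis_expand:
  assumes "unit_map V p" "unit_map V q" "v \<in> V" "adapted_basis p q v \<xi> \<eta> w1 w2 ha hb hs"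
  obtains x y z where "h = x *\<^sub>R ha + y *\<^sub>R hb + z *\<^sub>R hs"
    "mcf p h v = x *\<^sub>R \<xi> + (z * w1) *\<^sub>R \<eta>" "mcf q h v = y *\<^sub>R \<xi> + (z * w2) *\<^sub>R \<eta>"
proof -
  obtain x y z where h: "h = x *\<^sub>R ha + y *\<^sub>R hb + z *\<^sub>R hs"
    using assms(4) unfolding adapted_basis_def by blast
  note l = linear_mcf[OF assms(1,3)] linear_mcf[OF assms(2,3)]
  have "mcf p h v = x *\<^sub>R \<xi> + (z * w1) *\<^sub>R \<eta>" "mcf q h v = y *\<^sub>R \<xi> + (z * w2) *\<^sub>R \<eta>"
    using assms(4) unfolding h adapted_basis_def
    by (simp_all add: linear_add[OF l(1)] linear_add[OF l(2)] linear_cmul[OF l(1)] linear_cmul[OF l(2)])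
  then show ?thesis using that h by blast
qed

text \<open>This is the freedom left in an adapted frame: signs of \<xi> and \<eta>, and the length
  of w. It normalizes w once its type is known, and it matches a pointwise frame with a smooth
  one.\<close>

lemma adapted_scale:
  assumes "unit_map V p" "unit_map V q" "v \<in> V"
    and "adapted p q v \<xi> \<eta> w1 w2" "c \<noteq> 0" "\<epsilon>1 \<in> {1, -1}" "\<epsilon>2 \<in> {1, -1}"
  shows "adapted p q v (\<epsilon>1 *\<^sub>R \<xi>) (\<epsilon>2 *\<^sub>R \<eta>) (c * w1) (c * w2)"
proof -
  obtain ha hb hs where b: "adapted_basis p q v \<xi> \<eta> w1 w2 ha hb hs" and f: "quat_frame \<xi> \<eta>"
    using assms(4) unfolding adapted_def by blast
  have e: "\<epsilon>1 * \<epsilon>1 = 1" "\<epsilon>2 * \<epsilon>2 = 1" using assms(6,7) by auto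
  note l = linear_mcf[OF assms(1,3)] linear_mcf[OF assms(2,3)]
  have "\<exists>x y z. h = x *\<^sub>R (\<epsilon>1 *\<^sub>R ha) + y *\<^sub>R (\<epsilon>1 *\<^sub>R hb) + z *\<^sub>R ((c * \<epsilon>2) *\<^sub>R hs)" for h
  proof -
    obtain x y z where "h = x *\<^sub>R ha + y *\<^sub>R hb + z *\<^sub>R hs"
      using b unfolding adapted_basis_def by blast
    moreover have "(x * \<epsilon>1) *\<^sub>R (\<epsilon>1 *\<^sub>R ha) = x *\<^sub>R ha" "(y * \<epsilon>1) *\<^sub>R (\<epsilon>1 *\<^sub>R hb) = y *\<^sub>R hb"
      "(z * \<epsilon>2 / c) *\<^sub>R ((c * \<epsilon>2) *\<^sub>R hs) = z *\<^sub>R hs"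
      using e assms(5) by (simp_all add: mult.assoc)
    ultimately have "h = (x * \<epsilon>1) *\<^sub>R (\<epsilon>1 *\<^sub>R ha) + (y * \<epsilon>1) *\<^sub>R (\<epsilon>1 *\<^sub>R hb) + (z * \<epsilon>2 / c) *\<^sub>R ((c * \<epsilon>2) *\<^sub>R hs)"
      by (simp only:)
    then show ?thesis by blast
  qed
  then have "adapted_basis p q v (\<epsilon>1 *\<^sub>R \<xi>) (\<epsilon>2 *\<^sub>R \<eta>) (c * w1) (c * w2) (\<epsilon>1 *\<^sub>R ha) (\<epsilon>1 *\<^sub>R hb) ((c * \<epsilon>2) *\<^sub>R hs)"
    using b unfolding adapted_basis_def
    by (simp add: linear_cmul[OF l(1)] linear_cmul[OF l(2)] mult.commute mult.left_commute)
  moreover have "quat_frame (\<epsilon>1 *\<^sub>R \<xi>) (\<epsilon>2 *\<^sub>R \<eta>)"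
  proof -
    interpret quat_frame \<xi> \<eta> by (rule f)
    show ?thesis by unfold_locales (use e in \<open>auto simp: mult.assoc[symmetric]\<close>)
  qed
  moreover have "c * w1 \<noteq> 0 \<or> c * w2 \<noteq> 0"
    using assms(4,5) unfolding adapted_def by simp
  ultimately show ?thesis
    unfolding adapted_def by blast
qed

text \<open>The form of \<open>p\<close> takes values in the plane of \<xi> and \<eta>. Hence
  brackets on fixed \<open>h\<close> and \<open>k\<close> give a smooth field along the normal
  direction, although the frame itself is only known to exist point by point.\<close>

lemma adapted_normal:
  assumes pq: "unit_map V p" "unit_map V q" "v \<in> V" and ad: "adapted p q v \<xi> \<eta> w1 w2"
  obtains c where "mcf p h v *\<^sub>H mcf p k v - mcf p k v *\<^sub>H mcf p h v = c *\<^sub>R (\<xi> *\<^sub>H \<eta>)"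
proof -
  obtain ha hb hs where b: "adapted_basis p q v \<xi> \<eta> w1 w2 ha hb hs" and f: "quat_frame \<xi> \<eta>"
    using ad unfolding adapted_def by blast
  interpret quat_frame \<xi> \<eta> by (rule f)
  obtain x y z where h: "mcf p h v = x *\<^sub>R \<xi> + (z * w1) *\<^sub>R \<eta>"
    by (rule adapted_basis_expand[OF pq b, of h])
  obtain x' y' z' where k: "mcf p k v = x' *\<^sub>R \<xi> + (z' * w1) *\<^sub>R \<eta>"
    by (rule adapted_basis_expand[OF pq b, of k])
  show ?thesis
    unfolding h k by (rule that[unfolded h k]) (rule commutator)
qed

text \<open>Suppose that both components of w are nonzero. The bracket field \<open>N\<close> is
  smooth and orthogonal to both forms, so \<open>maurer_cartan_normal\<close> applies to each factor
  and determines the \<xi>-component of the derivative of \<open>N\<close> along \<open>hs\<close>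
  twice: as -4 w1^2 and as -4 w1 w2.\<close>

lemma adapted_trichotomy:
  assumes pq: "unit_map V p" "unit_map V q" and v: "v \<in> V"
    and all: "\<And>u. u \<in> V \<Longrightarrow> \<exists>\<xi> \<eta> w1 w2. adapted p q u \<xi> \<eta> w1 w2"
    and ad: "adapted p q v \<xi> \<eta> w1 w2"
  shows "w1 = 0 \<or> w2 = 0 \<or> w1 = w2"
proof (cases "w1 = 0 \<or> w2 = 0")
  case False
  obtain ha hb hs where b: "adapted_basis p q v \<xi> \<eta> w1 w2 ha hb hs" and f: "quat_frame \<xi> \<eta>"
    using ad unfolding adapted_def by blast
  interpret quat_frame \<xi> \<eta> by (rule f)
  define N where "N = (\<lambda>u. mcf p ha u *\<^sub>H mcf p hs u - mcf p hs u *\<^sub>H mcf p ha u)"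
  have o: "open V" using unit_mapD(1)[OF pq(1)] .
  have sN: "smooth_on V N"
    unfolding N_def by (intro smooth_on_diff smooth_on_qmult smooth_on_mcf[OF pq(1)] o)
  have Nperp: "N u \<bullet> mcf p h u = 0 \<and> N u \<bullet> mcf q h u = 0" if u: "u \<in> V" for u h
  proof -
    obtain \<xi>' \<eta>' w1' w2' where ad': "adapted p q u \<xi>' \<eta>' w1' w2'" using all[OF u] by blast
    obtain ha' hb' hs' where b': "adapted_basis p q u \<xi>' \<eta>' w1' w2' ha' hb' hs'" and f': "quat_frame \<xi>' \<eta>'"
      using ad' unfolding adapted_def by blast
    interpret f': quat_frame \<xi>' \<eta>' by (rule f')
    obtain c where "N u = c *\<^sub>R (\<xi>' *\<^sub>H \<eta>')"
      unfolding N_def by (rule adapted_normal[OF pq u ad'])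
    then show ?thesis
      by (auto intro: adapted_basis_expand[OF pq u b', of h] simp: inner_add_right)
  qed
  have Nv: "N v = (2 * w1) *\<^sub>R \<zeta>"
    using b commutator[of 1 0 0 w1] by (simp add: N_def adapted_basis_def)
  note Ep = maurer_cartan_normal[OF pq(1) v sN conjunct1[OF Nperp]]
    and Eq = maurer_cartan_normal[OF pq(2) v sN conjunct2[OF Nperp]]
  note bs = b[unfolded adapted_basis_def]
  \<comment> \<open>One of the two vectors lies in the kernel of the form of \<open>q\<close>, so
    the bracket vanishes; \<open>w2\<close> is nonzero and cancels. Fact 3 is the counterpart for
    the form of \<open>p\<close>, and both serve to drop the unknown \<eta>-components from 2 and
    4.\<close>
  have 1: "dd ha N v \<bullet> \<eta> = 0"
    using Eq[of ha hs] bs False by (simp add: qmult.zero_left qmult.zero_right)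
  have 2: "dd hs N v \<bullet> \<xi> - dd ha N v \<bullet> (w1 *\<^sub>R \<eta>) = - (4 * w1 * w1)"
    using Ep[of hs ha] bs commutator[of 0 w1 1 0] by (simp add: Nv)
  have 3: "dd hb N v \<bullet> \<eta> = 0"
    using Ep[of hb hs] bs False by (simp add: qmult.zero_left qmult.zero_right)
  have 4: "dd hs N v \<bullet> \<xi> - dd hb N v \<bullet> (w2 *\<^sub>R \<eta>) = - (4 * w1 * w2)"
    using Eq[of hs hb] bs commutator[of 0 w2 1 0] by (simp add: Nv)
  have "w1 * w1 = w1 * w2" using 1 2 3 4 by simp
  then show ?thesis by auto
qed auto

text \<open>Each of the three types is the vanishing of the brackets of a fixed combination of the
  two forms. This condition is closed and does not mention the frame. The three sets are disjoint
  and cover the connected set \<open>V\<close>, so one of them is all of \<open>V\<close>.\<close>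

lemma adapted_types:
  assumes pq: "unit_map V p" "unit_map V q" and V: "connected V"
    and all: "\<And>u. u \<in> V \<Longrightarrow> \<exists>\<xi> \<eta> w1 w2. adapted p q u \<xi> \<eta> w1 w2"
  obtains (0) "\<And>u. u \<in> V \<Longrightarrow> \<exists>\<xi> \<eta>. adapted p q u \<xi> \<eta> 0 1"
    | (1) "\<And>u. u \<in> V \<Longrightarrow> \<exists>\<xi> \<eta>. adapted p q u \<xi> \<eta> 1 0"
    | (2) "\<And>u. u \<in> V \<Longrightarrow> \<exists>\<xi> \<eta>. adapted p q u \<xi> \<eta> 1 1"
proof -
  have o: "open V" using unit_mapD(1)[OF pq(1)] .
  \<comment> \<open>The form \<alpha> \<omega>_p + \<beta> \<omega>_q has the coefficient \<alpha>
    w1 + \<beta> w2 at \<eta>. Its values at a point are all parallel to \<xi>, hence commute,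
    exactly when this coefficient vanishes.\<close>
  define Z where "Z = (\<lambda>\<alpha> \<beta>. {v \<in> V. \<forall>h k.
    (\<alpha> *\<^sub>R mcf p h v + \<beta> *\<^sub>R mcf q h v) *\<^sub>H (\<alpha> *\<^sub>R mcf p k v + \<beta> *\<^sub>R mcf q k v)
    - (\<alpha> *\<^sub>R mcf p k v + \<beta> *\<^sub>R mcf q k v) *\<^sub>H (\<alpha> *\<^sub>R mcf p h v + \<beta> *\<^sub>R mcf q h v) = 0})"
  have closed: "closedin (top_of_set V) (Z \<alpha> \<beta>)" for \<alpha> \<beta>
  proof -
    let ?c = "\<lambda>h k v. (\<alpha> *\<^sub>R mcf p h v + \<beta> *\<^sub>R mcf q h v) *\<^sub>H (\<alpha> *\<^sub>R mcf p k v + \<beta> *\<^sub>R mcf q k v)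
      - (\<alpha> *\<^sub>R mcf p k v + \<beta> *\<^sub>R mcf q k v) *\<^sub>H (\<alpha> *\<^sub>R mcf p h v + \<beta> *\<^sub>R mcf q h v)"
    have "continuous_on V (?c h k)" for h k
      by (intro smooth_on_continuous smooth_on_diff smooth_on_qmult smooth_on_add smooth_on_scaleR
          smooth_on_mcf[OF pq(1)] smooth_on_mcf[OF pq(2)] smooth_on_const o)
    then have "closedin (top_of_set V) {v \<in> V. ?c h k v = 0}" for h k
      using continuous_closedin_preimage_constant by blast
    then have "closedin (top_of_set V) (\<Inter>h. \<Inter>k. {v \<in> V. ?c h k v = 0})"
      by (intro closedin_INT) auto
    moreover have "(\<Inter>h. \<Inter>k. {v \<in> V. ?c h k v = 0}) = Z \<alpha> \<beta>"
      unfolding Z_def by auto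
    ultimately show ?thesis by simp
  qed
  \<comment> \<open>The brackets of \<open>ha\<close> and of \<open>hb\<close> with
    \<open>hs\<close> are 2 \<alpha> (\<alpha> w1 + \<beta> w2) and 2 \<beta> (\<alpha> w1 + \<beta>
    w2) times \<zeta>, so one nonzero coefficient is enough.\<close>
  have Z: "v \<in> Z \<alpha> \<beta> \<longleftrightarrow> \<alpha> * w1 + \<beta> * w2 = 0"
    if v: "v \<in> V" and ad: "adapted p q v \<xi> \<eta> w1 w2" and ab: "\<alpha> \<noteq> 0 \<or> \<beta> \<noteq> 0" for v \<xi> \<eta> w1 w2 \<alpha> \<beta>
  proof -
    obtain ha hb hs where b: "adapted_basis p q v \<xi> \<eta> w1 w2 ha hb hs" and f: "quat_frame \<xi> \<eta>"
      using ad unfolding adapted_def by blast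
    interpret quat_frame \<xi> \<eta> by (rule f)
    note bs = b[unfolded adapted_basis_def]
    have z0: "\<zeta> \<noteq> 0" using zeta_inner(5) by (metis inner_zero_left zero_neq_one)
    show ?thesis
    proof
      assume "v \<in> Z \<alpha> \<beta>"
      then have c0: "(\<alpha> *\<^sub>R mcf p h v + \<beta> *\<^sub>R mcf q h v) *\<^sub>H (\<alpha> *\<^sub>R mcf p k v + \<beta> *\<^sub>R mcf q k v)
        - (\<alpha> *\<^sub>R mcf p k v + \<beta> *\<^sub>R mcf q k v) *\<^sub>H (\<alpha> *\<^sub>R mcf p h v + \<beta> *\<^sub>R mcf q h v) = 0" for h k
        unfolding Z_def by blast
      have "\<alpha> * (\<alpha> * w1 + \<beta> * w2) = 0"
        using c0[of ha hs] bs commutator[of \<alpha> 0 0 "\<alpha> * w1 + \<beta> * w2"] z0 by (simp add: scaleR_add_left)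
      moreover have "\<beta> * (\<alpha> * w1 + \<beta> * w2) = 0"
        using c0[of hb hs] bs commutator[of \<beta> 0 0 "\<alpha> * w1 + \<beta> * w2"] z0 by (simp add: scaleR_add_left)
      ultimately show "\<alpha> * w1 + \<beta> * w2 = 0" using ab by auto
    next
      assume w: "\<alpha> * w1 + \<beta> * w2 = 0"
      have "\<exists>x. \<alpha> *\<^sub>R mcf p h v + \<beta> *\<^sub>R mcf q h v = x *\<^sub>R \<xi>" for h
      proof -
        obtain x y z where e: "mcf p h v = x *\<^sub>R \<xi> + (z * w1) *\<^sub>R \<eta>" "mcf q h v = y *\<^sub>R \<xi> + (z * w2) *\<^sub>R \<eta>"
          by (rule adapted_basis_expand[OF pq v b])
        have "\<alpha> *\<^sub>R mcf p h v + \<beta> *\<^sub>R mcf q h v = (\<alpha> * x + \<beta> * y) *\<^sub>R \<xi> + (z * (\<alpha> * w1 + \<beta> * w2)) *\<^sub>R \<eta>"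
          unfolding e by (simp add: algebra_simps)
        then show ?thesis using w by auto
      qed
      then obtain X where "\<And>h. \<alpha> *\<^sub>R mcf p h v + \<beta> *\<^sub>R mcf q h v = X h *\<^sub>R \<xi>" by metis
      then show "v \<in> Z \<alpha> \<beta>"
        using v by (simp add: Z_def qmult.scaleR_left qmult.scaleR_right mult.commute)
    qed
  qed
  have memZ: "v \<in> Z 1 0 \<longleftrightarrow> w1 = 0" "v \<in> Z 0 1 \<longleftrightarrow> w2 = 0" "v \<in> Z 1 (-1) \<longleftrightarrow> w1 = w2"
    if "v \<in> V" "adapted p q v \<xi> \<eta> w1 w2" for v \<xi> \<eta> w1 w2
    using Z[OF that, of 1 0] Z[OF that, of 0 1] Z[OF that, of 1 "-1"] by auto
  have cover: "v \<in> Z 1 0 \<union> (Z 0 1 \<union> Z 1 (-1))" if "v \<in> V" for v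
    using all[OF that] adapted_trichotomy[OF pq that all] memZ[OF that] by blast
  have disj: "\<not> (v \<in> Z 1 0 \<and> v \<in> Z 0 1)" "\<not> (v \<in> Z 1 0 \<and> v \<in> Z 1 (-1))" "\<not> (v \<in> Z 0 1 \<and> v \<in> Z 1 (-1))"
    if "v \<in> V" for v
    using all[OF that] memZ[OF that] unfolding adapted_def by metis+
  have sub: "Z \<alpha> \<beta> \<subseteq> V" for \<alpha> \<beta> by (auto simp: Z_def)
  have split: "A = {} \<or> B = {}" if "closedin (top_of_set V) A" "closedin (top_of_set V) B" "V \<subseteq> A \<union> B" "A \<inter> B = {}" for A B
    using V that unfolding connected_closedin by blast
  have "Z 1 0 = {} \<or> (Z 0 1 \<union> Z 1 (-1)) = {}"
    using cover disj sub by (intro split closed closedin_Un) blast+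
  moreover have "Z 0 1 = {} \<or> Z 1 (-1) = {}" if "Z 1 0 = {}"
    using cover disj sub that by (intro split closed) blast+
  ultimately consider "V \<subseteq> Z 1 0" | "V \<subseteq> Z 0 1" | "V \<subseteq> Z 1 (-1)"
    using cover by blast
  then show ?thesis
  proof cases
    case 1
    have "\<exists>\<xi> \<eta>. adapted p q u \<xi> \<eta> 0 1" if u: "u \<in> V" for u
    proof -
      obtain \<xi> \<eta> w1 w2 where ad: "adapted p q u \<xi> \<eta> w1 w2" using all[OF u] by blast
      then have "w1 = 0" "w2 \<noteq> 0" using memZ[OF u ad] 1 u unfolding adapted_def by auto
      then have "adapted p q u \<xi> \<eta> 0 1"
        using adapted_scale[OF pq u ad, of "1 / w2" 1 1] by simp
      then show ?thesis by blast
    qed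
    then show ?thesis by (rule that(1))
  next
    case 2
    have "\<exists>\<xi> \<eta>. adapted p q u \<xi> \<eta> 1 0" if u: "u \<in> V" for u
    proof -
      obtain \<xi> \<eta> w1 w2 where ad: "adapted p q u \<xi> \<eta> w1 w2" using all[OF u] by blast
      then have "w2 = 0" "w1 \<noteq> 0" using memZ[OF u ad] 2 u unfolding adapted_def by auto
      then have "adapted p q u \<xi> \<eta> 1 0"
        using adapted_scale[OF pq u ad, of "1 / w1" 1 1] by simp
      then show ?thesis by blast
    qed
    then show ?thesis by (rule that(2))
  next
    case 3
    have "\<exists>\<xi> \<eta>. adapted p q u \<xi> \<eta> 1 1" if u: "u \<in> V" for u
    proof -
      obtain \<xi> \<eta> w1 w2 where ad: "adapted p q u \<xi> \<eta> w1 w2" using all[OF u] by blast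
      then have "w1 = w2" "w1 \<noteq> 0" using memZ[OF u ad] 3 u unfolding adapted_def by auto
      then have "adapted p q u \<xi> \<eta> 1 1"
        using adapted_scale[OF pq u ad, of "1 / w1" 1 1] by simp
      then show ?thesis by blast
    qed
    then show ?thesis by (rule that(3))
  qed
qed

subsection \<open>The case \<open>w = (1, 0)\<close>\<close>

lemma (in quat_frame) unit_multiple:
  assumes "u = c *\<^sub>R \<xi>" "c \<noteq> 0"
  shows "(1 / norm u) *\<^sub>R u = sgn c *\<^sub>R \<xi>"
proof -
  have "norm \<xi> = 1" by (simp add: norm_eq_sqrt_inner)
  then show ?thesis using assms by (simp add: sgn_real_def)
qed

text \<open>Pointwise frames may jump by signs. With w = (1,0) the form of \<open>q\<close> is
  parallel to \<xi>, so its value on a fixed vector, normalized, is a smooth choice of \<xi>. The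
  normalized bracket is a smooth choice of \<zeta>, and \<eta> = \<zeta> \<xi>. Fixing the vectors
  of the adapted basis at \<open>v0\<close> makes both fields nonzero nearby.\<close>

lemma adapted_smooth_frame:
  assumes pq: "unit_map V p" "unit_map V q" and v0: "v0 \<in> V"
    and all: "\<And>u. u \<in> V \<Longrightarrow> \<exists>\<xi> \<eta>. adapted p q u \<xi> \<eta> 1 0"
  obtains r \<xi> \<eta> where "0 < r" "ball v0 r \<subseteq> V" "smooth_on (ball v0 r) \<xi>" "smooth_on (ball v0 r) \<eta>"
    "\<And>v. v \<in> ball v0 r \<Longrightarrow> adapted p q v (\<xi> v) (\<eta> v) 1 0"
proof -
  have o: "open V" using unit_mapD(1)[OF pq(1)] .
  obtain \<xi>0 \<eta>0 ha hb hs where b0: "adapted_basis p q v0 \<xi>0 \<eta>0 1 0 ha hb hs" and f0: "quat_frame \<xi>0 \<eta>0"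
    using all[OF v0] unfolding adapted_def by blast
  interpret f0: quat_frame \<xi>0 \<eta>0 by (rule f0)
  define W where "W = mcf q hb"
  define N where "N = (\<lambda>u. mcf p ha u *\<^sub>H mcf p hs u - mcf p hs u *\<^sub>H mcf p ha u)"
  have sW: "smooth_on V W" unfolding W_def by (rule smooth_on_mcf[OF pq(2)])
  have sN: "smooth_on V N"
    unfolding N_def by (intro smooth_on_diff smooth_on_qmult smooth_on_mcf[OF pq(1)] o)
  have "W v0 = \<xi>0" "N v0 = 2 *\<^sub>R (\<xi>0 *\<^sub>H \<eta>0)"
    using b0 f0.commutator[of 1 0 0 1] by (simp_all add: W_def N_def adapted_basis_def)
  then have nz: "W v0 \<noteq> 0" "N v0 \<noteq> 0"
    using f0.unit f0.zeta_inner(5) by (metis inner_zero_left zero_neq_one scaleR_eq_0_iff zero_neq_numeral)+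
  have "open (V \<inter> W -` (- {0}))" "open (V \<inter> N -` (- {0}))"
    by (intro continuous_open_preimage smooth_on_continuous sW sN o; simp add: open_Compl)+
  then have "open ((V \<inter> W -` (- {0})) \<inter> (V \<inter> N -` (- {0})))" by (rule open_Int)
  moreover have "v0 \<in> (V \<inter> W -` (- {0})) \<inter> (V \<inter> N -` (- {0}))" using v0 nz by simp
  ultimately obtain r where r: "r > 0" "ball v0 r \<subseteq> (V \<inter> W -` (- {0})) \<inter> (V \<inter> N -` (- {0}))"
    using openE by blast
  let ?B = "ball v0 r"
  have BV: "?B \<subseteq> V" and nzB: "\<And>v. v \<in> ?B \<Longrightarrow> W v \<noteq> 0" "\<And>v. v \<in> ?B \<Longrightarrow> N v \<noteq> 0"
    using r(2) by auto
  define \<xi> where "\<xi> = (\<lambda>v. (1 / norm (W v)) *\<^sub>R W v)"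
  define \<zeta> where "\<zeta> = (\<lambda>v. (1 / norm (N v)) *\<^sub>R N v)"
  define \<eta> where "\<eta> = (\<lambda>v. \<zeta> v *\<^sub>H \<xi> v)"
  have s\<xi>: "smooth_on ?B \<xi>"
    unfolding \<xi>_def by (rule smooth_on_normalize) (use smooth_on_subset[OF sW BV] nzB in auto)
  have s\<zeta>: "smooth_on ?B \<zeta>"
    unfolding \<zeta>_def by (rule smooth_on_normalize) (use smooth_on_subset[OF sN BV] nzB in auto)
  have s\<eta>: "smooth_on ?B \<eta>"
    unfolding \<eta>_def by (intro smooth_on_qmult s\<xi> s\<zeta> open_ball)
  have "adapted p q v (\<xi> v) (\<eta> v) 1 0" if v: "v \<in> ?B" for v
  proof -
    have vV: "v \<in> V" using v BV by auto
    obtain x y where ad: "adapted p q v x y 1 0" using all[OF vV] by blast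
    then obtain ha' hb' hs' where b: "adapted_basis p q v x y 1 0 ha' hb' hs'" and f: "quat_frame x y"
      unfolding adapted_def by blast
    interpret quat_frame x y by (rule f)
    \<comment> \<open>Taking \<open>x *\<^sub>H y\<close> as the first vector of a frame makes
      \<open>unit_multiple\<close> available for the normal direction.\<close>
    interpret \<zeta>: quat_frame "x *\<^sub>H y" x by unfold_locales auto
    obtain c where c: "W v = c *\<^sub>R x"
      by (rule adapted_basis_expand[OF pq vV b, of hb]) (auto simp: W_def)
    then have x: "\<xi> v = sgn c *\<^sub>R x" "sgn c \<in> {1, -1}"
      using unit_multiple[OF c] nzB(1)[OF v] by (auto simp: \<xi>_def sgn_real_def)
    obtain d where d: "N v = d *\<^sub>R (x *\<^sub>H y)"
      unfolding N_def by (rule adapted_normal[OF pq vV ad])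
    then have z: "\<zeta> v = sgn d *\<^sub>R (x *\<^sub>H y)" "sgn d \<in> {1, -1}"
      using \<zeta>.unit_multiple[OF d] nzB(2)[OF v] by (auto simp: \<zeta>_def sgn_real_def)
    have "\<eta> v = (sgn d * sgn c) *\<^sub>R y"
      by (simp add: \<eta>_def x z qmult.scaleR_left qmult.scaleR_right zeta_xi)
    moreover have "sgn d * sgn c \<in> {1, -1}" using x(2) z(2) by auto
    ultimately show ?thesis
      using adapted_scale[OF pq vV ad, of 1 "sgn c" "sgn d * sgn c"] x by simp
  qed
  then show ?thesis using that[OF r(1) BV s\<xi> s\<eta>] by blast
qed

section \<open>Structure equations of a smooth frame of type (1,0)\<close>

locale smooth_frame =
  fixes V :: "R3 set" and p q \<xi> \<eta> :: "R3 \<Rightarrow> quat"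
  assumes pq: "unit_map V p" "unit_map V q"
    and s\<xi>: "smooth_on V \<xi>" and s\<eta>: "smooth_on V \<eta>"
    and ad: "\<And>v. v \<in> V \<Longrightarrow> adapted p q v (\<xi> v) (\<eta> v) 1 0"
begin

lemma V: "open V" using unit_mapD(1)[OF pq(1)] .

abbreviation "\<zeta> v \<equiv> \<xi> v *\<^sub>H \<eta> v"
text \<open>The coframe dual to the adapted basis: the two forms are a \<xi> + s \<eta> and b
  \<xi>.\<close>

abbreviation "a h v \<equiv> mcf p h v \<bullet> \<xi> v"
abbreviation "b h v \<equiv> mcf q h v \<bullet> \<xi> v"
abbreviation "s h v \<equiv> mcf p h v \<bullet> \<eta> v"

lemma frame: "v \<in> V \<Longrightarrow> quat_frame (\<xi> v) (\<eta> v)"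
  using ad unfolding adapted_def by blast

lemma s\<zeta>: "smooth_on V \<zeta>"
  by (intro smooth_on_qmult s\<xi> s\<eta> V)

lemma mcf_components:
  assumes v: "v \<in> V"
  shows "mcf p h v = a h v *\<^sub>R \<xi> v + s h v *\<^sub>R \<eta> v" "mcf q h v = b h v *\<^sub>R \<xi> v"
proof -
  interpret F: quat_frame "\<xi> v" "\<eta> v" by (rule frame[OF v])
  obtain ha hb hs where bs: "adapted_basis p q v (\<xi> v) (\<eta> v) 1 0 ha hb hs"
    using ad[OF v] unfolding adapted_def by blast
  obtain x y z where "mcf p h v = x *\<^sub>R \<xi> v + (z * 1) *\<^sub>R \<eta> v" "mcf q h v = y *\<^sub>R \<xi> v + (z * 0) *\<^sub>R \<eta> v"
    by (rule adapted_basis_expand[OF pq v bs, of h])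
  then show "mcf p h v = a h v *\<^sub>R \<xi> v + s h v *\<^sub>R \<eta> v" "mcf q h v = b h v *\<^sub>R \<xi> v"
    by (simp_all add: inner_add_left)
qed

lemma dual_basis:
  assumes v: "v \<in> V"
  obtains ha hb hs where "a ha v = 1" "b ha v = 0" "s ha v = 0" "a hb v = 0" "b hb v = 1" "s hb v = 0"
    "a hs v = 0" "b hs v = 0" "s hs v = 1" "\<forall>h. h = a h v *\<^sub>R ha + b h v *\<^sub>R hb + s h v *\<^sub>R hs"
proof -
  interpret F: quat_frame "\<xi> v" "\<eta> v" by (rule frame[OF v])
  obtain ha hb hs where bs: "adapted_basis p q v (\<xi> v) (\<eta> v) 1 0 ha hb hs"
    using ad[OF v] unfolding adapted_def by blast
  have "h = a h v *\<^sub>R ha + b h v *\<^sub>R hb + s h v *\<^sub>R hs" for h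
  proof -
    obtain x y z where h: "h = x *\<^sub>R ha + y *\<^sub>R hb + z *\<^sub>R hs"
      and m: "mcf p h v = x *\<^sub>R \<xi> v + (z * 1) *\<^sub>R \<eta> v" "mcf q h v = y *\<^sub>R \<xi> v + (z * 0) *\<^sub>R \<eta> v"
      by (rule adapted_basis_expand[OF pq v bs, of h])
    have "a h v = x" "b h v = y" "s h v = z"
      unfolding m by (simp_all add: inner_add_left)
    then show ?thesis using h by simp
  qed
  then have "\<forall>h. h = a h v *\<^sub>R ha + b h v *\<^sub>R hb + s h v *\<^sub>R hs" by blast
  then show ?thesis
    by (rule that[rotated 9]) (use bs in \<open>auto simp: adapted_basis_def\<close>)
qed

lemma linear_abs:
  assumes "v \<in> V"
  shows "linear (\<lambda>h. a h v)" "linear (\<lambda>h. b h v)" "linear (\<lambda>h. s h v)"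
  using linear_mcf[OF pq(1) assms] linear_mcf[OF pq(2) assms]
  by (auto simp: linear_iff inner_add_left)

lemma smooth_abs: "smooth_on V (a h)" "smooth_on V (b h)" "smooth_on V (s h)"
  by (intro smooth_on_inner smooth_on_mcf[OF pq(1)] smooth_on_mcf[OF pq(2)] s\<xi> s\<eta> V)+

text \<open>Both forms are orthogonal to \<zeta>, and \<open>maurer_cartan_normal\<close> on pairs
  of the dual basis determines the \<xi>- and \<eta>-components of d\<zeta>. The one value left open
  is the \<eta>-component along \<open>hs\<close>, whence the restriction to the kernel of
  \<open>s\<close> in the second part.\<close>

lemma zeta_equations:
  assumes v: "v \<in> V"
  shows "dd h \<zeta> v \<bullet> \<xi> v = 0" and "s h v = 0 \<Longrightarrow> dd h \<zeta> v \<bullet> \<eta> v = 2 * a h v"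
proof -
  interpret F: quat_frame "\<xi> v" "\<eta> v" by (rule frame[OF v])
  obtain ha hb hs where bs: "a ha v = 1" "b ha v = 0" "s ha v = 0" "a hb v = 0" "b hb v = 1" "s hb v = 0"
    "a hs v = 0" "b hs v = 0" "s hs v = 1" and ex: "\<forall>h. h = a h v *\<^sub>R ha + b h v *\<^sub>R hb + s h v *\<^sub>R hs"
    by (rule dual_basis[OF v])
  have perp: "\<zeta> u \<bullet> mcf p h u = 0" "\<zeta> u \<bullet> mcf q h u = 0" if u: "u \<in> V" for u h
  proof -
    interpret u: quat_frame "\<xi> u" "\<eta> u" by (rule frame[OF u])
    show "\<zeta> u \<bullet> mcf p h u = 0" "\<zeta> u \<bullet> mcf q h u = 0"
      by (subst mcf_components[OF u], simp add: inner_add_right)+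
  qed
  note Ep = maurer_cartan_normal[OF pq(1) v s\<zeta> perp(1)] and Eq = maurer_cartan_normal[OF pq(2) v s\<zeta> perp(2)]
  have m: "mcf p ha v = \<xi> v" "mcf q ha v = 0" "mcf p hb v = 0" "mcf q hb v = \<xi> v"
    "mcf p hs v = \<eta> v" "mcf q hs v = 0"
    by (subst mcf_components[OF v], simp add: bs)+
  have c: "\<eta> v *\<^sub>H \<xi> v - \<xi> v *\<^sub>H \<eta> v = (- 2) *\<^sub>R \<zeta> v"
    using F.commutator[of 0 1 1 0] by simp
  have z: "dd ha \<zeta> v \<bullet> \<xi> v = 0" "dd hb \<zeta> v \<bullet> \<xi> v = 0" "dd hs \<zeta> v \<bullet> \<xi> v = 0"
    "dd ha \<zeta> v \<bullet> \<eta> v = 2" "dd hb \<zeta> v \<bullet> \<eta> v = 0"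
    using Eq[of hb ha] Ep[of hb ha] Eq[of hs hb] Ep[of hs ha] Ep[of hb hs]
    by (simp_all add: m c qmult.zero_left qmult.zero_right)
  have l: "linear (\<lambda>h. dd h \<zeta> v)"
    by (rule linear_dd[OF smooth_on_differentiable[OF s\<zeta> v]])
  have e: "dd h \<zeta> v = a h v *\<^sub>R dd ha \<zeta> v + b h v *\<^sub>R dd hb \<zeta> v + s h v *\<^sub>R dd hs \<zeta> v"
    by (subst ex[rule_format, of h]) (simp only: linear_add[OF l] linear_cmul[OF l])
  show "dd h \<zeta> v \<bullet> \<xi> v = 0" unfolding e by (simp add: inner_add_left z)
  show "dd h \<zeta> v \<bullet> \<eta> v = 2 * a h v" if "s h v = 0"
    unfolding e by (simp add: inner_add_left z that)
qed

text \<open>These are the differentiated relations of an orthonormal imaginary frame. The last one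
  also uses that d\<zeta> has no \<xi>-component; it leaves d\<xi> only a component along
  \<eta>.\<close>

lemma unit_perp_dd:
  assumes v: "v \<in> V"
  shows "dd h \<xi> v \<bullet> \<xi> v = 0" "dd h \<eta> v \<bullet> \<eta> v = 0" "dd h \<zeta> v \<bullet> \<zeta> v = 0"
    "dd h \<xi> v \<in> Im_quat" "dd h \<eta> v \<in> Im_quat" "dd h \<zeta> v \<in> Im_quat"
    "dd h \<eta> v \<bullet> \<zeta> v = - (dd h \<zeta> v \<bullet> \<eta> v)" "dd h \<xi> v \<bullet> \<zeta> v = 0"
proof -
  have fr: "\<xi> u \<bullet> \<xi> u = 1" "\<eta> u \<bullet> \<eta> u = 1" "\<zeta> u \<bullet> \<zeta> u = 1" "\<eta> u \<bullet> \<zeta> u = 0" "\<xi> u \<bullet> \<zeta> u = 0"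
    "\<xi> u \<in> Im_quat" "\<eta> u \<in> Im_quat" "\<zeta> u \<in> Im_quat" if u: "u \<in> V" for u
  proof -
    interpret u: quat_frame "\<xi> u" "\<eta> u" by (rule frame[OF u])
    show "\<xi> u \<bullet> \<xi> u = 1" "\<eta> u \<bullet> \<eta> u = 1" "\<zeta> u \<bullet> \<zeta> u = 1" "\<eta> u \<bullet> \<zeta> u = 0" "\<xi> u \<bullet> \<zeta> u = 0"
      "\<xi> u \<in> Im_quat" "\<eta> u \<in> Im_quat" "\<zeta> u \<in> Im_quat" by auto
  qed
  show "dd h \<xi> v \<in> Im_quat" "dd h \<eta> v \<in> Im_quat" "dd h \<zeta> v \<in> Im_quat"
    using fr(6-8) by (auto intro!: dd_Im[OF V v] s\<xi> s\<eta> s\<zeta>)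
  have "dd h \<xi> v \<bullet> \<xi> v + \<xi> v \<bullet> dd h \<xi> v = 0" by (rule dd_inner_const[OF V v s\<xi> s\<xi> fr(1)])
  then show "dd h \<xi> v \<bullet> \<xi> v = 0" by (simp add: inner_commute)
  have "dd h \<eta> v \<bullet> \<eta> v + \<eta> v \<bullet> dd h \<eta> v = 0" by (rule dd_inner_const[OF V v s\<eta> s\<eta> fr(2)])
  then show "dd h \<eta> v \<bullet> \<eta> v = 0" by (simp add: inner_commute)
  have "dd h \<zeta> v \<bullet> \<zeta> v + \<zeta> v \<bullet> dd h \<zeta> v = 0" by (rule dd_inner_const[OF V v s\<zeta> s\<zeta> fr(3)])
  then show "dd h \<zeta> v \<bullet> \<zeta> v = 0" by (simp add: inner_commute)
  have "dd h \<eta> v \<bullet> \<zeta> v + \<eta> v \<bullet> dd h \<zeta> v = 0" by (rule dd_inner_const[OF V v s\<eta> s\<zeta> fr(4)])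
  then show "dd h \<eta> v \<bullet> \<zeta> v = - (dd h \<zeta> v \<bullet> \<eta> v)" by (simp add: inner_commute)
  have "dd h \<xi> v \<bullet> \<zeta> v + \<xi> v \<bullet> dd h \<zeta> v = 0" by (rule dd_inner_const[OF V v s\<xi> s\<zeta> fr(5)])
  then show "dd h \<xi> v \<bullet> \<zeta> v = 0" using zeta_equations(1)[OF v] by (simp add: inner_commute)
qed

text \<open>The form of \<open>q\<close> is b \<xi>, whose values at a point commute, so the
  Maurer-Cartan equation says that b \<xi> is closed. Its \<xi>-component is the closedness of b;
  the rest is b \<and> d\<xi> = 0.\<close>

lemma b_dd_xi:
  assumes v: "v \<in> V"
  shows "b k v *\<^sub>R dd h \<xi> v = b h v *\<^sub>R dd k \<xi> v" "dd h (b k) v = dd k (b h) v"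
proof -
  interpret F: quat_frame "\<xi> v" "\<eta> v" by (rule frame[OF v])
  have 1: "dd h (mcf q k) v = b k v *\<^sub>R dd h \<xi> v + dd h (b k) v *\<^sub>R \<xi> v" for h k
  proof -
    have "dd h (mcf q k) v = dd h (\<lambda>u. b k u *\<^sub>R \<xi> u) v"
      by (rule dd_cong[OF V v]) (rule mcf_components(2))
    also have "\<dots> = b k v *\<^sub>R dd h \<xi> v + dd h (b k) v *\<^sub>R \<xi> v"
      by (rule dd_bilinear[OF bounded_bilinear_scaleR smooth_on_differentiable[OF smooth_abs(2) v]
            smooth_on_differentiable[OF s\<xi> v]])
    finally show ?thesis .
  qed
  have "mcf q k v *\<^sub>H mcf q h v - mcf q h v *\<^sub>H mcf q k v = 0"
    using F.commutator[of "b k v" 0 "b h v" 0] mcf_components(2)[OF v] by simp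
  then have 0: "b k v *\<^sub>R dd h \<xi> v + dd h (b k) v *\<^sub>R \<xi> v - (b h v *\<^sub>R dd k \<xi> v + dd k (b h) v *\<^sub>R \<xi> v) = 0"
    using maurer_cartan[OF pq(2) v, of h k] unfolding 1 by simp
  then have "(b k v *\<^sub>R dd h \<xi> v + dd h (b k) v *\<^sub>R \<xi> v - (b h v *\<^sub>R dd k \<xi> v + dd k (b h) v *\<^sub>R \<xi> v)) \<bullet> \<xi> v = 0"
    by simp
  then show "dd h (b k) v = dd k (b h) v"
    by (simp add: inner_diff_left inner_add_left unit_perp_dd(1)[OF v])
  then show "b k v *\<^sub>R dd h \<xi> v = b h v *\<^sub>R dd k \<xi> v" using 0 by simp
qed

text \<open>Differentiating \<open>\<langle>d\<xi>, \<zeta>\<rangle> = 0\<close> and using the symmetry of the second derivative of \<open>\<xi>\<close> gives the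
  integrability condition that forces \<open>\<xi>\<close> to be constant.\<close>

lemma dd_xi_zero:
  assumes v: "v \<in> V"
  shows "dd h \<xi> v = 0"
proof -
  interpret F: quat_frame "\<xi> v" "\<eta> v" by (rule frame[OF v])
  obtain ha hb hs where bs: "a ha v = 1" "b ha v = 0" "s ha v = 0" "b hb v = 1"
    by (rule dual_basis[OF v])
  \<comment> \<open>By b \<and> d\<xi> = 0 the derivative of \<xi> is proportional to b, which
    vanishes on \<open>ha\<close>.\<close>
  have ha: "dd ha \<xi> v = 0" using b_dd_xi(1)[OF v, of hb ha] bs by simp
  have sym: "dd k (dd h \<xi>) v \<bullet> \<zeta> v + dd h \<xi> v \<bullet> dd k \<zeta> v = 0" for h k
    by (rule dd_inner_const[OF V v smooth_on_dd[OF s\<xi>] s\<zeta> unit_perp_dd(8)])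
  have "dd hb \<xi> v \<bullet> dd ha \<zeta> v = dd ha \<xi> v \<bullet> dd hb \<zeta> v"
    using sym[of ha hb] sym[of hb ha] dd_commute[OF V s\<xi> v, of ha hb] by simp
  then have "dd hb \<xi> v \<bullet> dd ha \<zeta> v = 0" using ha by simp
  moreover have "dd ha \<zeta> v = 2 *\<^sub>R \<eta> v"
    using F.Im_expand[OF unit_perp_dd(6)[OF v, of ha]] zeta_equations[OF v, of ha] unit_perp_dd(3)[OF v] bs by simp
  \<comment> \<open>The derivative along \<open>ha\<close> of \<zeta> is 2 \<eta>, so the vanishing
    product removes the \<eta>-component, the last one that could survive.\<close>
  ultimately have "dd hb \<xi> v = 0"
    by (intro F.Im_zeroI unit_perp_dd v) simp
  then show ?thesis using b_dd_xi(1)[OF v, of hb h] bs by simp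
qed

text \<open>Brackets of the form of \<open>p\<close> point along \<zeta>, so its exterior derivative
  has no component along \<xi> or \<eta>. Passing from there to a and s costs nothing: \<xi> is
  constant, and d\<eta> is orthogonal to \<xi> and \<eta>, hence to the form.\<close>

lemma closed_forms:
  assumes v: "v \<in> V"
  shows "dd h (a k) v = dd k (a h) v" "dd h (s k) v = dd k (s h) v"
proof -
  interpret F: quat_frame "\<xi> v" "\<eta> v" by (rule frame[OF v])
  obtain c where c: "mcf p k v *\<^sub>H mcf p h v - mcf p h v *\<^sub>H mcf p k v = c *\<^sub>R \<zeta> v"
    by (rule adapted_normal[OF pq v ad[OF v], of k h])
  have "(dd h (mcf p k) v - dd k (mcf p h) v) \<bullet> x = c *\<^sub>R \<zeta> v \<bullet> x" for x
    unfolding maurer_cartan[OF pq(1) v] c ..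
  from this[of "\<xi> v"] this[of "\<eta> v"]
  have mc: "dd h (mcf p k) v \<bullet> \<xi> v = dd k (mcf p h) v \<bullet> \<xi> v"
    "dd h (mcf p k) v \<bullet> \<eta> v = dd k (mcf p h) v \<bullet> \<eta> v"
    by (simp_all add: inner_diff_left)
  have "dd h (a k) v = dd h (mcf p k) v \<bullet> \<xi> v" for h k
    using dd_inner[OF smooth_on_differentiable[OF smooth_on_mcf[OF pq(1)] v] smooth_on_differentiable[OF s\<xi> v]]
    by (simp add: dd_xi_zero[OF v])
  then show "dd h (a k) v = dd k (a h) v" using mc by simp
  have "\<eta> u \<bullet> \<xi> u = 0" if "u \<in> V" for u
    using quat_frame.orth'[OF frame[OF that]] .
  then have "dd h \<eta> v \<bullet> \<xi> v + \<eta> v \<bullet> dd h \<xi> v = 0" for h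
    by (rule dd_inner_const[OF V v s\<eta> s\<xi>])
  then have perp: "\<xi> v \<bullet> dd h \<eta> v = 0" "\<eta> v \<bullet> dd h \<eta> v = 0" for h
    using unit_perp_dd(2)[OF v] dd_xi_zero[OF v] by (simp_all add: inner_commute)
  have "mcf p k v \<bullet> dd h \<eta> v = 0" for h k
    by (subst mcf_components(1)[OF v]) (simp add: inner_add_left perp)
  then have "dd h (s k) v = dd h (mcf p k) v \<bullet> \<eta> v" for h k
    using dd_inner[OF smooth_on_differentiable[OF smooth_on_mcf[OF pq(1)] v] smooth_on_differentiable[OF s\<eta> v]]
    by simp
  then show "dd h (s k) v = dd k (s h) v" using mc by simp
qed

end

section \<open>Integration of the structure equations\<close>

lemma quat_i_frame_snd:
  assumes "quat_frame quat_i y"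
  shows "y = (0, snd y)" "norm (snd y) = 1"
proof -
  interpret quat_frame quat_i y by fact
  have "fst y = 0"
    using Im(2) orth by (simp add: Im_quat_def quat_i_def inner_prod_def inner_complex_def complex_eq_iff)
  then show "y = (0, snd y)" by (simp add: prod_eq_iff)
  have "(norm y)\<^sup>2 = 1" using unit(2) by (simp add: power2_norm_eq_inner)
  then have "norm y = 1" using power2_eq_imp_eq[of "norm y" 1] by simp
  then show "norm (snd y) = 1" using \<open>fst y = 0\<close> by (simp add: norm_prod_def)
qed

lemma has_derivative_cis_comp:
  assumes "(f has_derivative f') (at x)"
  shows "((\<lambda>x. cis (f x)) has_derivative (\<lambda>h. (\<i> * f' h) * cis (f x))) (at x)"
proof -
  have "(cis has_vector_derivative \<i> * cis y) (at y)" for y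
    unfolding has_vector_derivative_def
    by (auto intro!: derivative_eq_intros simp: scaleR_conv_of_real)
  then have "(cis has_derivative (\<lambda>h. h *\<^sub>R (\<i> * cis (f x)))) (at (f x))"
    by (simp add: has_vector_derivative_def)
  from has_derivative_compose[OF assms this] show ?thesis
    by (simp add: scaleR_conv_of_real mult_ac)
qed

context smooth_frame
begin

text \<open>The products of q with exp(-iB) and of p with exp(-iA) remove the \<xi>-parts of the two
  forms. The first product becomes constant. The second moves only in the direction of s and hence
  is a curve in S.\<close>

lemma normal_form_i:
  assumes cvx: "convex V" and v0: "v0 \<in> V" and xi: "\<And>v. v \<in> V \<Longrightarrow> \<xi> v = quat_i"
  obtains V1 U f \<A> q0 where "open V1" "v0 \<in> V1" "V1 \<subseteq> V" "open U" "admissible_data f \<A>" "q0 \<in> unit_quat"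
    "(\<lambda>v. (p v, q v)) ` V1 = F_isom qone q0 qone ` (immersion2 \<A> ` U)"
proof -
  obtain A where A: "\<And>v. v \<in> V \<Longrightarrow> (A has_derivative (\<lambda>h. a h v)) (at v)"
    using poincare[OF V cvx v0 linear_abs(1) smooth_abs(1) closed_forms(1)] by blast
  obtain B where B: "\<And>v. v \<in> V \<Longrightarrow> (B has_derivative (\<lambda>h. b h v)) (at v)"
    using poincare[OF V cvx v0 linear_abs(2) smooth_abs(2) b_dd_xi(2)] by blast
  obtain S where S: "\<And>v. v \<in> V \<Longrightarrow> (S has_derivative (\<lambda>h. s h v)) (at v)"
    using poincare[OF V cvx v0 linear_abs(3) smooth_abs(3) closed_forms(2)] by blast
  have inj: "h = 0" if h: "a h v0 = 0" "b h v0 = 0" "s h v0 = 0" for h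
  proof -
    obtain ha hb hs where "\<forall>h. h = a h v0 *\<^sub>R ha + b h v0 *\<^sub>R hb + s h v0 *\<^sub>R hs"
      by (rule dual_basis[OF v0])
    from this[rule_format, of h] show ?thesis using h by simp
  qed
  have pd: "(p has_derivative (\<lambda>h. p v *\<^sub>H mcf p h v)) (at v)"
    and qd: "(q has_derivative (\<lambda>h. q v *\<^sub>H mcf q h v)) (at v)" if v: "v \<in> V" for v
    using smooth_on_has_derivative[OF unit_mapD(2)[OF pq(1)] v] smooth_on_has_derivative[OF unit_mapD(2)[OF pq(2)] v]
    by (simp_all add: dd_eq_mcf[OF pq(1) v] dd_eq_mcf[OF pq(2) v])
  have up: "p v \<in> unit_quat" "q v \<in> unit_quat" if "v \<in> V" for v
    using unit_mapD(3)[OF pq(1) that] unit_mapD(3)[OF pq(2) that] .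
  define E :: "real \<Rightarrow> quat" where "E = (\<lambda>x. (cis x, 0))"
  have EE: "E x *\<^sub>H E (- x) = qone" "E (- x) *\<^sub>H E x = qone" for x
    by (simp_all add: E_def qmult_def cis_mult qone_def)
  have iE: "quat_i *\<^sub>H E x = E x *\<^sub>H quat_i" for x
    by (simp add: E_def qmult_def quat_i_def mult.commute)
  have Eneg: "((\<lambda>v. E (- f v)) has_derivative (\<lambda>h. - (f' h *\<^sub>R (quat_i *\<^sub>H E (- f v))))) (at v)"
    if "(f has_derivative f') (at v)" for f :: "R3 \<Rightarrow> real" and f' v
  proof -
    have "((\<lambda>v. - f v) has_derivative (\<lambda>h. - f' h)) (at v)"
      by (intro has_derivative_minus that)
    from has_derivative_Pair[OF has_derivative_cis_comp[OF this] has_derivative_const[of "0::complex"]]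
    show ?thesis unfolding E_def
      by (rule has_derivative_eq_rhs) (auto simp: fun_eq_iff quat_i_def qmult_def scaleR_conv_of_real)
  qed
  define q1 where "q1 = (\<lambda>v. q v *\<^sub>H E (- B v))"
  have "(q1 has_derivative (\<lambda>h. 0)) (at v within V)" if v: "v \<in> V" for v
  proof -
    have "(q1 has_derivative (\<lambda>h. q v *\<^sub>H (- (b h v *\<^sub>R (quat_i *\<^sub>H E (- B v))))
        + (q v *\<^sub>H mcf q h v) *\<^sub>H E (- B v))) (at v)"
      unfolding q1_def by (rule qmult.FDERIV[OF qd[OF v] Eneg[OF B[OF v]]])
    moreover have "q v *\<^sub>H (- (b h v *\<^sub>R (quat_i *\<^sub>H E (- B v)))) + (q v *\<^sub>H mcf q h v) *\<^sub>H E (- B v) = 0" for h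
      by (subst (2) mcf_components(2)[OF v])
        (simp add: xi[OF v] qmult.minus_right qmult.scaleR_right qmult.scaleR_left qmult_assoc)
    ultimately show ?thesis by (simp add: has_derivative_at_withinI)
  qed
  then obtain q0 where q0: "\<And>v. v \<in> V \<Longrightarrow> q1 v = q0"
    using has_derivative_zero_constant[OF cvx, of q1] by blast
  have q: "q v = q0 *\<^sub>H E (B v)" if v: "v \<in> V" for v
    using q0[OF v, symmetric] by (simp add: q1_def qmult_assoc EE)
  have q0u: "q0 \<in> unit_quat" using q0[OF v0, symmetric] up(2)[OF v0] by (simp add: q1_def E_def)
  define y where "y = (\<lambda>v. snd (\<eta> v))"
  have \<eta>: "\<eta> v = (0, y v)" "norm (y v) = 1" if v: "v \<in> V" for v
    using quat_i_frame_snd frame[OF v] unfolding xi[OF v] y_def by blast+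
  define G where "G = (\<lambda>v. p v *\<^sub>H E (- A v))"
  \<comment> \<open>Conjugating \<eta> = y j by exp(iA) gives e^(2iA) y j, because j anticommutes
    with i. This is the direction in which \<open>G\<close> moves.\<close>
  define e where "e = (\<lambda>v. cis (2 * A v) * y v)"
  \<comment> \<open>Pairing \<open>G\<close> with \<open>e\<close> makes one curve in S of both, so
    that the direction field of G is differentiable in S as well.\<close>
  define H where "H = (\<lambda>v. (G v, e v))"
  have p: "p v = G v *\<^sub>H E (A v)" for v
    by (simp add: G_def qmult_assoc EE)
  have dG: "(G has_derivative (\<lambda>h. s h v *\<^sub>R (G v *\<^sub>H (0, e v)))) (at v)" if v: "v \<in> V" for v
  proof -
    have "(G has_derivative (\<lambda>h. p v *\<^sub>H (- (a h v *\<^sub>R (quat_i *\<^sub>H E (- A v))))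
        + (p v *\<^sub>H mcf p h v) *\<^sub>H E (- A v))) (at v)"
      unfolding G_def by (rule qmult.FDERIV[OF pd[OF v] Eneg[OF A[OF v]]])
    moreover have "p v *\<^sub>H (- (a h v *\<^sub>R (quat_i *\<^sub>H E (- A v)))) + (p v *\<^sub>H mcf p h v) *\<^sub>H E (- A v)
      = s h v *\<^sub>R (G v *\<^sub>H (0, e v))" for h
    proof -
      have "E (- A v) *\<^sub>H (0, e v) = \<eta> v *\<^sub>H E (- A v)"
        by (simp add: E_def e_def \<eta>(1)[OF v] qmult_def cis_cnj cis_mult mult.assoc[symmetric])
      then show ?thesis
        by (subst (2) mcf_components(1)[OF v])
          (simp add: xi[OF v] G_def qmult.add_right qmult.add_left qmult.minus_right qmult.scaleR_right qmult.scaleR_left qmult_assoc)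
    qed
    ultimately show ?thesis by simp
  qed
  have dy: "(y has_derivative (\<lambda>h. dd h y v)) (at v)" "dd h \<eta> v = (0, dd h y v)" if v: "v \<in> V" for v h
  proof -
    have "(y has_derivative (\<lambda>h. snd (dd h \<eta> v))) (at v)"
      unfolding y_def by (rule has_derivative_snd[OF smooth_on_has_derivative[OF s\<eta> v]])
    moreover from dd_eqI[OF this] have yv: "\<And>h. dd h y v = snd (dd h \<eta> v)" .
    ultimately show "(y has_derivative (\<lambda>h. dd h y v)) (at v)" by simp
    have "dd h \<eta> v = dd h (\<lambda>v. (0, y v)) v"
      by (rule dd_cong[OF V v]) (rule \<eta>(1))
    also have "\<dots> = (0, dd h y v)"
      by (rule dd_eqI) (intro has_derivative_Pair has_derivative_const \<open>(y has_derivative (\<lambda>h. dd h y v)) (at v)\<close>)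
    finally show "dd h \<eta> v = (0, dd h y v)" .
  qed
  have de: "(e has_derivative (\<lambda>h. cis (2 * A v) * dd h y v + (\<i> * (2 * a h v)) * cis (2 * A v) * y v)) (at v)"
    if v: "v \<in> V" for v
    unfolding e_def
    by (rule has_derivative_eq_rhs[OF has_derivative_mult[OF has_derivative_cis_comp[OF has_derivative_mult_right[OF A[OF v]]] dy(1)[OF v]]])
      simp
  have dH: "(H has_derivative (\<lambda>h. (s h v *\<^sub>R (G v *\<^sub>H (0, e v)),
      cis (2 * A v) * dd h y v + (\<i> * (2 * a h v)) * cis (2 * A v) * y v))) (at v)" if v: "v \<in> V" for v
    unfolding H_def by (rule has_derivative_Pair[OF dG[OF v] de[OF v]])
  \<comment> \<open>On the kernel of s the structure equations give d\<eta> = -2a \<zeta>, that is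
    dy = -2a i y. The rotation by 2A in \<open>e\<close> cancels exactly this.\<close>
  have H0: "dd h H v = 0" if v: "v \<in> V" and s0: "s h v = 0" for v h
  proof -
    interpret F: quat_frame "\<xi> v" "\<eta> v" by (rule frame[OF v])
    have z: "dd h \<eta> v \<bullet> \<zeta> v = - 2 * a h v"
      using unit_perp_dd(7)[OF v] zeta_equations(2)[OF v s0] by simp
    have x: "dd h \<eta> v \<bullet> \<xi> v = 0"
      unfolding dy(2)[OF v] xi[OF v] by (simp add: quat_i_def inner_prod_def)
    have "dd h \<eta> v = (- 2 * a h v) *\<^sub>R \<zeta> v"
      using F.Im_expand[OF unit_perp_dd(5)[OF v, of h]] unit_perp_dd(2)[OF v] x z by simp
    then have "dd h y v = (- 2 * a h v) *\<^sub>R (\<i> * y v)"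
      unfolding dy(2)[OF v] by (simp add: xi[OF v] \<eta>(1)[OF v] quat_i_def qmult_def prod_eq_iff)
    then show ?thesis
      using dd_eqI[OF dH[OF v], of h] s0 by (simp add: scaleR_conv_of_real algebra_simps zero_prod_def)
  qed
  obtain V1 c d where V1: "open V1" "v0 \<in> V1" "V1 \<subseteq> V" "d > 0"
    and op: "\<And>V2. open V2 \<Longrightarrow> V2 \<subseteq> V1 \<Longrightarrow> open ((\<lambda>v. (A v, B v, S v)) ` V2)"
    and c1: "\<And>v. v \<in> V1 \<Longrightarrow> \<bar>S v - S v0\<bar> < d \<and> H v = c (S v)"
    and c2: "\<And>t. \<bar>t - S v0\<bar> < d \<Longrightarrow> \<exists>v h. v \<in> V1 \<and> S v = t \<and> s h v = 1 \<and> (c has_vector_derivative dd h H v) (at t)"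
    by (rule local_coordinates[OF V v0 A B S smooth_on_continuous[OF smooth_abs(1)] smooth_on_continuous[OF smooth_abs(2)]
          smooth_on_continuous[OF smooth_abs(3)] inj differentiableI[OF dH] H0])
      (assumption | rule that)+
  have c3: "fst (c t) \<in> unit_quat \<and> norm (snd (c t)) = 1 \<and>
      ((\<lambda>t. fst (c t)) has_vector_derivative fst (c t) *\<^sub>H (0, snd (c t))) (at t) \<and>
      (\<lambda>t. snd (c t)) differentiable (at t)" if t: "\<bar>t - S v0\<bar> < d" for t
  proof -
    obtain v h where v: "v \<in> V1" "S v = t" "s h v = 1" "(c has_vector_derivative dd h H v) (at t)"
      using c2[OF t] by blast
    have vV: "v \<in> V" using v V1 by auto
    have ct: "c t = (G v, e v)" using c1[OF v(1)] v(2) by (simp add: H_def)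
    have "fst (dd h H v) = G v *\<^sub>H (0, e v)"
      using dd_eqI[OF dH[OF vV], of h] v(3) by simp
    then have "((\<lambda>t. fst (c t)) has_vector_derivative fst (c t) *\<^sub>H (0, snd (c t))) (at t)"
      using bounded_linear.has_vector_derivative[OF bounded_linear_fst v(4)] by (simp add: ct)
    moreover have "(\<lambda>t. snd (c t)) differentiable (at t)"
      using bounded_linear.has_vector_derivative[OF bounded_linear_snd v(4)] by (rule differentiableI_vector)
    moreover have "G v \<in> unit_quat" using up(1)[OF vV] by (simp add: G_def E_def)
    moreover have "norm (e v) = 1" using \<eta>(2)[OF vV] by (simp add: e_def norm_mult)
    ultimately show ?thesis by (simp add: ct)
  qed
  obtain f \<A> \<epsilon> where adm: "admissible_data f \<A>" and \<epsilon>: "0 < \<epsilon>"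
    and \<A>: "\<And>t. \<bar>t - S v0\<bar> < \<epsilon> \<Longrightarrow> \<A> (2 / sqrt 3 * t) = fst (c t)"
    by (rule horizontal_of_curve[OF V1(4), of "S v0" "\<lambda>t. fst (c t)" "\<lambda>t. snd (c t)"]) (use c3 in blast)+
  \<comment> \<open>Only for these values of S does the globally extended curve agree with
    \<open>G\<close>.\<close>
  define V2 where "V2 = V1 \<inter> S -` ball (S v0) \<epsilon>"
  have "continuous_on V1 S"
    using S V1(3) by (meson continuous_at_imp_continuous_on has_derivative_continuous subsetD)
  then have oV2: "open V2"
    unfolding V2_def by (rule continuous_open_preimage[OF _ V1(1) open_ball])
  \<comment> \<open>The coordinates A and B are the two angles in \<open>immersion2\<close>, and S
    is the rescaled time sqrt 3 / 2 * t; \<open>L'\<close> inverts this linear map.\<close>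
  define L :: "R3 \<Rightarrow> R3" where "L = (\<lambda>(u, v, t). (sqrt 3 / 2 * u - v / 2, sqrt 3 / 2 * u + v / 2, sqrt 3 / 2 * t))"
  define L' :: "R3 \<Rightarrow> R3" where "L' = (\<lambda>(x, y, t). ((x + y) / sqrt 3, y - x, 2 / sqrt 3 * t))"
  have LL': "L (L' z) = z" for z
  proof (cases z)
    case (fields x y t)
    have "sqrt 3 / 2 * ((x + y) / sqrt 3) = (x + y) / 2" "sqrt 3 / 2 * (2 / sqrt 3 * t) = t" by simp_all
    then show ?thesis unfolding fields L_def L'_def prod.case by (simp add: field_simps)
  qed
  define U where "U = L -` ((\<lambda>v. (A v, B v, S v)) ` V2)"
  have "continuous_on UNIV L"
    unfolding L_def case_prod_unfold by (intro continuous_intros) simp_all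
  then have "open U"
    unfolding U_def using op[OF oV2] by (intro open_vimage) (auto simp: V2_def)
  have key: "F_isom qone q0 qone (immersion2 \<A> z) = (p v, q v)" if z: "L z = (A v, B v, S v)" and v: "v \<in> V2" for z v
  proof -
    have vV: "v \<in> V1" "v \<in> V" "\<bar>S v - S v0\<bar> < \<epsilon>"
      using v V1(3) by (auto simp: V2_def dist_real_def)
    obtain x y t where zf: "z = (x, y, t)" by (metis prod_cases3)
    have c: "sqrt 3 / 2 * x - y / 2 = A v" "sqrt 3 / 2 * x + y / 2 = B v" "sqrt 3 / 2 * t = S v"
      using z unfolding zf L_def by simp_all
    have "t = 2 / sqrt 3 * S v" by (simp add: c(3)[symmetric])
    moreover have "c (S v) = (G v, e v)" using c1[OF vV(1)] by (simp add: H_def)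
    ultimately have At: "\<A> t = G v"
      using \<A>[OF vV(3)] by simp
    show ?thesis
      unfolding zf immersion2_def prod.case c At F_isom_def
      using p[of v] q[OF vV(2)] by (simp add: quat_of_complex_def E_def)
  qed
  have "(\<lambda>v. (p v, q v)) ` V2 = F_isom qone q0 qone ` (immersion2 \<A> ` U)"
  proof (intro equalityI subsetI)
    fix w assume "w \<in> (\<lambda>v. (p v, q v)) ` V2"
    then obtain v where v: "v \<in> V2" "w = (p v, q v)" by blast
    have "L' (A v, B v, S v) \<in> U" using v(1) by (simp add: U_def LL')
    then show "w \<in> F_isom qone q0 qone ` (immersion2 \<A> ` U)"
      unfolding v(2) key[OF LL' v(1), symmetric] by blast
  next
    fix w assume "w \<in> F_isom qone q0 qone ` (immersion2 \<A> ` U)"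
    then obtain z where z: "z \<in> U" "w = F_isom qone q0 qone (immersion2 \<A> z)" by blast
    then obtain v where "v \<in> V2" "L z = (A v, B v, S v)" unfolding U_def by blast
    then show "w \<in> (\<lambda>v. (p v, q v)) ` V2" unfolding z(2) using key by auto
  qed
  moreover have "v0 \<in> V2" "V2 \<subseteq> V" using V1 \<epsilon> by (auto simp: V2_def)
  ultimately show ?thesis
    using that[OF oV2 _ _ \<open>open U\<close> adm q0u] by blast
qed

end

subsection \<open>The three normal forms\<close>

text \<open>This is the part of \<open>locally_congruent_at\<close> that concerns the parametrized
  map alone. Openness in the submanifold and the embedding condition are supplied in the
  theorem.\<close>

definition congruent_near :: "(R3 \<Rightarrow> quat \<times> quat) \<Rightarrow> (R3 \<Rightarrow> quat) \<Rightarrow> (R3 \<Rightarrow> quat) \<Rightarrow> R3 set \<Rightarrow> R3 \<Rightarrow> bool" where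
  "congruent_near \<phi> p q V v0 \<longleftrightarrow> (\<exists>V1 U a b c. open V1 \<and> v0 \<in> V1 \<and> V1 \<subseteq> V \<and> open U \<and>
     a \<in> unit_quat \<and> b \<in> unit_quat \<and> c \<in> unit_quat \<and>
     (\<lambda>v. (p v, q v)) ` V1 = F_isom a b c ` (\<phi> ` U))"

text \<open>As x and i both have square -1, the sum x + i satisfies x (x + i) = (x + i) i, and
  normalizing it gives \<open>g\<close>. The sum vanishes only for x = -i, where j does the
  same.\<close>

lemma rotate_to_quat_i:
  assumes "x \<in> Im_quat" "norm x = 1"
  obtains g where "g \<in> unit_quat" "qcnj g *\<^sub>H x *\<^sub>H g = quat_i"
proof -
  have ii: "quat_i *\<^sub>H quat_i = - qone" "x *\<^sub>H x = - qone"
    using assms Im_quat_square[OF assms(1)]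
    by (simp_all add: quat_units qone_def power2_norm_eq_inner[symmetric])
  obtain g where g: "g \<in> unit_quat" "x *\<^sub>H g = g *\<^sub>H quat_i"
  proof (cases "x + quat_i = 0")
    case True
    then have "x = - quat_i" by (simp add: eq_neg_iff_add_eq_0)
    moreover have "quat_j \<in> unit_quat" by (simp add: quat_j_def unit_quat_def norm_prod_def)
    ultimately show ?thesis
      using that[of quat_j] by (simp add: qmult.minus_left quat_units)
  next
    case False
    let ?g = "(1 / norm (x + quat_i)) *\<^sub>R (x + quat_i)"
    have "?g \<in> unit_quat" using False by (simp add: unit_quat_def)
    moreover have "x *\<^sub>H ?g = ?g *\<^sub>H quat_i"
      by (simp add: qmult.scaleR_right qmult.scaleR_left qmult.add_right qmult.add_left ii add.commute)
    ultimately show ?thesis using that by blast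
  qed
  then show ?thesis using that[OF g(1)] by (simp add: qmult_assoc)
qed

lemma normal_form2:
  assumes pq: "unit_map V p" "unit_map V q" and v0: "v0 \<in> V"
    and all: "\<And>u. u \<in> V \<Longrightarrow> \<exists>\<xi> \<eta>. adapted p q u \<xi> \<eta> 1 0"
  obtains f A where "admissible_data f A" "congruent_near (immersion2 A) p q V v0"
proof -
  obtain r \<xi> \<eta> where r: "0 < r" "ball v0 r \<subseteq> V" and sm: "smooth_on (ball v0 r) \<xi>" "smooth_on (ball v0 r) \<eta>"
    and ad: "\<And>v. v \<in> ball v0 r \<Longrightarrow> adapted p q v (\<xi> v) (\<eta> v) 1 0"
    by (rule adapted_smooth_frame[OF pq v0 all]) (assumption | rule that)+
  let ?B = "ball v0 r"
  note pqB = unit_map_subset[OF pq(1) open_ball r(2)] unit_map_subset[OF pq(2) open_ball r(2)]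
  interpret F: smooth_frame ?B p q \<xi> \<eta>
    by unfold_locales (use pqB sm ad in auto)
  have "(\<xi> has_derivative (\<lambda>h. 0)) (at v within ?B)" if "v \<in> ?B" for v
    using smooth_on_has_derivative[OF sm(1) that] F.dd_xi_zero[OF that]
    by (simp add: has_derivative_at_withinI)
  then obtain x where x: "\<And>v. v \<in> ?B \<Longrightarrow> \<xi> v = x"
    using has_derivative_zero_constant[OF convex_ball, of v0 r \<xi>] by blast
  have v0B: "v0 \<in> ?B" using r by simp
  have "x \<in> Im_quat" "norm x = 1"
    using F.frame[OF v0B] unfolding x[OF v0B]
    by (auto simp: quat_frame_def norm_eq_sqrt_inner)
  then obtain g where g: "g \<in> unit_quat" "qcnj g *\<^sub>H x *\<^sub>H g = quat_i"
    by (rule rotate_to_quat_i)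
  \<comment> \<open>Right multiplication of both factors by the same \<open>g\<close> conjugates
    both forms at once, so it turns the constant \<xi> into i and keeps the frame adapted. It is
    undone by the third parameter of \<open>F_isom\<close>.\<close>
  let ?p = "\<lambda>v. p v *\<^sub>H g" and ?q = "\<lambda>v. q v *\<^sub>H g" and ?\<eta> = "\<lambda>v. qcnj g *\<^sub>H \<eta> v *\<^sub>H g"
  interpret G: smooth_frame ?B ?p ?q "\<lambda>v. quat_i" ?\<eta>
  proof
    show "unit_map ?B ?p" "unit_map ?B ?q" using pqB g(1) by (auto intro: unit_map_mult_const)
    show "smooth_on ?B (\<lambda>v. quat_i)" by simp
    show "smooth_on ?B ?\<eta>"
      by (intro smooth_on_qmult smooth_on_const sm open_ball)
    fix v assume v: "v \<in> ?B"
    obtain ha hb hs where b: "adapted_basis p q v x (\<eta> v) 1 0 ha hb hs" and f: "quat_frame x (\<eta> v)"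
      using ad[OF v] unfolding adapted_def x[OF v] by blast
    have "quat_frame (qcnj g *\<^sub>H x *\<^sub>H qcnj (qcnj g)) (qcnj g *\<^sub>H \<eta> v *\<^sub>H qcnj (qcnj g))"
      by (rule quat_frame.quat_frame_conj[OF f]) (use g in simp)
    then have "quat_frame quat_i (?\<eta> v)" by (simp add: g)
    moreover have "adapted_basis ?p ?q v quat_i (?\<eta> v) 1 0 ha hb hs"
      using b unfolding adapted_basis_def mcf_conj[OF pqB(1) g(1) v] mcf_conj[OF pqB(2) g(1) v]
      by (simp add: g(2) qmult.zero_left qmult.zero_right)
    ultimately show "adapted ?p ?q v quat_i (?\<eta> v) 1 0"
      unfolding adapted_def by (metis zero_neq_one)
  qed
  obtain V1 U f A q0 where V1: "open V1" "v0 \<in> V1" "V1 \<subseteq> ?B" "open U" "admissible_data f A" "q0 \<in> unit_quat"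
    and eq: "(\<lambda>v. (?p v, ?q v)) ` V1 = F_isom qone q0 qone ` (immersion2 A ` U)"
    by (rule G.normal_form_i[OF convex_ball v0B refl])
  have "(\<lambda>v. (p v, q v)) ` V1 = F_isom qone q0 g ` (immersion2 A ` U)"
  proof -
    have "(\<lambda>v. (p v, q v)) ` V1 = (\<lambda>z. (fst z *\<^sub>H qcnj g, snd z *\<^sub>H qcnj g)) ` (\<lambda>v. (?p v, ?q v)) ` V1"
      using g(1) by (simp add: image_image qmult_assoc)
    also have "\<dots> = F_isom qone q0 g ` (immersion2 A ` U)"
      unfolding eq by (simp add: image_image F_isom_def)
    finally show ?thesis .
  qed
  then have "congruent_near (immersion2 A) p q V v0"
    unfolding congruent_near_def using V1 g(1) r(2)
    by (intro exI[of _ V1] exI[of _ U] exI[of _ qone] exI[of _ q0] exI[of _ g]) auto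
  then show ?thesis using that V1(5) by blast
qed

text \<open>Transport along a map \<Psi> that carries one model to another, up to an isometry and a
  change \<open>R\<close> of parameters. As \<open>R\<close> is a continuous involution, the image
  of an open set is its preimage and hence open.\<close>

lemma congruent_nearI:
  assumes "congruent_near \<phi> p q V v0"
    and "\<And>a b c. a \<in> unit_quat \<Longrightarrow> b \<in> unit_quat \<Longrightarrow> c \<in> unit_quat \<Longrightarrow>
      \<exists>a' b' c'. a' \<in> unit_quat \<and> b' \<in> unit_quat \<and> c' \<in> unit_quat \<and>
        (\<forall>z. \<Psi> (F_isom a b c (\<phi> z)) = F_isom a' b' c' (\<phi>' (R z)))"
    and "\<And>v. v \<in> V \<Longrightarrow> \<Psi> (p v, q v) = (p' v, q' v)"
    and "continuous_on UNIV R" "\<And>z. R (R z) = z"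
  shows "congruent_near \<phi>' p' q' V v0"
proof -
  obtain V1 U a b c where V1: "open V1" "v0 \<in> V1" "V1 \<subseteq> V" "open U"
    "a \<in> unit_quat" "b \<in> unit_quat" "c \<in> unit_quat"
    and eq: "(\<lambda>v. (p v, q v)) ` V1 = F_isom a b c ` (\<phi> ` U)"
    using assms(1) unfolding congruent_near_def by blast
  obtain a' b' c' where abc: "a' \<in> unit_quat" "b' \<in> unit_quat" "c' \<in> unit_quat"
    "\<And>z. \<Psi> (F_isom a b c (\<phi> z)) = F_isom a' b' c' (\<phi>' (R z))"
    using assms(2)[OF V1(5-7)] by blast
  have "(\<lambda>v. (p' v, q' v)) ` V1 = \<Psi> ` (\<lambda>v. (p v, q v)) ` V1"
    unfolding image_image using assms(3) V1(3) by (intro image_cong) auto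
  also have "\<dots> = F_isom a' b' c' ` (\<phi>' ` (R ` U))"
    unfolding eq by (simp add: image_image abc(4))
  finally have "(\<lambda>v. (p' v, q' v)) ` V1 = F_isom a' b' c' ` (\<phi>' ` (R ` U))" .
  moreover have "R ` U = R -` U"
  proof (intro equalityI subsetI)
    fix x assume "x \<in> R -` U"
    then show "x \<in> R ` U" by (intro image_eqI[of _ _ "R x"]) (simp_all add: assms(5))
  qed (use assms(5) in force)
  then have "open (R ` U)" using open_vimage[OF V1(4) assms(4)] by simp
  ultimately show ?thesis unfolding congruent_near_def using V1(1-3) abc(1-3) by blast
qed

lemma normal_form1:
  assumes pq: "unit_map V p" "unit_map V q" and v0: "v0 \<in> V"
    and all: "\<And>u. u \<in> V \<Longrightarrow> \<exists>\<xi> \<eta>. adapted p q u \<xi> \<eta> 0 1"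
  obtains f A where "admissible_data f A" "congruent_near (immersion1 A) p q V v0"
proof -
  have "\<exists>\<xi> \<eta>. adapted q p u \<xi> \<eta> 1 0" if u: "u \<in> V" for u
  proof -
    obtain \<xi> \<eta> ha hb hs where f: "quat_frame \<xi> \<eta>" and b: "adapted_basis p q u \<xi> \<eta> 0 1 ha hb hs"
      using all[OF u] unfolding adapted_def by blast
    have "\<exists>x y z. h = x *\<^sub>R hb + y *\<^sub>R ha + z *\<^sub>R hs" for h
    proof -
      obtain x y z where "h = x *\<^sub>R ha + y *\<^sub>R hb + z *\<^sub>R hs"
        using b unfolding adapted_basis_def by blast
      then have "h = y *\<^sub>R hb + x *\<^sub>R ha + z *\<^sub>R hs" by (simp only: add.commute)
      then show ?thesis by blast
    qed
    then have "adapted_basis q p u \<xi> \<eta> 1 0 hb ha hs"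
      using b unfolding adapted_basis_def by blast
    then show ?thesis using f unfolding adapted_def by (metis zero_neq_one)
  qed
  then obtain f A where A: "admissible_data f A" "congruent_near (immersion2 A) q p V v0"
    by (rule normal_form2[OF pq(2,1) v0])
  have "congruent_near (immersion1 A) p q V v0"
  proof (rule congruent_nearI[OF A(2), where \<Psi> = prod.swap and R = "\<lambda>z. z"])
    fix a b c :: quat assume u: "a \<in> unit_quat" "b \<in> unit_quat" "c \<in> unit_quat"
    have "\<forall>z. prod.swap (F_isom a b c (immersion2 A z)) = F_isom b a c (immersion1 A z)"
      by (auto simp: F_isom_def immersion1_def immersion2_def)
    with u show "\<exists>a' b' c'. a' \<in> unit_quat \<and> b' \<in> unit_quat \<and> c' \<in> unit_quat \<and>
        (\<forall>z. prod.swap (F_isom a b c (immersion2 A z)) = F_isom a' b' c' (immersion1 A z))"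
      by blast
  qed auto
  then show ?thesis using that A(1) by blast
qed

text \<open>For P = p^-1 and Q = q p^-1 the forms are, up to conjugation by p, the negative of the
  form of p and the difference of the forms of q and p. Hence w = (1,1) becomes (-1,0), and the
  adapted frame is conjugated by p.\<close>

lemma normal_form3:
  assumes pq: "unit_map V p" "unit_map V q" and v0: "v0 \<in> V"
    and all: "\<And>u. u \<in> V \<Longrightarrow> \<exists>\<xi> \<eta>. adapted p q u \<xi> \<eta> 1 1"
  obtains f A where "admissible_data f A" "congruent_near (immersion3 A) p q V v0"
proof -
  define P where "P = (\<lambda>v. qcnj (p v))"
  define Q where "Q = (\<lambda>v. q v *\<^sub>H P v)"
  have sP: "smooth_on V P" and sQ: "smooth_on V Q"
    unfolding Q_def P_def using unit_mapD[OF pq(1)] unit_mapD[OF pq(2)]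
    by (auto intro!: smooth_on_qmult smooth_on_qcnj)
  have PQ: "unit_map V P" "unit_map V Q"
    using sP sQ unit_mapD[OF pq(1)] unit_mapD[OF pq(2)] by (auto simp: unit_map_def P_def Q_def)
  have mP: "mcf P h v = p v *\<^sub>H (- mcf p h v) *\<^sub>H qcnj (p v)"
    and mQ: "mcf Q h v = p v *\<^sub>H (mcf q h v - mcf p h v) *\<^sub>H qcnj (p v)" if v: "v \<in> V" for h v
  proof -
    note u = unit_mapD(3)[OF pq(1) v] unit_mapD(3)[OF pq(2) v]
    have dP: "dd h P v = - (mcf p h v *\<^sub>H qcnj (p v))"
      unfolding P_def dd_linear[OF bounded_linear_qcnj smooth_on_differentiable[OF unit_mapD(2)[OF pq(1)] v]]
      by (simp add: dd_eq_mcf[OF pq(1) v] qcnj_qmult mcf_Im[OF pq(1) v] qmult.minus_left)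
    show "mcf P h v = p v *\<^sub>H (- mcf p h v) *\<^sub>H qcnj (p v)"
      unfolding mcf_def[of P] dP by (simp add: P_def qmult.minus_right qmult.minus_left qmult_assoc)
    have "dd h Q v = q v *\<^sub>H dd h P v + dd h q v *\<^sub>H P v"
      unfolding Q_def
      by (rule dd_qmult[OF smooth_on_differentiable[OF unit_mapD(2)[OF pq(2)] v] smooth_on_differentiable[OF sP v]])
    then show "mcf Q h v = p v *\<^sub>H (mcf q h v - mcf p h v) *\<^sub>H qcnj (p v)"
      unfolding mcf_def[of Q] dP using u
      by (simp add: Q_def P_def dd_eq_mcf[OF pq(2) v] qcnj_qmult qmult.minus_right qmult.minus_left qmult_assoc
          qmult.add_right qmult.diff_left qmult.diff_right)
  qed
  have "\<exists>\<xi> \<eta>. adapted P Q u \<xi> \<eta> 1 0" if u: "u \<in> V" for u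
  proof -
    obtain \<xi> \<eta> ha hb hs where f: "quat_frame \<xi> \<eta>" and b: "adapted_basis p q u \<xi> \<eta> 1 1 ha hb hs"
      using all[OF u] unfolding adapted_def by blast
    let ?\<xi> = "p u *\<^sub>H \<xi> *\<^sub>H qcnj (p u)" and ?\<eta> = "p u *\<^sub>H \<eta> *\<^sub>H qcnj (p u)"
    \<comment> \<open>On these three vectors the new pair of forms takes the values (\<xi>, 0), (0,
      \<xi>) and (\<eta>, 0), up to conjugation.\<close>
    have "\<exists>x y z. h = x *\<^sub>R (- ha - hb) + y *\<^sub>R hb + z *\<^sub>R (- hs)" for h
    proof -
      obtain x y z where "h = x *\<^sub>R ha + y *\<^sub>R hb + z *\<^sub>R hs"
        using b unfolding adapted_basis_def by blast
      then have "h = (- x) *\<^sub>R (- ha - hb) + (y - x) *\<^sub>R hb + (- z) *\<^sub>R (- hs)"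
        by (simp add: algebra_simps)
      then show ?thesis by blast
    qed
    moreover note lm = linear_mcf[OF pq(1) u] linear_mcf[OF pq(2) u]
    have l: "mcf p (- ha - hb) u = - mcf p ha u - mcf p hb u" "mcf q (- ha - hb) u = - mcf q ha u - mcf q hb u"
      "mcf p (- hs) u = - mcf p hs u" "mcf q (- hs) u = - mcf q hs u"
      by (simp_all add: linear_diff[OF lm(1)] linear_diff[OF lm(2)] linear_neg[OF lm(1)] linear_neg[OF lm(2)])
    ultimately have "adapted_basis P Q u ?\<xi> ?\<eta> 1 0 (- ha - hb) hb (- hs)"
      using b unfolding adapted_basis_def mP[OF u] mQ[OF u] l
      by (simp add: qmult.zero_left qmult.zero_right)
    moreover have "quat_frame ?\<xi> ?\<eta>"
      by (rule quat_frame.quat_frame_conj[OF f unit_mapD(3)[OF pq(1) u]])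
    ultimately show ?thesis unfolding adapted_def by (metis zero_neq_one)
  qed
  then obtain f A where A: "admissible_data f A" "congruent_near (immersion2 A) P Q V v0"
    by (rule normal_form2[OF PQ v0])
  \<comment> \<open>With \<alpha> and \<beta> the angles of \<open>immersion2\<close> at z, the map
    \<Psi> produces cis(-\<alpha>) and cis(\<beta> - \<alpha>). Solving for the parameters of
    \<open>immersion3\<close> gives \<open>R\<close>, a reflection of the (u, v)-plane.\<close>
  define R :: "R3 \<Rightarrow> R3" where "R = (\<lambda>(u, v, t). (- u / 2 - sqrt 3 / 2 * v, v / 2 - sqrt 3 / 2 * u, t))"
  define \<Psi> :: "quat \<times> quat \<Rightarrow> quat \<times> quat" where "\<Psi> = (\<lambda>z. (qcnj (fst z), snd z *\<^sub>H qcnj (fst z)))"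
  have "congruent_near (immersion3 A) p q V v0"
  proof (rule congruent_nearI[OF A(2), where \<Psi> = \<Psi> and R = R])
    fix a b c :: quat assume u: "a \<in> unit_quat" "b \<in> unit_quat" "c \<in> unit_quat"
    have "\<Psi> (F_isom a b c (immersion2 A z)) = F_isom c b a (immersion3 A (R z))" for z
    proof (cases z)
      case (fields x y t)
      define \<alpha> where "\<alpha> = sqrt 3 / 2 * x - y / 2"
      define \<beta> where "\<beta> = sqrt 3 / 2 * x + y / 2"
      have s3: "sqrt 3 * (sqrt 3 * y) = 3 * y" by (simp add: mult.assoc[symmetric])
      have 1: "y / 2 - sqrt 3 / 2 * x = - \<alpha>" by (simp add: \<alpha>_def)
      have 2: "sqrt 3 / 2 * (- x / 2 - sqrt 3 / 2 * y) - - \<alpha> / 2 = \<alpha> - \<beta>"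
        by (simp add: \<alpha>_def \<beta>_def field_simps s3)
      have i2: "immersion2 A z = (A t *\<^sub>H quat_of_complex (cis \<alpha>), quat_of_complex (cis \<beta>))"
        by (simp add: fields immersion2_def \<alpha>_def \<beta>_def)
      have i3: "immersion3 A (R z) = (quat_of_complex (cis (- \<alpha>)) *\<^sub>H qcnj (A t),
          quat_of_complex (cnj (cis (\<alpha> - \<beta>))) *\<^sub>H qcnj (A t))"
        unfolding fields immersion3_def R_def prod.case 1 2 ..
      have e: "qcnj (quat_of_complex (cis \<alpha>)) = quat_of_complex (cis (- \<alpha>))"
        "quat_of_complex (cis \<beta>) *\<^sub>H quat_of_complex (cis (- \<alpha>)) = quat_of_complex (cnj (cis (\<alpha> - \<beta>)))"
        by (simp_all add: quat_of_complex_def qcnj_def qmult_def cis_cnj cis_mult)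
      show ?thesis
        unfolding i2 i3 \<Psi>_def F_isom_def e(2)[symmetric]
        using u by (simp add: qcnj_qmult qmult_assoc e(1))
    qed
    with u show "\<exists>a' b' c'. a' \<in> unit_quat \<and> b' \<in> unit_quat \<and> c' \<in> unit_quat \<and>
        (\<forall>z. \<Psi> (F_isom a b c (immersion2 A z)) = F_isom a' b' c' (immersion3 A (R z)))"
      by blast
  next
    show "\<Psi> (P v, Q v) = (p v, q v)" if "v \<in> V" for v
      using unit_mapD(3)[OF pq(1) that] by (simp add: \<Psi>_def P_def Q_def qmult_assoc)
    show "continuous_on UNIV R"
      unfolding R_def case_prod_unfold by (intro continuous_intros) simp_all
    show "R (R z) = z" for z
    proof (cases z)
      case (fields x y t)
      have "sqrt 3 * (sqrt 3 * y) = 3 * y" "sqrt 3 * (sqrt 3 * x) = 3 * x" by (simp_all add: mult.assoc[symmetric])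
      then show ?thesis by (simp add: fields R_def field_simps)
    qed
  qed
  then show ?thesis using that A(1) by blast
qed

lemma normal_form:
  assumes pq: "unit_map V p" "unit_map V q" and v0: "v0 \<in> V" and V: "connected V"
    and all: "\<And>u. u \<in> V \<Longrightarrow> \<exists>\<xi> \<eta> w1 w2. adapted p q u \<xi> \<eta> w1 w2"
  shows "\<exists>f A. admissible_data f A \<and> (\<exists>\<phi>\<in>{immersion1 A, immersion2 A, immersion3 A}. congruent_near \<phi> p q V v0)"
proof (rule adapted_types[OF pq V all])
  assume "\<And>u. u \<in> V \<Longrightarrow> \<exists>\<xi> \<eta>. adapted p q u \<xi> \<eta> 0 1"
  then obtain f A where "admissible_data f A" "congruent_near (immersion1 A) p q V v0"
    by (rule normal_form1[OF pq v0])
  then show ?thesis by (intro exI[of _ f] exI[of _ A]) simp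
next
  assume "\<And>u. u \<in> V \<Longrightarrow> \<exists>\<xi> \<eta>. adapted p q u \<xi> \<eta> 1 0"
  then obtain f A where "admissible_data f A" "congruent_near (immersion2 A) p q V v0"
    by (rule normal_form2[OF pq v0])
  then show ?thesis by (intro exI[of _ f] exI[of _ A]) simp
next
  assume "\<And>u. u \<in> V \<Longrightarrow> \<exists>\<xi> \<eta>. adapted p q u \<xi> \<eta> 1 1"
  then obtain f A where "admissible_data f A" "congruent_near (immersion3 A) p q V v0"
    by (rule normal_form3[OF pq v0])
  then show ?thesis by (intro exI[of _ f] exI[of _ A]) simp
qed

subsection \<open>Tangent spaces\<close>

text \<open>Let \<open>g\<close> be a linear left inverse of the differential at \<open>v\<close>.
  Then g \<circ> F has the identity as derivative there and a local inverse m, and K = m \<circ> g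
  is defined on an open set of the ambient space. It serves both the chain rule for tangent spaces
  and the embedding condition.\<close>

lemma immersion_local_left_inverse:
  fixes F :: "R3 \<Rightarrow> 'b::euclidean_space"
  assumes "open V" "smooth_on V F" "v \<in> V" "inj (\<lambda>h. dd h F v)"
  obtains U G K where "open U" "v \<in> U" "U \<subseteq> V" "open G" "F ` U \<subseteq> G"
    "\<And>y. y \<in> G \<Longrightarrow> K differentiable (at y)" "\<And>z. z \<in> U \<Longrightarrow> K (F z) = z"
proof -
  have lin: "linear (\<lambda>h. dd h F v)" by (rule linear_dd[OF smooth_on_differentiable[OF assms(2,3)]])
  obtain g where g: "linear g" "g \<circ> (\<lambda>h. dd h F v) = id"
    using linear_injective_left_inverse[OF lin assms(4)] by blast
  have bg: "bounded_linear g" using g(1) by (simp add: linear_conv_bounded_linear)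
  define k where "k = (\<lambda>v. g (F v))"
  define k' where "k' = (\<lambda>v. Blinfun (\<lambda>h. g (dd h F v)))"
  have dk: "(k has_derivative (\<lambda>h. g (dd h F v))) (at v)" if "v \<in> V" for v
    unfolding k_def by (rule bounded_linear.has_derivative[OF bg smooth_on_has_derivative[OF assms(2) that]])
  have k': "blinfun_apply (k' v) = (\<lambda>h. g (dd h F v))" if "v \<in> V" for v
    unfolding k'_def using bounded_linear_Blinfun_apply[OF has_derivative_bounded_linear[OF dk[OF that]]] .
  have ck: "continuous_on V k'"
  proof (rule continuous_on_blinfun_componentwise)
    fix i
    have "continuous_on V (\<lambda>v. g (dd i F v))"
      by (rule bounded_linear.continuous_on[OF bg smooth_on_continuous[OF smooth_on_dd[OF assms(2)]]])
    then show "continuous_on V (\<lambda>v. blinfun_apply (k' v) i)"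
      by (rule continuous_on_eq) (simp add: k')
  qed
  have dk': "(k has_derivative blinfun_apply (k' v)) (at v)" if "v \<in> V" for v
    using dk[OF that] by (simp add: k'[OF that])
  have inv: "id_blinfun o\<^sub>L k' v = id_blinfun"
    using pointfree_idE[OF g(2)] by (intro blinfun_eqI) (simp add: k'[OF assms(3)])
  obtain U W m m' where U: "open U" "U \<subseteq> V" "v \<in> U" "open W"
    and hom: "homeomorphism U W k m" and dm: "\<And>y. y \<in> W \<Longrightarrow> (m has_derivative (m' y)) (at y)"
    by (rule inverse_function_theorem[OF assms(1) dk' ck assms(3) inv]) (assumption | rule that)+
  show ?thesis
  proof (rule that[of U "g -` W" "m \<circ> g"])
    show "open (g -` W)"
      by (rule open_vimage[OF U(4) linear_continuous_on[OF bg]])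
    show "F ` U \<subseteq> g -` W" "\<And>z. z \<in> U \<Longrightarrow> (m \<circ> g) (F z) = z"
      using hom by (auto simp: homeomorphism_def k_def)
    show "(m \<circ> g) differentiable (at y)" if "y \<in> g -` W" for y
      unfolding o_def
      by (rule differentiableI[OF has_derivative_compose[OF bounded_linear_imp_has_derivative[OF bg] dm]]) (use that in simp)
  qed (use U in auto)
qed

lemma local_paramD:
  assumes "local_param M \<iota> V \<psi>"
  shows "open V" "openin M (\<psi> ` V)" "homeomorphic_map (top_of_set V) (subtopology M (\<psi> ` V)) \<psi>"
    "smooth_on V (\<iota> \<circ> \<psi>)" "\<And>v. v \<in> V \<Longrightarrow> inj (\<lambda>h. dd h (\<iota> \<circ> \<psi>) v)"
    "\<And>v. v \<in> V \<Longrightarrow> \<psi> v \<in> topspace M" "inj_on \<psi> V"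
  using assms openin_subset[of M "\<psi> ` V"] homeomorphic_imp_injective_map[of "top_of_set V" _ \<psi>]
  by (auto simp: local_param_def)

lemma local_param_openin:
  assumes "local_param M \<iota> V \<psi>" "open U" "U \<subseteq> V"
  shows "openin M (\<psi> ` U)"
proof -
  have "openin (top_of_set V) U" using assms(2,3) by (simp add: open_subset)
  then have "openin (subtopology M (\<psi> ` V)) (\<psi> ` U)"
    using homeomorphic_imp_open_map[OF local_paramD(3)[OF assms(1)]] by (simp add: open_map_def)
  then show ?thesis
    using local_paramD(2)[OF assms(1)] by (meson openin_trans_full)
qed

lemma local_param_preimage:
  assumes "local_param M \<iota> V \<psi>" "openin M W"
  shows "open {v \<in> V. \<psi> v \<in> W}"
proof -
  have "continuous_map (top_of_set V) M \<psi>"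
    using homeomorphic_imp_continuous_map[OF local_paramD(3)[OF assms(1)]] continuous_map_into_fulltopology by blast
  from openin_continuous_map_preimage[OF this assms(2)]
  have "openin (top_of_set V) {v \<in> V. \<psi> v \<in> W}" by simp
  then show ?thesis using local_paramD(1)[OF assms(1)] by (simp add: openin_open_eq)
qed

text \<open>Near \<open>v'\<close> the second parametrized map equals F \<circ> K \<circ> F', so its
  differential factors through that of \<open>F\<close>.\<close>

lemma range_dd_param_subset:
  assumes 1: "local_param M \<iota> V \<psi>" and 2: "local_param M \<iota> V' \<psi>'"
    and v: "v \<in> V" "v' \<in> V'" "\<psi>' v' = \<psi> v"
  shows "range (\<lambda>h. dd h (\<iota> \<circ> \<psi>') v') \<subseteq> range (\<lambda>h. dd h (\<iota> \<circ> \<psi>) v)"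
proof -
  let ?F = "\<iota> \<circ> \<psi>" and ?F' = "\<iota> \<circ> \<psi>'"
  obtain U G K where U: "open U" "v \<in> U" "U \<subseteq> V" "open G" "?F ` U \<subseteq> G"
    and K: "\<And>y. y \<in> G \<Longrightarrow> K differentiable (at y)" "\<And>z. z \<in> U \<Longrightarrow> K (?F z) = z"
    by (rule immersion_local_left_inverse[OF local_paramD(1,4)[OF 1] v(1) local_paramD(5)[OF 1 v(1)]])
      (assumption | rule that)+
  \<comment> \<open>The overlap is formed in \<open>M\<close>, where chart images are open.
    Comparing images under \<iota> would fail, as \<iota> may identify distant points.\<close>
  let ?O = "{w \<in> V'. \<psi>' w \<in> \<psi> ` U}"
  have O: "open ?O" "v' \<in> ?O"
    using local_param_preimage[OF 2 local_param_openin[OF 1 U(1,3)]] v U(2) by auto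
  have eq: "?F' w = ?F (K (?F' w))" if w: "w \<in> ?O" for w
  proof -
    obtain z where "z \<in> U" "\<psi>' w = \<psi> z" using w by blast
    then show ?thesis using K(2) by simp
  qed
  have y: "?F' v' = ?F v" "K (?F' v') = v" "?F' v' \<in> G"
    using v(3) K(2)[OF U(2)] U(2,5) by auto
  have dF': "(?F' has_derivative (\<lambda>h. dd h ?F' v')) (at v')"
    by (rule smooth_on_has_derivative[OF local_paramD(4)[OF 2] v(2)])
  have dK: "(K has_derivative (\<lambda>h. dd h K (?F' v'))) (at (?F' v'))"
    by (rule frechet_derivative_worksI[OF K(1)[OF y(3)]])
  have dF: "(?F has_derivative (\<lambda>h. dd h ?F v)) (at (K (?F' v')))"
    unfolding y(2) by (rule smooth_on_has_derivative[OF local_paramD(4)[OF 1] v(1)])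
  have "((\<lambda>w. ?F (K (?F' w))) has_derivative (\<lambda>h. dd (dd (dd h ?F' v') K (?F' v')) ?F v)) (at v')"
    by (rule has_derivative_compose[OF has_derivative_compose[OF dF' dK] dF])
  then have "(?F' has_derivative (\<lambda>h. dd (dd (dd h ?F' v') K (?F' v')) ?F v)) (at v')"
    by (rule has_derivative_transform_within_open[OF _ O]) (use eq in simp)
  then have "dd h ?F' v' = dd (dd (dd h ?F' v') K (?F' v')) ?F v" for h
    by (rule dd_eqI)
  then show ?thesis by blast
qed

lemma tangent_space_eq:
  assumes "local_param M \<iota> V \<psi>" "v \<in> V"
  shows "tangent_space M \<iota> (\<psi> v) = range (\<lambda>h. dd h (\<iota> \<circ> \<psi>) v)"
proof
  show "tangent_space M \<iota> (\<psi> v) \<subseteq> range (\<lambda>h. dd h (\<iota> \<circ> \<psi>) v)"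
    unfolding tangent_space_def using range_dd_param_subset[OF assms(1) _ assms(2)] by blast
  show "range (\<lambda>h. dd h (\<iota> \<circ> \<psi>) v) \<subseteq> tangent_space M \<iota> (\<psi> v)"
    unfolding tangent_space_def using assms by blast
qed

subsection \<open>Linear algebra of \<open>J\<close> and \<open>P\<close> in the left trivialization\<close>

definition J0 :: "quat \<times> quat \<Rightarrow> quat \<times> quat" where
  "J0 z = (1 / sqrt 3) *\<^sub>R (2 *\<^sub>R snd z - fst z, snd z - 2 *\<^sub>R fst z)"

definition g0 :: "quat \<times> quat \<Rightarrow> quat \<times> quat \<Rightarrow> real" where
  "g0 z z' = 4 / 3 * (fst z \<bullet> fst z' + snd z \<bullet> snd z') - 2 / 3 * (fst z \<bullet> snd z' + snd z \<bullet> fst z')"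

lemma linear_J0: "linear J0"
  by (rule linearI) (simp_all add: J0_def prod_eq_iff algebra_simps)

lemma J0_J0: "J0 (J0 z) = - z"
proof -
  obtain x y where Pair: "z = (x, y)" by (rule prod.exhaust)
  have "J0 (J0 z) = (1 / sqrt 3) *\<^sub>R (1 / sqrt 3) *\<^sub>R (2 *\<^sub>R (y - 2 *\<^sub>R x) - (2 *\<^sub>R y - x), (y - 2 *\<^sub>R x) - 2 *\<^sub>R (2 *\<^sub>R y - x))"
    by (simp add: J0_def Pair algebra_simps)
  also have "\<dots> = (1 / 3) *\<^sub>R ((- 3) *\<^sub>R z)"
  proof -
    have "(2 *\<^sub>R (y - 2 *\<^sub>R x) - (2 *\<^sub>R y - x), (y - 2 *\<^sub>R x) - 2 *\<^sub>R (2 *\<^sub>R y - x)) = (- 3) *\<^sub>R z"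
      by (simp add: Pair prod_eq_iff algebra_simps complex_eq_iff)
    then show ?thesis by (simp only:) simp
  qed
  finally show ?thesis by simp
qed

lemma g0_eq: "(z \<bullet> z' + J0 z \<bullet> J0 z') / 2 = g0 z z'"
  by (simp add: g0_def J0_def inner_prod_def[of "(_::quat, _::quat)"] inner_prod_def[of "_::quat \<times> quat"]
      inner_diff_left inner_diff_right algebra_simps inner_commute)
    (simp add: field_simps)

text \<open>Two explicit combinations of J and P act as matrices that isolate a single coordinate,
  so an invariant subspace contains both axis copies of each component.\<close>

lemma JP_invariant_axes:
  assumes X: "subspace X" and J: "\<forall>z\<in>X. J0 z \<in> X" and P: "\<forall>z\<in>X. prod.swap z \<in> X"
    and z: "(\<alpha>, \<beta>) \<in> X"
  shows "(\<alpha>, 0) \<in> X" "(0, \<alpha>) \<in> X" "(\<beta>, 0) \<in> X" "(0, \<beta>) \<in> X"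
proof -
  have 1: "(0, \<beta> - 2 *\<^sub>R \<alpha>) \<in> X" if "(\<alpha>, \<beta>) \<in> X" for \<alpha> \<beta>
  proof -
    have s: "(\<beta>, \<alpha>) \<in> X" using bspec[OF P that] by simp
    have j: "(2 *\<^sub>R \<beta> - \<alpha>, \<beta> - 2 *\<^sub>R \<alpha>) \<in> X"
      using subspace_scale[OF X bspec[OF J that], of "sqrt 3"] by (simp add: J0_def)
    \<comment> \<open>This is (sqrt 3 J + 1 - 2 P) / 2 applied to (\<alpha>, \<beta>).\<close>
    have "(1 / 2) *\<^sub>R ((2 *\<^sub>R \<beta> - \<alpha>, \<beta> - 2 *\<^sub>R \<alpha>) + (\<alpha>, \<beta>) - 2 *\<^sub>R (\<beta>, \<alpha>)) \<in> X"
      by (intro subspace_add[OF X] subspace_diff[OF X] subspace_scale[OF X] j that s)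
    moreover have "(1 / 2) *\<^sub>R ((2 *\<^sub>R \<beta> - \<alpha>, \<beta> - 2 *\<^sub>R \<alpha>) + (\<alpha>, \<beta>) - 2 *\<^sub>R (\<beta>, \<alpha>)) = (0, \<beta> - 2 *\<^sub>R \<alpha>)"
      by (simp add: prod_eq_iff complex_eq_iff)
    ultimately show ?thesis by simp
  qed
  have ax: "(0, \<alpha>) \<in> X" if z: "(\<alpha>, \<beta>) \<in> X" for \<alpha> \<beta>
  proof -
    have "(\<beta>, \<alpha>) \<in> X" using bspec[OF P z] by simp
    \<comment> \<open>The same operator applied to the swapped vector gives \<alpha> - 2 \<beta>,
      and 2 (\<beta> - 2 \<alpha>) + (\<alpha> - 2 \<beta>) = -3 \<alpha>.\<close>
    then have "(- 1 / 3) *\<^sub>R (2 *\<^sub>R (0, \<beta> - 2 *\<^sub>R \<alpha>) + (0, \<alpha> - 2 *\<^sub>R \<beta>)) \<in> X"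
      using 1[of \<alpha> \<beta>] 1[of \<beta> \<alpha>] z by (intro subspace_add[OF X] subspace_scale[OF X])
    moreover have "(- 1 / 3) *\<^sub>R (2 *\<^sub>R (0, \<beta> - 2 *\<^sub>R \<alpha>) + (0, \<alpha> - 2 *\<^sub>R \<beta>)) = (0 :: quat, \<alpha>)"
      by (simp add: prod_eq_iff complex_eq_iff)
    ultimately show ?thesis by simp
  qed
  show "(0, \<alpha>) \<in> X" using ax[OF z] .
  then show "(\<alpha>, 0) \<in> X" using bspec[OF P, of "(0, \<alpha>)"] by simp
  have "(\<beta>, \<alpha>) \<in> X" using bspec[OF P z] by simp
  then show "(0, \<beta>) \<in> X" by (rule ax)
  then show "(\<beta>, 0) \<in> X" using bspec[OF P, of "(0, \<beta>)"] by simp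
qed

text \<open>Two independent components would contribute four independent vectors, two on each axis,
  which the bound on the dimension excludes.\<close>

lemma JP_invariant_line:
  assumes X: "subspace X" and J: "\<forall>z\<in>X. J0 z \<in> X" and P: "\<forall>z\<in>X. prod.swap z \<in> X"
    and nz: "z0 \<in> X" "z0 \<noteq> 0" and dim: "dim X < 4"
  obtains \<xi> where "\<xi> \<bullet> \<xi> = 1" "(\<xi>, 0) \<in> X" "(0, \<xi>) \<in> X"
    "\<And>z. z \<in> X \<Longrightarrow> z = ((fst z \<bullet> \<xi>) *\<^sub>R \<xi>, (snd z \<bullet> \<xi>) *\<^sub>R \<xi>)"
proof -
  note ax = JP_invariant_axes[OF X J P]
  obtain \<gamma> where \<gamma>: "\<gamma> \<noteq> 0" "(\<gamma>, 0) \<in> X" "(0, \<gamma>) \<in> X"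
  proof (cases "fst z0 = 0")
    case True
    then have "snd z0 \<noteq> 0" using nz(2) by (simp add: prod_eq_iff)
    then show ?thesis using that[of "snd z0"] ax(3,4)[of "fst z0" "snd z0"] nz(1) by simp
  next
    case False
    then show ?thesis using that[of "fst z0"] ax(1,2)[of "fst z0" "snd z0"] nz(1) by simp
  qed
  define \<xi> where "\<xi> = (1 / norm \<gamma>) *\<^sub>R \<gamma>"
  have \<xi>: "\<xi> \<bullet> \<xi> = 1" "(\<xi>, 0) \<in> X" "(0, \<xi>) \<in> X"
    using \<gamma>(1) subspace_scale[OF X \<gamma>(2), of "1 / norm \<gamma>"] subspace_scale[OF X \<gamma>(3), of "1 / norm \<gamma>"]
    by (simp_all add: \<xi>_def dot_square_norm power2_eq_square)
  have par: "\<alpha> = (\<alpha> \<bullet> \<xi>) *\<^sub>R \<xi>" if \<alpha>: "(\<alpha>, 0) \<in> X" "(0, \<alpha>) \<in> X" for \<alpha>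
  proof (rule ccontr)
    define \<kappa> where "\<kappa> = \<alpha> - (\<alpha> \<bullet> \<xi>) *\<^sub>R \<xi>"
    assume "\<alpha> \<noteq> (\<alpha> \<bullet> \<xi>) *\<^sub>R \<xi>"
    then have \<kappa>: "\<kappa> \<noteq> 0" by (simp add: \<kappa>_def)
    have o: "\<kappa> \<bullet> \<xi> = 0" using \<xi>(1) by (simp add: \<kappa>_def inner_diff_left)
    then have o': "\<xi> \<bullet> \<kappa> = 0" by (simp only: inner_commute)
    have \<kappa>X: "(\<kappa>, 0) \<in> X" "(0, \<kappa>) \<in> X"
      using subspace_diff[OF X \<alpha>(1) subspace_scale[OF X \<xi>(2), of "\<alpha> \<bullet> \<xi>"]]
        subspace_diff[OF X \<alpha>(2) subspace_scale[OF X \<xi>(3), of "\<alpha> \<bullet> \<xi>"]] by (simp_all add: \<kappa>_def)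
    have \<xi>0: "\<xi> \<noteq> 0" using \<xi>(1) by auto
    let ?B = "{(\<xi>, 0), (0, \<xi>), (\<kappa>, 0), (0, \<kappa>)} :: (quat \<times> quat) set"
    have "pairwise orthogonal ?B" "0 \<notin> ?B"
      using o o' \<kappa> \<xi>0 by (auto simp: pairwise_def orthogonal_def inner_prod_def[of "(_::quat, _::quat)"] zero_prod_def[where 'a = quat and 'b = quat])
    then have "independent ?B" by (rule pairwise_orthogonal_independent)
    moreover have "card ?B = 4"
    proof -
      have "\<xi> \<noteq> \<kappa>" using o \<xi>(1) by auto
      then show ?thesis using \<kappa> \<xi>0 by simp
    qed
    moreover have "?B \<subseteq> X" using \<xi> \<kappa>X by simp
    ultimately show False using dim independent_card_le_dim[of ?B X] by simp
  qed
  show ?thesis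
  proof (rule that[OF \<xi>])
    fix z assume "z \<in> X"
    then have z: "(fst z, snd z) \<in> X" by simp
    have "fst z = (fst z \<bullet> \<xi>) *\<^sub>R \<xi>" "snd z = (snd z \<bullet> \<xi>) *\<^sub>R \<xi>"
      by (intro par ax(1,2)[OF z] ax(3,4)[OF z])+
    then show "z = ((fst z \<bullet> \<xi>) *\<^sub>R \<xi>, (snd z \<bullet> \<xi>) *\<^sub>R \<xi>)"
      by (intro prod_eqI) (simp_all only: fst_conv snd_conv)
  qed
qed

text \<open>The subspaces \<open>D\<close> and \<open>C\<close> are invariant under J and P and have
  dimension below four, so each is a line tensored with R^2. They supply \<xi> and \<eta>; a vector
  \<open>n\<close> of \<open>T\<close> orthogonal to \<open>D\<close> lies in \<open>C\<close> and
  supplies w.\<close>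

lemma JP_structure:
  fixes T :: "(quat \<times> quat) set"
  assumes T: "subspace T" "dim T = 3" "T \<subseteq> Im_quat \<times> Im_quat"
    and D: "D = J0 ` T \<inter> T" "prod.swap ` D = D" "D \<noteq> {0}"
    and E: "E = {z \<in> T. \<forall>y\<in>D. g0 z y = 0}"
    and C: "C = {y + z | y z. y \<in> E \<and> z \<in> J0 ` E}" "prod.swap ` C = C"
  obtains \<xi> \<eta> w1 w2 where "quat_frame \<xi> \<eta>" "w1 \<noteq> 0 \<or> w2 \<noteq> 0"
    "T = {(x *\<^sub>R \<xi> + (z * w1) *\<^sub>R \<eta>, y *\<^sub>R \<xi> + (z * w2) *\<^sub>R \<eta>) | x y z. True}"
proof -
  have sJT: "subspace (J0 ` T)" by (rule linear_subspace_image[OF linear_J0 T(1)])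
  have sD: "subspace D" unfolding D(1) by (rule subspace_inter[OF sJT T(1)])
  have JD: "\<forall>z\<in>D. J0 z \<in> D"
  proof
    fix z assume z: "z \<in> D"
    obtain y where y: "y \<in> T" "z = J0 y" using z unfolding D(1) by blast
    have "J0 z \<in> J0 ` T" using z unfolding D(1) by blast
    moreover have "J0 z \<in> T" using y subspace_neg[OF T(1)] by (simp add: J0_J0)
    ultimately show "J0 z \<in> D" unfolding D(1) by blast
  qed
  have PD: "\<forall>z\<in>D. prod.swap z \<in> D" using D(2) by blast
  obtain z0 where z0: "z0 \<in> D" "z0 \<noteq> 0" using D(3) subspace_0[OF sD] by blast
  have "dim D \<le> dim T" by (rule dim_subset) (use D(1) in auto)
  then have dD: "dim D < 4" using T(2) by simp
  obtain \<xi> where \<xi>: "\<xi> \<bullet> \<xi> = 1" "(\<xi>, 0) \<in> D" "(0, \<xi>) \<in> D"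
    and Dform: "\<And>z. z \<in> D \<Longrightarrow> z = ((fst z \<bullet> \<xi>) *\<^sub>R \<xi>, (snd z \<bullet> \<xi>) *\<^sub>R \<xi>)"
    by (rule JP_invariant_line[OF sD JD PD z0 dD]) (assumption | rule that)+
  have \<xi>T: "(\<xi>, 0) \<in> T" "(0, \<xi>) \<in> T" using \<xi> D(1) by auto
  have \<xi>Im: "\<xi> \<in> Im_quat" using \<xi>T T(3) by auto
  have \<xi>0: "\<xi> \<noteq> 0" using \<xi>(1) by auto
  have Dmem: "(x *\<^sub>R \<xi>, y *\<^sub>R \<xi>) \<in> D" for x y
    using subspace_add[OF sD subspace_scale[OF sD \<xi>(2), of x] subspace_scale[OF sD \<xi>(3), of y]] by simp
  have Dsub: "D \<subseteq> T" using D(1) by blast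
  have "\<not> T \<subseteq> span {(\<xi>, 0), (0, \<xi>)}"
  proof
    assume "T \<subseteq> span {(\<xi>, 0), (0, \<xi>)}"
    then have "dim T \<le> card {(\<xi>, 0), (0, \<xi>)}" by (rule dim_le_card) simp
    also have "\<dots> \<le> 2" by (rule card_insert_le_m1) simp_all
    finally show False using T(2) by simp
  qed
  then obtain t where t: "t \<in> T" "t \<notin> span {(\<xi>, 0), (0, \<xi>)}" by blast
  \<comment> \<open>The Euclidean projection is enough: \<open>g0\<close> is built from inner
    products of components, and both components of \<open>n\<close> are orthogonal to \<xi>.\<close>
  define n where "n = t - ((fst t \<bullet> \<xi>) *\<^sub>R \<xi>, (snd t \<bullet> \<xi>) *\<^sub>R \<xi>)"
  have nT: "n \<in> T" unfolding n_def using subspace_diff[OF T(1) t(1)] Dmem Dsub by blast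
  have n0: "n \<noteq> 0"
  proof
    assume "n = 0"
    then have "t = (fst t \<bullet> \<xi>) *\<^sub>R (\<xi>, 0) + (snd t \<bullet> \<xi>) *\<^sub>R (0, \<xi>)"
      by (simp add: n_def)
    also have "\<dots> \<in> span {(\<xi>, 0), (0, \<xi>)}"
      by (intro span_add span_scale span_base) auto
    finally show False using t(2) by blast
  qed
  have no': "fst n \<bullet> \<xi> = 0" "snd n \<bullet> \<xi> = 0"
    using \<xi>(1) by (simp_all add: n_def inner_diff_left)
  then have "\<xi> \<bullet> fst n = 0" "\<xi> \<bullet> snd n = 0" by (simp_all only: inner_commute)
  note no = no' this
  have nE: "n \<in> E"
    unfolding E using nT
  proof (intro CollectI conjI ballI)
    fix y assume "y \<in> D"
    show "g0 n y = 0"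
      by (subst Dform[OF \<open>y \<in> D\<close>]) (simp add: g0_def no)
  qed
  have Tform: "\<exists>x y c. z = (x *\<^sub>R \<xi>, y *\<^sub>R \<xi>) + c *\<^sub>R n" if z: "z \<in> T" for z
  proof -
    let ?B = "{(\<xi>, 0), (0, \<xi>), n} :: (quat \<times> quat) set"
    have "pairwise orthogonal ?B"
      using no by (auto simp: pairwise_def orthogonal_def inner_prod_def[of "(_::quat, _::quat)"] inner_prod_def[of "_::quat \<times> quat"])
    moreover have "0 \<notin> ?B" using n0 \<xi>0 by (auto simp: zero_prod_def[where 'a = quat and 'b = quat])
    ultimately have ind: "independent ?B" by (rule pairwise_orthogonal_independent)
    have "n \<noteq> (\<xi>, 0)" "n \<noteq> (0, \<xi>)" using no \<xi>(1) by auto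
    then have "card ?B = 3" using \<xi>0 by simp
    then have "T \<subseteq> span ?B"
      using card_eq_dim[of ?B T] ind \<xi>T nT T(2) by simp
    then have "z \<in> span ?B" using z by blast
    then obtain x where "z - x *\<^sub>R (\<xi>, 0) \<in> span {(0, \<xi>), n}" unfolding span_breakdown_eq by blast
    then obtain y where "z - x *\<^sub>R (\<xi>, 0) - y *\<^sub>R (0, \<xi>) \<in> span {n}" unfolding span_breakdown_eq by blast
    then obtain c where "z - x *\<^sub>R (\<xi>, 0) - y *\<^sub>R (0, \<xi>) = c *\<^sub>R n" unfolding span_singleton by blast
    then have "z = (x *\<^sub>R (\<xi>, 0) + y *\<^sub>R (0, \<xi>)) + c *\<^sub>R n" by (simp only: algebra_simps)
    then show ?thesis by (intro exI[of _ x] exI[of _ y] exI[of _ c]) simp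
  qed
  have Eform: "\<exists>c. z = c *\<^sub>R n" if z: "z \<in> E" for z
  proof -
    obtain x y c where zf: "z = (x *\<^sub>R \<xi>, y *\<^sub>R \<xi>) + c *\<^sub>R n" using Tform z E by blast
    have "g0 z (x *\<^sub>R \<xi>, y *\<^sub>R \<xi>) = 0" using z Dmem unfolding E by blast
    \<comment> \<open>On \<xi> times R^2 the metric is 2/3 (x^2 + y^2 + (x - y)^2), so orthogonality
      to \<open>D\<close> leaves only multiples of \<open>n\<close>.\<close>
    then have "4 / 3 * (x * x + y * y) - 2 / 3 * (x * y + y * x) = 0"
      unfolding zf g0_def by (simp add: inner_add_left no \<xi>(1))
    then have "x\<^sup>2 + y\<^sup>2 + (x - y)\<^sup>2 = 0" by (simp add: power2_eq_square algebra_simps)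
    then have "x = 0 \<and> y = 0"
      using sum_power2_ge_zero[of x y] zero_le_power2[of "x - y"] sum_power2_eq_zero_iff[of x y] by linarith
    then show ?thesis using zf by (intro exI[of _ c]) (simp add: zero_prod_def[symmetric])
  qed
  have sE: "c *\<^sub>R n \<in> E" for c
  proof -
    have "g0 (c *\<^sub>R n) y = c * g0 n y" for y by (simp add: g0_def algebra_simps)
    then show ?thesis using nE subspace_scale[OF T(1)] unfolding E by simp
  qed
  have Cform: "C = {a *\<^sub>R n + b *\<^sub>R J0 n | a b. True}"
  proof (intro equalityI subsetI)
    fix z assume "z \<in> C"
    then obtain y z' where "z = y + J0 z'" "y \<in> E" "z' \<in> E" unfolding C(1) by blast
    moreover obtain a b where "y = a *\<^sub>R n" "z' = b *\<^sub>R n" using calculation Eform by blast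
    ultimately have "z = a *\<^sub>R n + b *\<^sub>R J0 n" by (simp only: linear_cmul[OF linear_J0])
    then show "z \<in> {a *\<^sub>R n + b *\<^sub>R J0 n | a b. True}" by blast
  next
    fix z assume "z \<in> {a *\<^sub>R n + b *\<^sub>R J0 n | a b. True}"
    then obtain a b where z: "z = a *\<^sub>R n + J0 (b *\<^sub>R n)" by (auto simp: linear_cmul[OF linear_J0])
    show "z \<in> C" unfolding C(1) z using sE by blast
  qed
  have Cspan: "C = span {n, J0 n}"
  proof (intro equalityI subsetI)
    fix z assume "z \<in> C"
    then obtain a b where "z = a *\<^sub>R n + b *\<^sub>R J0 n" unfolding Cform by blast
    moreover have "a *\<^sub>R n + b *\<^sub>R J0 n \<in> span {n, J0 n}"
      by (intro span_add span_scale span_base) auto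
    ultimately show "z \<in> span {n, J0 n}" by simp
  next
    fix z assume "z \<in> span {n, J0 n}"
    then obtain a where "z - a *\<^sub>R n \<in> span {J0 n}" unfolding span_breakdown_eq by blast
    then obtain b where "z - a *\<^sub>R n = b *\<^sub>R J0 n" unfolding span_singleton by blast
    then have "z = a *\<^sub>R n + b *\<^sub>R J0 n" by (simp only: algebra_simps)
    then show "z \<in> C" unfolding Cform by blast
  qed
  have sC: "subspace C" unfolding Cspan by (rule subspace_span)
  have JC: "\<forall>z\<in>C. J0 z \<in> C"
  proof
    fix z assume "z \<in> C"
    then obtain a b where "z = a *\<^sub>R n + b *\<^sub>R J0 n" unfolding Cform by blast
    then have "J0 z = (- b) *\<^sub>R n + a *\<^sub>R J0 n"
      by (simp add: linear_add[OF linear_J0] linear_cmul[OF linear_J0] J0_J0)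
    then show "J0 z \<in> C" unfolding Cform by blast
  qed
  have PC: "\<forall>z\<in>C. prod.swap z \<in> C" using C(2) by blast
  have nC: "n \<in> C" unfolding Cspan by (simp add: span_base)
  have "dim C \<le> card {n, J0 n}" unfolding Cspan by (rule dim_le_card) simp_all
  also have "\<dots> \<le> 2" by (rule card_insert_le_m1) simp_all
  finally have dC: "dim C < 4" by simp
  obtain \<eta> where \<eta>: "\<eta> \<bullet> \<eta> = 1" "(\<eta>, 0) \<in> C"
    and Cf: "\<And>z. z \<in> C \<Longrightarrow> z = ((fst z \<bullet> \<eta>) *\<^sub>R \<eta>, (snd z \<bullet> \<eta>) *\<^sub>R \<eta>)"
    by (rule JP_invariant_line[OF sC JC PC nC n0 dC]) (assumption | rule that)+
  define w1 where "w1 = fst n \<bullet> \<eta>"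
  define w2 where "w2 = snd n \<bullet> \<eta>"
  have nf: "n = (w1 *\<^sub>R \<eta>, w2 *\<^sub>R \<eta>)" unfolding w1_def w2_def by (rule Cf[OF nC])
  have w: "w1 \<noteq> 0 \<or> w2 \<noteq> 0" using n0 nf by (auto simp: zero_prod_def[where 'a = quat and 'b = quat])
  have "\<xi> \<bullet> \<eta> = 0" using no(3,4) w unfolding nf by auto
  moreover have "\<eta> \<in> Im_quat"
  proof -
    have "w1 *\<^sub>R \<eta> \<in> Im_quat" "w2 *\<^sub>R \<eta> \<in> Im_quat" using nT T(3) unfolding nf by auto
    then show ?thesis using w by (auto simp: Im_quat_def)
  qed
  ultimately have fr: "quat_frame \<xi> \<eta>" using \<xi>(1) \<eta>(1) \<xi>Im by unfold_locales
  have "T = {(x *\<^sub>R \<xi> + (z * w1) *\<^sub>R \<eta>, y *\<^sub>R \<xi> + (z * w2) *\<^sub>R \<eta>) | x y z. True}"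
  proof (intro equalityI subsetI)
    fix z assume "z \<in> T"
    then obtain x y c where "z = (x *\<^sub>R \<xi>, y *\<^sub>R \<xi>) + c *\<^sub>R n" using Tform by blast
    then have "z = (x *\<^sub>R \<xi> + (c * w1) *\<^sub>R \<eta>, y *\<^sub>R \<xi> + (c * w2) *\<^sub>R \<eta>)" by (simp add: nf)
    then show "z \<in> {(x *\<^sub>R \<xi> + (z * w1) *\<^sub>R \<eta>, y *\<^sub>R \<xi> + (z * w2) *\<^sub>R \<eta>) | x y z. True}" by blast
  next
    fix z assume "z \<in> {(x *\<^sub>R \<xi> + (z * w1) *\<^sub>R \<eta>, y *\<^sub>R \<xi> + (z * w2) *\<^sub>R \<eta>) | x y z. True}"
    then obtain x y c where "z = (x *\<^sub>R \<xi> + (c * w1) *\<^sub>R \<eta>, y *\<^sub>R \<xi> + (c * w2) *\<^sub>R \<eta>)" by blast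
    then have "z = (x *\<^sub>R \<xi>, y *\<^sub>R \<xi>) + c *\<^sub>R n" by (simp add: nf)
    moreover have "(x *\<^sub>R \<xi>, y *\<^sub>R \<xi>) + c *\<^sub>R n \<in> T"
      using subspace_add[OF T(1)] subspace_scale[OF T(1) nT] Dmem Dsub by blast
    ultimately show "z \<in> T" by simp
  qed
  then show ?thesis using that fr w by blast
qed

section \<open>Left trivialization of the tangent spaces and adapted frames on the
  submanifold\<close>

lemma unit_quat_inner_left:
  assumes "p \<in> unit_quat"
  shows "(p *\<^sub>H x) \<bullet> (p *\<^sub>H y) = x \<bullet> y"
  using assms by (simp add: inner_qmult_left)

definition left_triv :: "quat \<times> quat \<Rightarrow> quat \<times> quat \<Rightarrow> quat \<times> quat" where
  "left_triv x Z = (qcnj (fst x) *\<^sub>H fst Z, qcnj (snd x) *\<^sub>H snd Z)"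

lemma linear_left_triv: "linear (left_triv x)"
  by (rule linearI) (simp_all add: left_triv_def qmult.add_right qmult.scaleR_right)

context
  fixes x assumes x: "x \<in> S3S3"
begin

lemma unit_fst_snd: "fst x \<in> unit_quat" "snd x \<in> unit_quat"
  using x by (auto simp: S3S3_def)

lemma inj_left_triv: "inj (left_triv x)"
proof (rule injI)
  fix Y Z assume "left_triv x Y = left_triv x Z"
  then have "fst x *\<^sub>H (qcnj (fst x) *\<^sub>H fst Y) = fst x *\<^sub>H (qcnj (fst x) *\<^sub>H fst Z)"
    "snd x *\<^sub>H (qcnj (snd x) *\<^sub>H snd Y) = snd x *\<^sub>H (qcnj (snd x) *\<^sub>H snd Z)"
    by (simp_all only: left_triv_def prod.inject)
  then show "Y = Z" using unit_fst_snd by (simp add: prod_eq_iff)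
qed

lemma left_triv_J: "left_triv x (J_nk x Z) = J0 (left_triv x Z)"
  using unit_fst_snd
  by (simp add: left_triv_def J_nk_def J0_def Let_def qmult.scaleR_right qmult.add_right qmult.diff_right)

lemma left_triv_P: "left_triv x (P_nk x Z) = prod.swap (left_triv x Z)"
  using unit_fst_snd by (simp add: left_triv_def P_nk_def Let_def)

lemma left_triv_inner: "left_triv x Y \<bullet> left_triv x Z = Y \<bullet> Z"
  using unit_fst_snd
  by (cases Y, cases Z) (simp add: left_triv_def unit_quat_inner_left)

lemma g_nk_eq: "g_nk x Y Z = g0 (left_triv x Y) (left_triv x Z)"
  unfolding g_nk_def g0_eq[symmetric] left_triv_J[symmetric] left_triv_inner by simp

end

text \<open>The pair of Maurer-Cartan forms is the differential of the parametrized map followed by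
  left trivialization. So \<open>JP_structure\<close> describes its range, and its injectivity turns
  a basis of the range into an adapted basis of parameter vectors.\<close>

lemma adapted_point:
  assumes M: "submanifold3 M \<iota>" and lp: "local_param M \<iota> V \<psi>" and v: "v \<in> V"
    and nz: "D1 M \<iota> (\<psi> v) \<noteq> {0}"
    and P1: "P_nk (\<iota> (\<psi> v)) ` D1 M \<iota> (\<psi> v) = D1 M \<iota> (\<psi> v)"
    and P2: "P_nk (\<iota> (\<psi> v)) ` D2 M \<iota> (\<psi> v) = D2 M \<iota> (\<psi> v)"
    and pq: "unit_map V (\<lambda>u. fst (\<iota> (\<psi> u)))" "unit_map V (\<lambda>u. snd (\<iota> (\<psi> u)))"
  shows "\<exists>\<xi> \<eta> w1 w2. adapted (\<lambda>u. fst (\<iota> (\<psi> u))) (\<lambda>u. snd (\<iota> (\<psi> u))) v \<xi> \<eta> w1 w2"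
proof -
  define x where "x = \<iota> (\<psi> v)"
  have x: "x \<in> S3S3"
    using M local_paramD(6)[OF lp v] by (auto simp: submanifold3_def x_def)
  define tl where "tl = left_triv x"
  note tl_simps = left_triv_J[OF x, folded tl_def] left_triv_P[OF x, folded tl_def] g_nk_eq[OF x, folded tl_def]
  have lin: "linear tl" and inj: "inj tl"
    unfolding tl_def by (rule linear_left_triv, rule inj_left_triv[OF x])
  define F where "F = \<iota> \<circ> \<psi>"
  let ?p = "\<lambda>u. fst (\<iota> (\<psi> u))" and ?q = "\<lambda>u. snd (\<iota> (\<psi> u))"
  define \<Omega> where "\<Omega> = (\<lambda>h. (mcf ?p h v, mcf ?q h v))"
  have Fd: "F differentiable (at v)"
    unfolding F_def by (rule smooth_on_differentiable[OF local_paramD(4)[OF lp] v])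
  have \<Omega>: "\<Omega> h = tl (dd h F v)" for h
    using dd_linear[OF bounded_linear_fst Fd, of h] dd_linear[OF bounded_linear_snd Fd, of h]
    by (simp add: \<Omega>_def mcf_def tl_def left_triv_def x_def F_def o_def)
  have lin\<Omega>: "linear \<Omega>"
    using linear_compose[OF linear_dd[OF Fd] lin] unfolding \<Omega>[abs_def] o_def .
  have inj\<Omega>: "inj \<Omega>"
    unfolding \<Omega>[abs_def] using inj_compose[OF inj local_paramD(5)[OF lp v, folded F_def]] by (simp add: o_def)
  define T where "T = range \<Omega>"
  have TT: "T = tl ` tangent_space M \<iota> (\<psi> v)"
    unfolding T_def tangent_space_eq[OF lp v] F_def[symmetric] image_image \<Omega> ..
  have sT: "subspace T"
    unfolding T_def by (rule linear_subspace_image[OF lin\<Omega> subspace_UNIV])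
  have dT: "dim T = 3"
    unfolding T_def using dim_image_eq[OF lin\<Omega>, of UNIV] inj\<Omega> by (simp add: inj_on_subset)
  have TIm: "T \<subseteq> Im_quat \<times> Im_quat"
    unfolding T_def \<Omega>_def using mcf_Im[OF pq(1) v] mcf_Im[OF pq(2) v] by auto
  define D where "D = tl ` D1 M \<iota> (\<psi> v)"
  define E where "E = tl ` D1_perp M \<iota> (\<psi> v)"
  define C where "C = tl ` D2 M \<iota> (\<psi> v)"
  have D: "D = J0 ` T \<inter> T"
    unfolding D_def D1_def TT image_Int[OF inj] x_def[symmetric] image_image tl_simps ..
  have PD: "prod.swap ` D = D"
    using arg_cong[OF P1, of "(`) tl"] unfolding D_def image_image x_def[symmetric] tl_simps .
  have D0: "D \<noteq> {0}"
  proof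
    assume "D = {0}"
    then have "tl ` D1 M \<iota> (\<psi> v) = tl ` {0}" by (simp add: D_def linear_0[OF lin])
    then show False using nz inj by (simp only: inj_image_eq_iff)
  qed
  have E: "E = {z \<in> T. \<forall>y\<in>D. g0 z y = 0}"
    unfolding E_def D1_perp_def orth_compl_in_TM_def TT D_def x_def[symmetric] tl_simps by blast
  have C: "C = {y + z | y z. y \<in> E \<and> z \<in> J0 ` E}"
  proof -
    have "tl ` J_nk x ` Y = J0 ` tl ` Y" for Y by (simp add: image_image tl_simps)
    moreover have "tl ` {y + z | y z. y \<in> Y \<and> z \<in> Z} = {y + z | y z. y \<in> tl ` Y \<and> z \<in> tl ` Z}" for Y Z
    proof (intro equalityI subsetI)
      fix w assume "w \<in> tl ` {y + z | y z. y \<in> Y \<and> z \<in> Z}"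
      then obtain y z where "y \<in> Y" "z \<in> Z" "w = tl (y + z)" by blast
      then show "w \<in> {y + z | y z. y \<in> tl ` Y \<and> z \<in> tl ` Z}" using linear_add[OF lin] by blast
    next
      fix w assume "w \<in> {y + z | y z. y \<in> tl ` Y \<and> z \<in> tl ` Z}"
      then obtain y z where "y \<in> Y" "z \<in> Z" "w = tl y + tl z" by blast
      then show "w \<in> tl ` {y + z | y z. y \<in> Y \<and> z \<in> Z}"
        by (intro image_eqI[of _ _ "y + z"]) (simp only: linear_add[OF lin], blast)
    qed
    ultimately show ?thesis unfolding C_def D2_def E_def x_def[symmetric] by simp
  qed
  have PC: "prod.swap ` C = C"
    using arg_cong[OF P2, of "(`) tl"] unfolding C_def image_image x_def[symmetric] tl_simps .
  obtain \<xi> \<eta> w1 w2 where f: "quat_frame \<xi> \<eta>" and w: "w1 \<noteq> 0 \<or> w2 \<noteq> 0"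
    and Tf: "T = {(x *\<^sub>R \<xi> + (z * w1) *\<^sub>R \<eta>, y *\<^sub>R \<xi> + (z * w2) *\<^sub>R \<eta>) | x y z. True}"
    by (rule JP_structure[OF sT dT TIm D PD D0 E C PC])
  have mem: "(x *\<^sub>R \<xi> + (z * w1) *\<^sub>R \<eta>, y *\<^sub>R \<xi> + (z * w2) *\<^sub>R \<eta>) \<in> range \<Omega>" for x y z
    using Tf unfolding T_def by blast
  have "(\<xi>, 0) \<in> range \<Omega>" "(0, \<xi>) \<in> range \<Omega>" "(w1 *\<^sub>R \<eta>, w2 *\<^sub>R \<eta>) \<in> range \<Omega>"
    using mem[where x = 1 and y = 0 and z = 0] mem[where x = 0 and y = 1 and z = 0]
      mem[where x = 0 and y = 0 and z = 1] by simp_all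
  then obtain ha hb hs where ha: "\<Omega> ha = (\<xi>, 0)" and hb: "\<Omega> hb = (0, \<xi>)"
    and hs: "\<Omega> hs = (w1 *\<^sub>R \<eta>, w2 *\<^sub>R \<eta>)"
    unfolding image_iff by metis
  have "\<exists>x y z. h = x *\<^sub>R ha + y *\<^sub>R hb + z *\<^sub>R hs" for h
  proof -
    have "\<Omega> h \<in> T" unfolding T_def by blast
    then obtain x y z where "\<Omega> h = (x *\<^sub>R \<xi> + (z * w1) *\<^sub>R \<eta>, y *\<^sub>R \<xi> + (z * w2) *\<^sub>R \<eta>)"
      unfolding Tf by blast
    also have "\<dots> = \<Omega> (x *\<^sub>R ha + y *\<^sub>R hb + z *\<^sub>R hs)"
      by (simp add: linear_add[OF lin\<Omega>] linear_cmul[OF lin\<Omega>] ha hb hs)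
    finally have "h = x *\<^sub>R ha + y *\<^sub>R hb + z *\<^sub>R hs" by (rule injD[OF inj\<Omega>])
    then show ?thesis by blast
  qed
  then have "adapted_basis ?p ?q v \<xi> \<eta> w1 w2 ha hb hs"
    using ha hb hs unfolding adapted_basis_def \<Omega>_def by simp
  then show ?thesis unfolding adapted_def using f w by blast
qed

text \<open>The distribution of the CR structure lies in \<open>D1\<close> and has constant rank. If
  \<open>D1\<close> vanished at one point, that rank would be zero, and the whole submanifold would
  be totally real.\<close>

lemma proper_CR_D1_nontrivial:
  assumes "proper_CR_submanifold3 M \<iota>" "x \<in> topspace M"
  shows "D1 M \<iota> x \<noteq> {0}"
proof
  assume z: "D1 M \<iota> x = {0}"
  obtain r D where sd: "smooth_distribution M \<iota> r D"
    and J: "\<And>x. x \<in> topspace M \<Longrightarrow> J_nk (\<iota> x) ` D x = D x \<and>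
      J_nk (\<iota> x) ` orth_compl_in_TM M \<iota> D x \<subseteq> normal_space M \<iota> x"
    using assms(1) unfolding proper_CR_submanifold3_def CR_submanifold3_def by metis
  have "\<forall>x\<in>topspace M. D x \<subseteq> tangent_space M \<iota> x \<and> subspace (D x) \<and> dim (D x) = r"
    using sd unfolding smooth_distribution_def by (rule conjunct1)
  then have D: "D x \<subseteq> tangent_space M \<iota> x" "dim (D x) = r" if "x \<in> topspace M" for x
    using that by simp_all
  have "D x \<subseteq> J_nk (\<iota> x) ` tangent_space M \<iota> x"
    using image_mono[OF D(1)[OF assms(2)], of "J_nk (\<iota> x)"] J[OF assms(2)] by simp
  then have "D x \<subseteq> D1 M \<iota> x" using D(1)[OF assms(2)] unfolding D1_def by simp
  then have "dim (D x) = 0" unfolding z dim_eq_0 .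
  then have r0: "r = 0" using D(2)[OF assms(2)] by simp
  have "J_nk (\<iota> x) ` tangent_space M \<iota> x \<subseteq> normal_space M \<iota> x" if x: "x \<in> topspace M" for x
  proof -
    have "dim (D x) = 0" using D(2)[OF x] r0 by simp
    then have D0: "D x \<subseteq> {0}" unfolding dim_eq_0 .
    have "J_nk (\<iota> x) 0 = 0"
      by (simp add: J_nk_def Let_def qmult.zero_right prod_eq_iff)
    then have "g_nk (\<iota> x) Z 0 = 0" for Z by (simp add: g_nk_def)
    then have "\<forall>Y\<in>D x. g_nk (\<iota> x) Z Y = 0" for Z using D0 by blast
    then have "orth_compl_in_TM M \<iota> D x = tangent_space M \<iota> x"
      unfolding orth_compl_in_TM_def by simp
    then show ?thesis using J[OF x] by simp
  qed
  then have "totally_real_submanifold M \<iota>" unfolding totally_real_submanifold_def by simp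
  then show False using assms(1) unfolding proper_CR_submanifold3_def by simp
qed

text \<open>On the chart image, \<iota> is the inverse chart followed by the homeomorphism \<iota>
  \<circ> \<psi>.\<close>

lemma local_param_embedding:
  assumes lp: "local_param M \<iota> V \<psi>" and U: "open U" "U \<subseteq> V" "homeomorphism U ((\<iota> \<circ> \<psi>) ` U) (\<iota> \<circ> \<psi>) K"
  shows "embedding_map (subtopology M (\<psi> ` U)) euclidean \<iota>"
proof -
  let ?W = "\<psi> ` U"
  have WM: "?W \<subseteq> topspace M" using local_paramD(6)[OF lp] U(2) by blast
  have "homeomorphic_map (subtopology (top_of_set V) U) (subtopology (subtopology M (\<psi> ` V)) ?W) \<psi>"
    by (rule homeomorphic_map_subtopologies[OF local_paramD(3)[OF lp]]) (use U(2) WM in auto)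
  then have "homeomorphic_map (top_of_set U) (subtopology M ?W) \<psi>"
    using U(2) by (simp add: subtopology_subtopology Int_absorb1 image_mono)
  then obtain \<psi>i where \<psi>i: "homeomorphic_maps (top_of_set U) (subtopology M ?W) \<psi> \<psi>i"
    unfolding homeomorphic_map_maps by blast
  then have 1: "homeomorphic_map (subtopology M ?W) (top_of_set U) \<psi>i"
    unfolding homeomorphic_map_maps using homeomorphic_maps_sym by blast
  have "homeomorphic_maps (top_of_set U) (top_of_set ((\<iota> \<circ> \<psi>) ` U)) (\<iota> \<circ> \<psi>) K"
    using U(3) by (auto simp: homeomorphism_def homeomorphic_maps_def)
  then have 2: "homeomorphic_map (top_of_set U) (top_of_set ((\<iota> \<circ> \<psi>) ` U)) (\<iota> \<circ> \<psi>)"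
    unfolding homeomorphic_map_maps by blast
  have "homeomorphic_map (subtopology M ?W) (top_of_set ((\<iota> \<circ> \<psi>) ` U)) \<iota>"
  proof (rule homeomorphic_map_eq[OF homeomorphic_map_compose[OF 1 2]])
    fix y assume "y \<in> topspace (subtopology M ?W)"
    then have "\<psi> (\<psi>i y) = y" using \<psi>i by (auto simp: homeomorphic_maps_def)
    then show "(\<iota> \<circ> \<psi> \<circ> \<psi>i) y = \<iota> y" by simp
  qed
  then show ?thesis
    using WM by (simp add: embedding_map_def Int_absorb1 image_comp)
qed

theorem theorem2:
  fixes M :: "'m topology" and \<iota> :: "'m \<Rightarrow> quat \<times> quat"
  assumes "proper_CR_submanifold3 M \<iota>"
    and "\<And>x. x \<in> topspace M \<Longrightarrow> P_nk (\<iota> x) ` D1 M \<iota> x = D1 M \<iota> x"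
    and "\<And>x. x \<in> topspace M \<Longrightarrow> P_nk (\<iota> x) ` D2 M \<iota> x = D2 M \<iota> x"
  shows "\<forall>x\<in>topspace M. \<exists>f A. admissible_data f A \<and>
           (\<exists>\<phi>\<in>{immersion1 A, immersion2 A, immersion3 A}. locally_congruent_at M \<iota> x \<phi>)"
proof
  fix x assume x: "x \<in> topspace M"
  have M: "submanifold3 M \<iota>"
    using assms(1) by (simp add: proper_CR_submanifold3_def CR_submanifold3_def)
  then obtain V \<psi> v0 where lp: "local_param M \<iota> V \<psi>" and v0: "v0 \<in> V" "x = \<psi> v0"
    using x unfolding submanifold3_def by blast
  let ?F = "\<iota> \<circ> \<psi>" and ?p = "\<lambda>u. fst (\<iota> (\<psi> u))" and ?q = "\<lambda>u. snd (\<iota> (\<psi> u))"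
  have "smooth_on V ?p" "smooth_on V ?q"
    using smooth_on_linear[OF bounded_linear_fst local_paramD(1,4)[OF lp]]
      smooth_on_linear[OF bounded_linear_snd local_paramD(1,4)[OF lp]] by (simp_all add: o_def)
  moreover have "\<iota> (\<psi> u) \<in> S3S3" if "u \<in> V" for u
    using M local_paramD(6)[OF lp that] by (auto simp: submanifold3_def)
  ultimately have pq: "unit_map V ?p" "unit_map V ?q"
    using local_paramD(1)[OF lp] by (auto simp: unit_map_def S3S3_def mem_Times_iff)
  have ad: "\<exists>\<xi> \<eta> w1 w2. adapted ?p ?q u \<xi> \<eta> w1 w2" if u: "u \<in> V" for u
    by (rule adapted_point[OF M lp u proper_CR_D1_nontrivial[OF assms(1)] assms(2,3) pq])
      (rule local_paramD(6)[OF lp u])+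
  \<comment> \<open>On \<open>U\<close> the map \<iota> \<circ> \<psi> has a continuous inverse.
    Working in a ball inside \<open>U\<close> makes every smaller piece embedded and also gives the
    connectedness that \<open>normal_form\<close> asks for.\<close>
  obtain U G K where U: "open U" "v0 \<in> U" "U \<subseteq> V" "open G" "?F ` U \<subseteq> G"
    and K: "\<And>y. y \<in> G \<Longrightarrow> K differentiable (at y)" "\<And>z. z \<in> U \<Longrightarrow> K (?F z) = z"
    by (rule immersion_local_left_inverse[OF local_paramD(1,4)[OF lp] v0(1) local_paramD(5)[OF lp v0(1)]])
      (assumption | rule that)+
  obtain r where r: "r > 0" "ball v0 r \<subseteq> U" using U(1,2) openE by blast
  then have BV: "ball v0 r \<subseteq> V" using U(3) by blast
  have "\<exists>f A. admissible_data f A \<and> (\<exists>\<phi>\<in>{immersion1 A, immersion2 A, immersion3 A}.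
      congruent_near \<phi> ?p ?q (ball v0 r) v0)"
    by (rule normal_form) (use unit_map_subset[OF pq(1) open_ball BV] unit_map_subset[OF pq(2) open_ball BV] r(1) ad BV in auto)
  then obtain f A \<phi> where A: "admissible_data f A" "\<phi> \<in> {immersion1 A, immersion2 A, immersion3 A}"
    and "congruent_near \<phi> ?p ?q (ball v0 r) v0"
    by blast
  then obtain V1 U1 a b c where V1: "open V1" "v0 \<in> V1" "V1 \<subseteq> ball v0 r" "open U1"
    "a \<in> unit_quat" "b \<in> unit_quat" "c \<in> unit_quat"
    and eq: "(\<lambda>v. (?p v, ?q v)) ` V1 = F_isom a b c ` (\<phi> ` U1)"
    unfolding congruent_near_def by blast
  have V1U: "V1 \<subseteq> U" "V1 \<subseteq> V" using V1(3) r(2) U(3) by auto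
  have "homeomorphism V1 (?F ` V1) ?F K"
  proof (rule homeomorphismI)
    show "continuous_on V1 ?F"
      by (rule continuous_on_subset[OF smooth_on_continuous[OF local_paramD(4)[OF lp]] V1U(2)])
    show "continuous_on (?F ` V1) K"
      using U(5) V1U(1) by (intro continuous_at_imp_continuous_on ballI differentiable_imp_continuous_within K(1)) blast
  qed (use K(2) V1U in auto)
  then have "embedding_map (subtopology M (\<psi> ` V1)) euclidean \<iota>"
    by (rule local_param_embedding[OF lp V1(1) V1U(2)])
  moreover have "openin M (\<psi> ` V1)" by (rule local_param_openin[OF lp V1(1) V1U(2)])
  moreover have "\<iota> ` \<psi> ` V1 = F_isom a b c ` (\<phi> ` U1)"
    using eq by (simp add: image_image)
  ultimately have "locally_congruent_at M \<iota> x \<phi>"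
    unfolding locally_congruent_at_def v0(2) using V1(2,4-7) by blast
  then show "\<exists>f A. admissible_data f A \<and>
           (\<exists>\<phi>\<in>{immersion1 A, immersion2 A, immersion3 A}. locally_congruent_at M \<iota> x \<phi>)"
    using A by blast
qed

end
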